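(* Assume that $\tilde Q_h^n\in\mathbb{X}_h$ and $\tilde u_h^n\in\mathbb{Y}_h$ are given, and let $Q_h^n=\tilde Q_h^n+\tilde q_h$ (symmetric and trace-free) and $u_h^n=\tilde u_h^n+\tilde g_h^n$. Assume that $\varepsilon_1>|\varepsilon_2|R+|\varepsilon_3|$ and $|\varepsilon_3|<\frac{L}{12}$. Then there exist $\tilde Q_h^{n+1}\in\mathbb{X}_h$ and $\tilde u_h^{n+1}\in\mathbb{Y}_h$ such that $Q_h^{n+1}=\tilde Q_h^{n+1}+\tilde q_h$ and $u_h^{n+1}=\tilde u_h^{n+1}+\tilde g_h^{n+1}$ solve the step-$n$ equations (S1)–(S2) of the scheme in the context; hence the scheme admits solutions for all $n=1,2,\dots,N$.
   Context: Setting. $d\in\{2,3\}$; $\Omega\subset\mathbb{R}^d$ is a bounded, simply connected, convex polygon/polyhedron; $T>0$. Constants: $L>0$, $\varepsilon_1>0$, $\varepsilon_2,\varepsilon_3\in\mathbb{R}$, $a,b\in\mathbb{R}$, $c>0$, $R>0$, and $\beta_1\ge\max\{|b|,a\}$, $\beta_2\ge\max\{|b|,c\}$. Notation: $|\cdot|$ is the Euclidean/Frobenius norm, $A:B=\operatorname{tr}(A^\top B)$ (and the analogous full contraction for $\nabla A:\nabla B$), $(A\odot B)_{ij}=A_{ij}B_{ij}$, $(A)_S=\frac12(A+A^\top)$, $(\operatorname{div}Q)_i=\sum_j\partial_jQ_{ij}$. Truncation. $\mathcal{T}_R:\mathbb{R}^{d\times d}\to\mathbb{R}^{d\times d}$ is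 twice continuously differentiable, acts entrywise ($\mathcal{T}_R(Q)_{ij}$ depends only on $Q_{ij}$), maps symmetric matrices to symmetric matrices, and satisfies $\mathcal{T}_R(Q)_{ij}\in[-R/d,R/d]$ with first and second derivatives of each $\mathcal{T}_R(Q)_{ij}$ bounded by a finite constant $C_{\mathcal{T}_R}>0$. For $A,B\in\mathbb{R}^{d\times d}$, $\tilde{\mathcal{P}}(A,B)_{ij}=\frac{\mathcal{T}_R(A)_{ij}-\mathcal{T}_R(B)_{ij}}{A_{ij}-B_{ij}}$ if $A_{ij}\ne B_{ij}$, and $\tilde{\mathcal{P}}(A,B)_{ij}=\frac{\partial\mathcal{T}_R(B)_{ij}}{\partial Q_{ij}}$ otherwise. Bulk terms. $\frac{\partial\mathcal{F}_1(Q)}{\partial Q}=\beta_1Q-\frac b3\big(M(Q)-\frac1d\operatorname{tr}(M(Q))I\big)+\beta_2|Q|^2Q$ with $M(Q)=QQ^\top+Q^\top Q+Q^2$ (for symmetric $Q$ this is $\beta_1Q-b(Q^2-\frac1d\operatorname{tr}(Q^2)I)+\beta_2\operatorname{tr}(Q^2)Q$), and $\frac{\partial\mathcal{F}_2(Q)}{\partial Q}=(\beta_1-a)Q+(\beta_2-c)|Q|^2Q$. Discretization. $\Delta t>0$, $t^n=n\Delta t$, $N\in\mathbb{N}$ with $N\Delta t=T$. $\mathfrak{T}_h$ is a quasi-uniform triangulation of $\Omega$ (triangles/tetrahedra) of mesh size $h$. $\mathbb{X}_h$ (resp. $\mathbb{Y}_h$) is the space of functions in $H_0^1(\Omega;\mathbb{R}^{d\times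 d})$ (resp. $H_0^1(\Omega)$) that are (componentwise) affine on each element. The boundary data have extensions $\tilde g\in L^\infty(0,T;H^1(\Omega))\cap W^{1,2}(0,T;H^1(\Omega))$ and $\tilde q\in H^1(\Omega;\mathbb{R}^{d\times d})$, $\tilde q$ symmetric and trace-free; $\tilde g_h^n$ and $\tilde q_h$ are the $L^2(\Omega)$-orthogonal projections of $\tilde g(t^n)$ and $\tilde q$ onto continuous piecewise linear functions on $\mathfrak{T}_h$. $D_t^+f^n=(f^{n+1}-f^n)/\Delta t$, $f^{n+1/2}=(f^n+f^{n+1})/2$. The scheme. Starting from symmetric trace-free $Q_h^0\in\tilde q_h+\mathbb{X}_h$ and $u_h^0\in\tilde g_h^0+\mathbb{Y}_h$, find for $n=0,\dots,N-1$ functions $Q_h^{n+1}\in\tilde q_h+\mathbb{X}_h$ and $u_h^{n+1}\in\tilde g_h^{n+1}+\mathbb{Y}_h$ such that for all $\Phi_h\in\mathbb{X}_h$, $\psi_h\in\mathbb{Y}_h$, with $\tilde{\mathcal{P}}_h^n=\tilde{\mathcal{P}}(Q_h^{n+1},Q_h^n)$: (S1) $$\begin{aligned}-\int_\Omega D_t^+Q_h^n:\Phi_h\,dx={}&L\int_\Omega\nabla Q_h^{n+1/2}:\nabla\Phi_h\,dx+\int_\Omega\Big(\frac{\partial\mathcal{F}_1(Q_h^{n+1})}{\partial Q}-\frac{\partial\mathcal{F}_2(Q_h^n)}{\partial Q}\Big):\Phi_h\,dx\\&-\frac{\varepsilon_2}{2}\int_\Omega\Big((\tilde{\mathcal{P}}_h^n\odot\nabla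 u_h^n(\nabla u_h^{n+1})^\top)_S-\frac1d\operatorname{tr}(\tilde{\mathcal{P}}_h^n\odot\nabla u_h^n(\nabla u_h^{n+1})^\top)I\Big):\Phi_h\,dx\\&-\varepsilon_3\int_\Omega\Big(\nabla u_h^{n+1/2}\cdot\operatorname{div}((\Phi_h)_S)-\frac1d\nabla u_h^{n+1/2}\cdot\nabla\operatorname{tr}\Phi_h\Big)dx,\end{aligned}$$ (S2) $$\int_\Omega(\varepsilon_1\nabla u_h^{n+1}+\varepsilon_2\mathcal{T}_R(Q_h^{n+1})\nabla u_h^{n+1}+\varepsilon_3\operatorname{div}(Q_h^{n+1}))\cdot\nabla\psi_h\,dx=0 .$$ *)

theory Defs
  imports "HOL-Analysis.Analysis"
begin

section \<open>Tensor notation\<close>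

text \<open>
  The dimension is \<open>d = CARD('n)\<close>. The contraction \<open>A : B = tr(A\<^sup>T B)\<close> is the inner
  product \<open>A \<bullet> B\<close> of \<open>real^'n^'n\<close>, and \<open>norm\<close> on this type is the Frobenius norm.
\<close>

definition hadamard :: "real^'n^'m \<Rightarrow> real^'n^'m \<Rightarrow> real^'n^'m" (infixl "\<odot>" 70) where
  "A \<odot> B = (\<chi> i j. A $ i $ j * B $ i $ j)"

definition outer :: "real^'m \<Rightarrow> real^'n \<Rightarrow> real^'n^'m" where
  "outer x y = (\<chi> i j. x $ i * y $ j)"

definition sym_part :: "real^'n^'n \<Rightarrow> real^'n^'n" where
  "sym_part A = (1/2) *\<^sub>R (A + transpose A)"

definition dev :: "real^'n^'n \<Rightarrow> real^'n^'n" where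
  "dev A = A - (trace A / real CARD('n)) *\<^sub>R mat 1"

definition sym_tracefree :: "real^'n^'n \<Rightarrow> bool" where
  "sym_tracefree A \<longleftrightarrow> transpose A = A \<and> trace A = 0"

section \<open>Classical differentiability and test functions\<close>

definition pd :: "'a::euclidean_space \<Rightarrow> ('a \<Rightarrow> 'b::real_normed_vector) \<Rightarrow> 'a \<Rightarrow> 'b" where
  "pd e f x = frechet_derivative f (at x) e"

primrec Ck :: "nat \<Rightarrow> ('a::euclidean_space \<Rightarrow> 'b::real_normed_vector) \<Rightarrow> bool" where
  "Ck 0 f \<longleftrightarrow> continuous_on UNIV f"
| "Ck (Suc k) f \<longleftrightarrow> f differentiable_on UNIV \<and> (\<forall>e\<in>Basis. Ck k (pd e f))"

definition test_fun :: "'a::euclidean_space set \<Rightarrow> ('a \<Rightarrow> 'b::real_normed_vector) \<Rightarrow> bool" where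
  "test_fun U \<phi> \<longleftrightarrow>
     (\<forall>k. Ck k \<phi>) \<and> (\<exists>K. compact K \<and> K \<subseteq> U \<and> (\<forall>x. x \<notin> K \<longrightarrow> \<phi> x = 0))"

section \<open>Sobolev spaces\<close>

text \<open>
  Functions on \<open>U\<close> are total functions whose values outside \<open>U\<close> are irrelevant.
  The value type \<open>'b\<close> is \<open>real\<close>, \<open>real^'n\<close> or \<open>real^'n^'n\<close>, so
  that the scalar and the matrix-valued spaces are instances of the same definitions.
\<close>

definition L2_on :: "(real^'n) set \<Rightarrow> (real^'n \<Rightarrow> 'b::euclidean_space) \<Rightarrow> bool" where
  "L2_on U v \<longleftrightarrow>
     set_borel_measurable lebesgue U v \<and> set_integrable lebesgue U (\<lambda>x. (norm (v x))\<^sup>2)"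

definition has_weak_partial ::
  "(real^'n) set \<Rightarrow> 'n \<Rightarrow> (real^'n \<Rightarrow> 'b::euclidean_space) \<Rightarrow> (real^'n \<Rightarrow> 'b) \<Rightarrow> bool" where
  "has_weak_partial U i v g \<longleftrightarrow> L2_on U g \<and>
     (\<forall>\<phi> :: real^'n \<Rightarrow> real. test_fun U \<phi> \<longrightarrow>
        (LINT x:U|lebesgue. pd (axis i 1) \<phi> x *\<^sub>R v x) = - (LINT x:U|lebesgue. \<phi> x *\<^sub>R g x))"

definition H1 :: "(real^'n) set \<Rightarrow> (real^'n \<Rightarrow> 'b::euclidean_space) set" where
  "H1 U = {v. L2_on U v \<and> (\<forall>i. \<exists>g. has_weak_partial U i v g)}"

text \<open>Weak partial derivatives are unique up to null sets; \<open>wpd\<close> picks a representative.\<close>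

definition wpd ::
  "(real^'n) set \<Rightarrow> 'n \<Rightarrow> (real^'n \<Rightarrow> 'b::euclidean_space) \<Rightarrow> real^'n \<Rightarrow> 'b" where
  "wpd U i v = (SOME g. has_weak_partial U i v g)"

definition H1_inner ::
  "(real^'n) set \<Rightarrow> (real^'n \<Rightarrow> 'b::euclidean_space) \<Rightarrow> (real^'n \<Rightarrow> 'b) \<Rightarrow> real" where
  "H1_inner U v w = (LINT x:U|lebesgue. v x \<bullet> w x)
     + (\<Sum>i\<in>UNIV. LINT x:U|lebesgue. wpd U i v x \<bullet> wpd U i w x)"

definition H1_norm :: "(real^'n) set \<Rightarrow> (real^'n \<Rightarrow> 'b::euclidean_space) \<Rightarrow> real" where
  "H1_norm U v = sqrt (H1_inner U v v)"

definition H10 :: "(real^'n) set \<Rightarrow> (real^'n \<Rightarrow> 'b::euclidean_space) set" where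
  "H10 U = {v \<in> H1 U. \<exists>\<phi>. (\<forall>k. test_fun U (\<phi> k)) \<and>
     (\<lambda>k::nat. H1_norm U (\<lambda>x. v x - \<phi> k x)) \<longlonglongrightarrow> 0}"

definition grad :: "(real^'n) set \<Rightarrow> (real^'n \<Rightarrow> real) \<Rightarrow> real^'n \<Rightarrow> real^'n" where
  "grad U u x = (\<chi> i. wpd U i u x)"

definition grad_contract ::
  "(real^'n) set \<Rightarrow> (real^'n \<Rightarrow> real^'n^'n) \<Rightarrow> (real^'n \<Rightarrow> real^'n^'n) \<Rightarrow> real^'n \<Rightarrow> real" where
  "grad_contract U A B x = (\<Sum>k\<in>UNIV. wpd U k A x \<bullet> wpd U k B x)"

definition diverg :: "(real^'n) set \<Rightarrow> (real^'n \<Rightarrow> real^'n^'n) \<Rightarrow> real^'n \<Rightarrow> real^'n" where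
  "diverg U Q x = (\<chi> i. \<Sum>j\<in>UNIV. wpd U j Q x $ i $ j)"

section \<open>Functions of time with values in \<open>H\<^sup>1\<close>\<close>

text \<open>Strong measurability: almost everywhere limit of \<open>H\<^sup>1\<close>-valued simple functions.\<close>

definition strongly_measurable_H1 ::
  "(real^'n) set \<Rightarrow> real \<Rightarrow> (real \<Rightarrow> real^'n \<Rightarrow> real) \<Rightarrow> bool" where
  "strongly_measurable_H1 U T g \<longleftrightarrow>
     (\<exists>s :: nat \<Rightarrow> real \<Rightarrow> real^'n \<Rightarrow> real.
        (\<forall>k. finite (s k ` {0<..<T}) \<and> s k ` {0<..<T} \<subseteq> H1 U \<and>
             (\<forall>v. {t \<in> {0<..<T}. s k t = v} \<in> sets lebesgue)) \<and>
        (AE t in lebesgue. t \<in> {0<..<T} \<longrightarrow>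
           (\<lambda>k. H1_norm U (\<lambda>x. s k t x - g t x)) \<longlonglongrightarrow> 0))"

definition L2_time_H1 :: "(real^'n) set \<Rightarrow> real \<Rightarrow> (real \<Rightarrow> real^'n \<Rightarrow> real) set" where
  "L2_time_H1 U T = {g. (AE t in lebesgue. t \<in> {0<..<T} \<longrightarrow> g t \<in> H1 U) \<and>
     strongly_measurable_H1 U T g \<and>
     set_integrable lebesgue {0<..<T} (\<lambda>t. (H1_norm U (g t))\<^sup>2)}"

definition Linf_time_H1 :: "(real^'n) set \<Rightarrow> real \<Rightarrow> (real \<Rightarrow> real^'n \<Rightarrow> real) set" where
  "Linf_time_H1 U T = {g. (AE t in lebesgue. t \<in> {0<..<T} \<longrightarrow> g t \<in> H1 U) \<and>
     strongly_measurable_H1 U T g \<and>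
     (\<exists>M. AE t in lebesgue. t \<in> {0<..<T} \<longrightarrow> H1_norm U (g t) \<le> M)}"

text \<open>
  The identity \<open>\<integral> \<phi>' g dt = - \<integral> \<phi> g' dt\<close> between Bochner integrals in the Hilbert space
  \<open>H\<^sup>1\<close> is expressed by pairing both sides with every element of \<open>H\<^sup>1\<close>.
\<close>

definition W12_time_H1 :: "(real^'n) set \<Rightarrow> real \<Rightarrow> (real \<Rightarrow> real^'n \<Rightarrow> real) set" where
  "W12_time_H1 U T = {g \<in> L2_time_H1 U T. \<exists>g' \<in> L2_time_H1 U T.
     \<forall>\<phi> :: real \<Rightarrow> real. test_fun {0<..<T} \<phi> \<longrightarrow> (\<forall>v \<in> H1 U.
       (LINT t:{0<..<T}|lebesgue. deriv \<phi> t * H1_inner U (g t) v) =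
       - (LINT t:{0<..<T}|lebesgue. \<phi> t * H1_inner U (g' t) v))}"

text \<open>
  A class in \<open>W\<^sup>1\<^sup>,\<^sup>2(0,T;H\<^sup>1)\<close> has exactly one representative that is continuous on \<open>[0,T]\<close>;
  the point values \<open>g(t\<^sup>n)\<close> are those of that representative.
\<close>

definition continuous_time_H1 ::
  "(real^'n) set \<Rightarrow> real \<Rightarrow> (real \<Rightarrow> real^'n \<Rightarrow> real) \<Rightarrow> bool" where
  "continuous_time_H1 U T g \<longleftrightarrow> (\<forall>t\<in>{0..T}. g t \<in> H1 U \<and>
     ((\<lambda>s. H1_norm U (\<lambda>x. g s x - g t x)) \<longlongrightarrow> 0) (at t within {0..T}))"

section \<open>Domain, mesh and finite element spaces\<close>

definition polyhedral_domain :: "(real^'n) set \<Rightarrow> bool" where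
  "polyhedral_domain U \<longleftrightarrow> open U \<and> U \<noteq> {} \<and> bounded U \<and> simply_connected U \<and> convex U \<and>
     polytope (closure U)"

text \<open>
  Elements are closed \<open>d\<close>-simplices; \<open>triangulation\<close> makes the mesh conforming.
  \<open>\<rho>\<close> is the quasi-uniformity constant of the family of meshes.
\<close>

definition quasi_uniform_mesh ::
  "(real^'n) set \<Rightarrow> real \<Rightarrow> real \<Rightarrow> (real^'n) set set \<Rightarrow> bool" where
  "quasi_uniform_mesh U \<rho> h \<T> \<longleftrightarrow>
     triangulation \<T> \<and> (\<forall>K\<in>\<T>. int CARD('n) simplex K) \<and> \<Union>\<T> = closure U \<and>
     h = Max (diameter ` \<T>) \<and> (\<forall>K\<in>\<T>. \<exists>x. ball x (\<rho> * h) \<subseteq> K)"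

definition affine_on_elements ::
  "(real^'n) set set \<Rightarrow> (real^'n \<Rightarrow> 'b::euclidean_space) \<Rightarrow> bool" where
  "affine_on_elements \<T> v \<longleftrightarrow> (\<forall>K\<in>\<T>. \<exists>A c. linear A \<and> (\<forall>x\<in>K. v x = A x + c))"

definition P1_space ::
  "(real^'n) set \<Rightarrow> (real^'n) set set \<Rightarrow> (real^'n \<Rightarrow> 'b::euclidean_space) set" where
  "P1_space U \<T> = {v. continuous_on (closure U) v \<and> affine_on_elements \<T> v}"

text \<open>
  \<open>P1_zero U \<T>\<close> is the space \<open>\<X>\<^sub>h\<close> for \<open>'b = real^'n^'n\<close> and \<open>\<Y>\<^sub>h\<close> for \<open>'b = real\<close>.
  Being affine on the closed elements, its members are continuous on \<open>closure U\<close>.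
\<close>

definition P1_zero ::
  "(real^'n) set \<Rightarrow> (real^'n) set set \<Rightarrow> (real^'n \<Rightarrow> 'b::euclidean_space) set" where
  "P1_zero U \<T> = {v \<in> H10 U. affine_on_elements \<T> v}"

definition is_L2_projection ::
  "(real^'n) set \<Rightarrow> (real^'n) set set \<Rightarrow> (real^'n \<Rightarrow> 'b::euclidean_space) \<Rightarrow>
     (real^'n \<Rightarrow> 'b) \<Rightarrow> bool" where
  "is_L2_projection U \<T> w p \<longleftrightarrow> p \<in> P1_space U \<T> \<and>
     (\<forall>v \<in> P1_space U \<T>. (LINT x:U|lebesgue. (w x - p x) \<bullet> v x) = 0)"

section \<open>Truncation and bulk terms\<close>

definition truncation ::
  "real \<Rightarrow> real \<Rightarrow> (real^'n^'n \<Rightarrow> real^'n^'n) \<Rightarrow> bool" where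
  "truncation R C TR \<longleftrightarrow> Ck 2 TR \<and>
     (\<forall>A B i j. A $ i $ j = B $ i $ j \<longrightarrow> TR A $ i $ j = TR B $ i $ j) \<and>
     (\<forall>A. transpose A = A \<longrightarrow> transpose (TR A) = TR A) \<and>
     (\<forall>A i j. TR A $ i $ j \<in> {- (R / real CARD('n)) .. R / real CARD('n)}) \<and>
     (\<forall>A i j. \<forall>E\<in>Basis. \<bar>pd E (\<lambda>Q. TR Q $ i $ j) A\<bar> \<le> C) \<and>
     (\<forall>A i j. \<forall>E\<in>Basis. \<forall>F\<in>Basis. \<bar>pd F (pd E (\<lambda>Q. TR Q $ i $ j)) A\<bar> \<le> C)"

definition Ptilde ::
  "(real^'n^'n \<Rightarrow> real^'n^'n) \<Rightarrow> real^'n^'n \<Rightarrow> real^'n^'n \<Rightarrow> real^'n^'n" where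
  "Ptilde TR A B = (\<chi> i j.
     if A $ i $ j \<noteq> B $ i $ j then (TR A $ i $ j - TR B $ i $ j) / (A $ i $ j - B $ i $ j)
     else pd (axis i (axis j 1)) (\<lambda>Q. TR Q $ i $ j) B)"

definition dF1 :: "real \<Rightarrow> real \<Rightarrow> real \<Rightarrow> real^'n^'n \<Rightarrow> real^'n^'n" where
  "dF1 b \<beta>1 \<beta>2 Q = \<beta>1 *\<^sub>R Q
     - (b / 3) *\<^sub>R dev (Q ** transpose Q + transpose Q ** Q + Q ** Q)
     + (\<beta>2 * (norm Q)\<^sup>2) *\<^sub>R Q"

definition dF2 :: "real \<Rightarrow> real \<Rightarrow> real \<Rightarrow> real \<Rightarrow> real^'n^'n \<Rightarrow> real^'n^'n" where
  "dF2 a c \<beta>1 \<beta>2 Q = (\<beta>1 - a) *\<^sub>R Q + ((\<beta>2 - c) * (norm Q)\<^sup>2) *\<^sub>R Q"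

section \<open>The scheme\<close>

definition midpoint_fun ::
  "(real^'n \<Rightarrow> 'b::real_vector) \<Rightarrow> (real^'n \<Rightarrow> 'b) \<Rightarrow> real^'n \<Rightarrow> 'b" where
  "midpoint_fun f0 f1 x = (1/2) *\<^sub>R (f0 x + f1 x)"

text \<open>In both equations \<open>(Q0, u0)\<close> is the old and \<open>(Q1, u1)\<close> the new time level.\<close>

definition eq_S1 ::
  "(real^'n) set \<Rightarrow> (real^'n^'n \<Rightarrow> real^'n^'n) \<Rightarrow> real \<Rightarrow> real \<Rightarrow> real \<Rightarrow>
   real \<Rightarrow> real \<Rightarrow> real \<Rightarrow> real \<Rightarrow> real \<Rightarrow> real \<Rightarrow>
   (real^'n \<Rightarrow> real^'n^'n) \<Rightarrow> (real^'n \<Rightarrow> real) \<Rightarrow>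
   (real^'n \<Rightarrow> real^'n^'n) \<Rightarrow> (real^'n \<Rightarrow> real) \<Rightarrow>
   (real^'n \<Rightarrow> real^'n^'n) \<Rightarrow> bool" where
  "eq_S1 U TR L \<epsilon>2 \<epsilon>3 a b c \<beta>1 \<beta>2 \<Delta>t Q0 u0 Q1 u1 \<Phi> \<longleftrightarrow>
     - (LINT x:U|lebesgue. ((1 / \<Delta>t) *\<^sub>R (Q1 x - Q0 x)) \<bullet> \<Phi> x)
     = L * (LINT x:U|lebesgue. grad_contract U (midpoint_fun Q0 Q1) \<Phi> x)
     + (LINT x:U|lebesgue. (dF1 b \<beta>1 \<beta>2 (Q1 x) - dF2 a c \<beta>1 \<beta>2 (Q0 x)) \<bullet> \<Phi> x)
     - (\<epsilon>2 / 2) * (LINT x:U|lebesgue.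
         (let G = Ptilde TR (Q1 x) (Q0 x) \<odot> outer (grad U u0 x) (grad U u1 x)
          in (sym_part G - (1 / real CARD('n)) *\<^sub>R trace G *\<^sub>R mat 1) \<bullet> \<Phi> x))
     - \<epsilon>3 * (LINT x:U|lebesgue.
         grad U (midpoint_fun u0 u1) x \<bullet> diverg U (\<lambda>y. sym_part (\<Phi> y)) x
         - (1 / real CARD('n)) *
           (grad U (midpoint_fun u0 u1) x \<bullet> grad U (\<lambda>y. trace (\<Phi> y)) x))"

definition eq_S2 ::
  "(real^'n) set \<Rightarrow> (real^'n^'n \<Rightarrow> real^'n^'n) \<Rightarrow> real \<Rightarrow> real \<Rightarrow> real \<Rightarrow>
   (real^'n \<Rightarrow> real^'n^'n) \<Rightarrow> (real^'n \<Rightarrow> real) \<Rightarrow> (real^'n \<Rightarrow> real) \<Rightarrow> bool" where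
  "eq_S2 U TR \<epsilon>1 \<epsilon>2 \<epsilon>3 Q1 u1 \<psi> \<longleftrightarrow>
     (LINT x:U|lebesgue.
        (\<epsilon>1 *\<^sub>R grad U u1 x + \<epsilon>2 *\<^sub>R (TR (Q1 x) *v grad U u1 x) + \<epsilon>3 *\<^sub>R diverg U Q1 x)
        \<bullet> grad U \<psi> x) = 0"

end

(*
In a finite-dimensional space the quartic term \<beta>2 |Q|^2 Q of the bulk force beats every other term of
(S1), all of which grow at most cubically in Q and linearly in \<nabla>u, while (S2) is elliptic in \<nabla>u because
the truncated coefficient satisfies |T_R| \<le> R. So the joint system for (Q, u) is coercive: tested with the
unknowns themselves it is nonnegative on a large sphere of coefficients, and Brouwer's theorem gives a
zero. Neither an a priori energy estimate nor Poincare's inequality is needed, since only \<nabla>u occurs.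

The weak derivatives of the scheme are chosen representatives, so two facts link them to piecewise
gradients: they are unique almost everywhere (fundamental lemma of the calculus of variations), and a
Lipschitz function that is differentiable almost everywhere has its classical gradient as weak gradient.
*)

theory Submission
  imports Defs
begin

text \<open>The equations are tested with the homogeneous parts of the unknowns, so the boundary
  extensions stay inside the nonlinear terms as bounded perturbations. On one fixed mesh all basis
  functions and their weak gradients are essentially bounded, hence the terms can be compared
  pointwise; the constants depend on the mesh and on the old time level, which is harmless for
  existence. \<open>Q\<close> is expanded in an L2-orthonormal basis with coefficient norm
  \<open>s\<close>, \<open>u\<close> in a basis orthonormal for the Dirichlet form with coefficient
  norm \<open>G\<close>. Then the quartic term contributes a multiple of \<open>s ^ 4\<close>, the
  elliptic term a multiple of \<open>G ^ 2\<close>, and the mixed terms of size \<open>s * G\<close>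
  are split by Young's inequality. Two features of the encoding shape the rest. Functions are total
  with arbitrary values off the domain, so the finite element spaces are finite-dimensional only
  modulo the null functions of a degenerate form. And \<open>wpd\<close> is a choice, hence linear
  only almost everywhere, so that even closure of \<open>H10\<close> under addition has to be
  earned.\<close>

section \<open>Brouwer's theorem in coordinates and zeros of coercive maps\<close>

lemma convergent_subseq_coordinates:
  fixes X :: "nat \<Rightarrow> nat \<Rightarrow> real"
  assumes "\<And>k j. j < n \<Longrightarrow> \<bar>X k j\<bar> \<le> B"
  shows "\<exists>\<sigma> x. strict_mono \<sigma> \<and> (\<forall>j<n. (\<lambda>k. X (\<sigma> k) j) \<longlonglongrightarrow> x j)"
  using assms
proof (induction n)
  case 0
  show ?case by (intro exI[of _ id]) (auto simp: strict_mono_def)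
next
  case (Suc n)
  then obtain \<sigma> x where \<sigma>: "strict_mono \<sigma>" "\<forall>j<n. (\<lambda>k. X (\<sigma> k) j) \<longlonglongrightarrow> x j"
    by force
  have "bounded (range (\<lambda>k. X (\<sigma> k) n))"
    using Suc.prems[of n] by (auto simp: bounded_iff)
  then obtain l \<tau> where \<tau>: "strict_mono \<tau>" "((\<lambda>k. X (\<sigma> k) n) \<circ> \<tau>) \<longlonglongrightarrow> l"
    using bounded_imp_convergent_subsequence by blast
  have "(\<lambda>k. X ((\<sigma> \<circ> \<tau>) k) j) \<longlonglongrightarrow> (x(n := l)) j" if "j < Suc n" for j
  proof (cases "j = n")
    case True
    then show ?thesis using \<tau>(2) by (simp add: o_def)
  next
    case False
    with that have "(\<lambda>k. X (\<sigma> k) j) \<longlonglongrightarrow> x j" using \<sigma>(2) by simp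
    from LIMSEQ_subseq_LIMSEQ[OF this \<tau>(1)] show ?thesis
      using False by (simp add: o_def)
  qed
  then show ?case
    using strict_mono_o[OF \<sigma>(1) \<tau>(1)] by blast
qed

text \<open>
  The library states Brouwer's theorem for a type of class \<open>euclidean_space\<close>; below the
  dimension is that of a finite element space, a number obtained inside a proof, so the theorem is
  derived again from Kuhn's combinatorial lemma for coordinates \<open>i < n\<close>.
\<close>

lemma brouwer_unit_cube_nat:
  fixes f :: "(nat \<Rightarrow> real) \<Rightarrow> nat \<Rightarrow> real"
  assumes cont: "\<And>X x i. i < n \<Longrightarrow> (\<And>j. j < n \<Longrightarrow> (\<lambda>k. X k j) \<longlonglongrightarrow> x j) \<Longrightarrow>
                   (\<lambda>k. f (X k) i) \<longlonglongrightarrow> f x i"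
    and range: "\<And>x i. i < n \<Longrightarrow> 0 \<le> f x i \<and> f x i \<le> 1"
  shows "\<exists>x. \<forall>i<n. f x i = x i"
proof -
  \<comment> \<open>\<open>Q\<close> is a corner of a grid cell of side \<open>1 / Suc k\<close>.
    For each \<open>i\<close>, \<open>A i\<close> and \<open>B i\<close> are points close to it at
    which the displacement \<open>f x i - x i\<close> in direction \<open>i\<close> is nonnegative
    and nonpositive, respectively.\<close>
  define P where "P k Q A B \<longleftrightarrow> (\<forall>j<n. 0 \<le> Q j \<and> Q j \<le> 1) \<and>
      (\<forall>i<n. (\<forall>j<n. \<bar>A i j - Q j\<bar> \<le> 1 / real (Suc k) \<and> \<bar>B i j - Q j\<bar> \<le> 1 / real (Suc k)) \<and>
             A i i \<le> f (A i) i \<and> f (B i) i \<le> B i i)" for k Q A B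
  have step: "\<exists>Q A B. P k Q A B" for k
  proof -
    define p where "p = Suc k"
    have p: "p > 0" by (simp add: p_def)
    define sc where "sc x = (\<lambda>j. real (x j) / real p)" for x :: "nat \<Rightarrow> nat"
    \<comment> \<open>Label 1 says that \<open>f\<close> does not increase coordinate
      \<open>i\<close>, label 0 that it does not decrease it. Kuhn's lemma prescribes 0 on the face
      \<open>x i = 0\<close> and 1 on the face \<open>x i = p\<close>; both are consistent with this
      reading because \<open>f\<close> maps into the unit cube.\<close>
    define label :: "(nat \<Rightarrow> nat) \<Rightarrow> nat \<Rightarrow> nat" where
      "label x i = (if x i = p \<or> (x i \<noteq> 0 \<and> f (sc x) i < sc x i) then 1 else 0)" for x i
    have l0: "sc x i \<le> f (sc x) i" if "label x i = 0" "i < n" for x i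
      using that range[of i "sc x"] p by (auto simp: label_def sc_def split: if_splits)
    have l1: "f (sc x) i \<le> sc x i" if "label x i = 1" "i < n" for x i
      using that range[of i "sc x"] p by (auto simp: label_def sc_def split: if_splits)
    obtain q where q: "\<forall>i<n. q i < p"
      and rs: "\<forall>i<n. \<exists>r s. (\<forall>j<n. q j \<le> r j \<and> r j \<le> q j + 1) \<and>
                 (\<forall>j<n. q j \<le> s j \<and> s j \<le> q j + 1) \<and> label r i \<noteq> label s i"
      by (rule kuhn_lemma[OF p, of n label]) (use p in \<open>auto simp: label_def\<close>)
    have near: "\<bar>sc r j - sc q j\<bar> \<le> 1 / real p" if "q j \<le> r j" "r j \<le> q j + 1" for r j
    proof -
      have "sc r j - sc q j = (real (r j) - real (q j)) / real p"
        by (simp add: sc_def diff_divide_distrib)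
      also have "\<bar>\<dots>\<bar> \<le> 1 / real p"
        using that p by (simp add: divide_right_mono)
      finally show ?thesis .
    qed
    have "\<exists>a b. (\<forall>j<n. \<bar>a j - sc q j\<bar> \<le> 1 / real p \<and> \<bar>b j - sc q j\<bar> \<le> 1 / real p) \<and>
             a i \<le> f a i \<and> f b i \<le> b i" if i: "i < n" for i
    proof -
      from rs i obtain r s where r: "\<forall>j<n. q j \<le> r j \<and> r j \<le> q j + 1"
        and s: "\<forall>j<n. q j \<le> s j \<and> s j \<le> q j + 1" and ne: "label r i \<noteq> label s i" by blast
      have "label x i = 0 \<or> label x i = 1" for x by (simp add: label_def)
      with ne consider "label r i = 0" "label s i = 1" | "label s i = 0" "label r i = 1"
        by metis
      then show ?thesis
      proof cases
        case 1
        then show ?thesis using l0[OF 1(1) i] l1[OF 1(2) i] near r s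
          by (intro exI[of _ "sc r"] exI[of _ "sc s"]) auto
      next
        case 2
        then show ?thesis using l0[OF 2(1) i] l1[OF 2(2) i] near r s
          by (intro exI[of _ "sc s"] exI[of _ "sc r"]) auto
      qed
    qed
    then obtain A B where "\<forall>i<n. (\<forall>j<n. \<bar>A i j - sc q j\<bar> \<le> 1 / real p \<and> \<bar>B i j - sc q j\<bar> \<le> 1 / real p) \<and>
             A i i \<le> f (A i) i \<and> f (B i) i \<le> B i i"
      by metis
    moreover have "\<forall>j<n. 0 \<le> sc q j \<and> sc q j \<le> 1"
      using q p by (auto simp: sc_def intro: less_imp_le)
    ultimately show ?thesis unfolding p_def P_def by blast
  qed
  then obtain Q A B where "\<And>k. P k (Q k) (A k) (B k)" by metis
  then have Q: "\<And>k j. j < n \<Longrightarrow> 0 \<le> Q k j \<and> Q k j \<le> 1"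
    and A: "\<And>k i j. i < n \<Longrightarrow> j < n \<Longrightarrow> \<bar>A k i j - Q k j\<bar> \<le> 1 / real (Suc k)"
    and B: "\<And>k i j. i < n \<Longrightarrow> j < n \<Longrightarrow> \<bar>B k i j - Q k j\<bar> \<le> 1 / real (Suc k)"
    and Af: "\<And>k i. i < n \<Longrightarrow> A k i i \<le> f (A k i) i"
    and Bf: "\<And>k i. i < n \<Longrightarrow> f (B k i) i \<le> B k i i"
    unfolding P_def by blast+
  \<comment> \<open>A subsequence of the corners converges, and the points \<open>A\<close> and
    \<open>B\<close> follow it since the cells shrink. In the limit the two opposite inequalities
    hold at the same point.\<close>
  obtain \<sigma> x where \<sigma>: "strict_mono \<sigma>" and x: "\<And>j. j < n \<Longrightarrow> (\<lambda>k. Q (\<sigma> k) j) \<longlonglongrightarrow> x j"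
    using convergent_subseq_coordinates[of n Q 1] Q by (metis abs_of_nonneg)
  have lim: "(\<lambda>k. P (\<sigma> k) j) \<longlonglongrightarrow> x j"
    if "\<And>k. \<bar>P k j - Q k j\<bar> \<le> 1 / real (Suc k)" "j < n" for P j
  proof -
    have "(\<lambda>k. P k j - Q k j) \<longlonglongrightarrow> 0"
      by (rule Lim_null_comparison[OF _ LIMSEQ_Suc[OF lim_1_over_n]]) (use that in simp)
    from LIMSEQ_subseq_LIMSEQ[OF this \<sigma>] have "(\<lambda>k. P (\<sigma> k) j - Q (\<sigma> k) j) \<longlonglongrightarrow> 0"
      by (simp add: o_def)
    from tendsto_add[OF this x[OF that(2)]] show ?thesis by simp
  qed
  have "f x i = x i" if i: "i < n" for i
  proof (rule antisym)
    have limA: "(\<lambda>k. A (\<sigma> k) i j) \<longlonglongrightarrow> x j" if "j < n" for j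
      using lim[of "\<lambda>k. A k i"] A i that by simp
    have limB: "(\<lambda>k. B (\<sigma> k) i j) \<longlonglongrightarrow> x j" if "j < n" for j
      using lim[of "\<lambda>k. B k i"] B i that by simp
    show "x i \<le> f x i"
      by (rule LIMSEQ_le[OF limA[OF i] cont[OF i limA]]) (use Af i in auto)
    show "f x i \<le> x i"
      by (rule LIMSEQ_le[OF cont[OF i limB] limB[OF i]]) (use Bf i in auto)
  qed
  then show ?thesis by blast
qed

text \<open>Without a zero, \<open>- r F / |F|\<close> would be a continuous map of the ball of
  radius \<open>r\<close> into its sphere. At a fixed point \<open>x\<close> of this map
  \<open>F x\<close> is a negative multiple of \<open>x\<close>, so that the pairing of
  \<open>F x\<close> with \<open>x\<close> is negative on the sphere, against coercivity.\<close>

lemma coercive_map_has_zero: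
  fixes F :: "(nat \<Rightarrow> real) \<Rightarrow> nat \<Rightarrow> real"
  assumes cont: "\<And>X x i. i < n \<Longrightarrow> (\<And>j. j < n \<Longrightarrow> (\<lambda>k. X k j) \<longlonglongrightarrow> x j) \<Longrightarrow>
                   (\<lambda>k. F (X k) i) \<longlonglongrightarrow> F x i"
    and r: "r > 0"
    and coercive: "\<And>x. (\<Sum>i<n. (x i)\<^sup>2) = r\<^sup>2 \<Longrightarrow> 0 \<le> (\<Sum>i<n. F x i * x i)"
  shows "\<exists>x. \<forall>i<n. F x i = 0"
proof (rule ccontr)
  assume neg: "\<not> ?thesis"
  define nrm where "nrm x = sqrt (\<Sum>i<n. (x i)\<^sup>2)" for x :: "nat \<Rightarrow> real"
  have nrm_sq: "(nrm x)\<^sup>2 = (\<Sum>i<n. (x i)\<^sup>2)" for x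
    by (simp add: nrm_def sum_nonneg)
  have F0: "nrm (F x) > 0" for x
  proof -
    obtain i where "i < n" "F x i \<noteq> 0" using neg by blast
    then have "(\<Sum>i<n. (F x i)\<^sup>2) > 0"
      by (intro sum_pos2[of _ i]) auto
    then show ?thesis by (simp add: nrm_def)
  qed
  \<comment> \<open>\<open>sh\<close> stretches the unit cube to the cube of half side
    \<open>r\<close>, and \<open>\<pi>\<close> retracts radially onto the ball. In these coordinates
    \<open>f\<close> is \<open>- r F / |F|\<close> after the retraction; it is defined on all
    points, so no domain has to be carried along.\<close>
  define \<pi> where "\<pi> x = (\<lambda>i. r * x i / max r (nrm x))" for x
  define sh where "sh y = (\<lambda>i. r * (2 * y i - 1))" for y :: "nat \<Rightarrow> real"
  define f where "f y i = (1 - F (\<pi> (sh y)) i / nrm (F (\<pi> (sh y)))) / 2" for y i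
  have max_pos: "max r t \<noteq> 0" for t using r by auto
  have "\<exists>y. \<forall>i<n. f y i = y i"
  proof (rule brouwer_unit_cube_nat)
    fix X :: "nat \<Rightarrow> nat \<Rightarrow> real" and x :: "nat \<Rightarrow> real" and i assume i: "i < n" and lim: "\<And>j. j < n \<Longrightarrow> (\<lambda>k. X k j) \<longlonglongrightarrow> x j"
    have s: "(\<lambda>k. sh (X k) j) \<longlonglongrightarrow> sh x j" if "j < n" for j
      unfolding sh_def using lim[OF that] by (intro tendsto_intros)
    have "(\<lambda>k. nrm (sh (X k))) \<longlonglongrightarrow> nrm (sh x)"
      unfolding nrm_def using s by (intro tendsto_intros) auto
    then have p: "(\<lambda>k. \<pi> (sh (X k)) j) \<longlonglongrightarrow> \<pi> (sh x) j" if "j < n" for j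
      unfolding \<pi>_def using s[OF that] max_pos by (intro tendsto_intros)
    have FF: "(\<lambda>k. F (\<pi> (sh (X k))) j) \<longlonglongrightarrow> F (\<pi> (sh x)) j" if "j < n" for j
      by (rule cont[OF that p])
    then have "(\<lambda>k. nrm (F (\<pi> (sh (X k))))) \<longlonglongrightarrow> nrm (F (\<pi> (sh x)))"
      unfolding nrm_def by (intro tendsto_intros) auto
    then show "(\<lambda>k. f (X k) i) \<longlonglongrightarrow> f x i"
      unfolding f_def using FF[OF i] F0[of "\<pi> (sh x)"] by (intro tendsto_intros) auto
  next
    fix y :: "nat \<Rightarrow> real" and i assume i: "i < n"
    have "\<bar>F x i\<bar> \<le> nrm (F x)" for x
    proof -
      have "(F x i)\<^sup>2 \<le> (\<Sum>i<n. (F x i)\<^sup>2)"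
        using i by (intro member_le_sum) auto
      then show ?thesis unfolding nrm_def by (simp add: real_le_rsqrt)
    qed
    then have "\<bar>F x i / nrm (F x)\<bar> \<le> 1" for x
      using F0[of x] by (simp add: abs_le_iff)
    from this[of "\<pi> (sh y)"] show "0 \<le> f y i \<and> f y i \<le> 1"
      unfolding f_def abs_le_iff by simp
  qed
  then obtain y where y: "\<And>i. i < n \<Longrightarrow> f y i = y i" by blast
  define x where "x = sh y"
  define v where "v = F (\<pi> x)"
  have v0: "nrm v > 0" using F0 by (simp add: v_def)
  have x: "x i = - r * v i / nrm v" if "i < n" for i
  proof -
    have "2 * y i - 1 = - (v i / nrm v)"
      using y[OF that] unfolding f_def v_def x_def by simp
    then show ?thesis by (simp add: x_def sh_def)
  qed
  \<comment> \<open>The fixed point lies on the sphere itself, so the retraction leaves it in place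
    and the coercivity assumption applies to it.\<close>
  have "(\<Sum>i<n. (x i)\<^sup>2) = (\<Sum>i<n. (r / nrm v)\<^sup>2 * (v i)\<^sup>2)"
    by (rule sum.cong) (auto simp: x power_divide power_mult_distrib)
  also have "\<dots> = (r / nrm v)\<^sup>2 * (nrm v)\<^sup>2"
    by (simp add: nrm_sq sum_distrib_left)
  also have "\<dots> = r\<^sup>2" using v0 by (simp add: power_divide)
  finally have xr: "(\<Sum>i<n. (x i)\<^sup>2) = r\<^sup>2" .
  then have "nrm x = r" using r by (simp add: nrm_def)
  then have "\<pi> x = x" using r by (simp add: \<pi>_def)
  then have "0 \<le> (\<Sum>i<n. v i * x i)"
    using coercive[OF xr] by (simp add: v_def)
  also have "\<dots> = (\<Sum>i<n. - (r / nrm v) * (v i)\<^sup>2)"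
    by (rule sum.cong) (auto simp: x power2_eq_square)
  also have "\<dots> = - (r / nrm v) * (nrm v)\<^sup>2"
    by (simp add: nrm_sq sum_distrib_left sum_negf)
  also have "\<dots> < 0" using r v0 by simp
  finally show False by simp
qed

section \<open>Calculus of the classes \<open>Ck\<close> and of test functions\<close>

lemma pd_eqI:
  assumes "(f has_derivative f') (at x)"
  shows "pd e f x = f' e"
  using frechet_derivative_at[OF assms] by (simp add: pd_def)

lemma Ck_differentiable: "Ck (Suc k) f \<Longrightarrow> f differentiable (at x)"
  by (simp add: differentiable_on_def)

lemma Ck_continuous: "Ck k f \<Longrightarrow> continuous_on UNIV f"
  by (cases k) (auto intro: differentiable_imp_continuous_on)

text \<open>Serves the product rule: each of its terms keeps one factor undifferentiated, and that
  factor has to be lowered by one order of smoothness.\<close>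

lemma Ck_SucD: "Ck (Suc k) f \<Longrightarrow> Ck k f"
proof (induction k arbitrary: f)
  case 0
  then show ?case using Ck_continuous by fastforce
next
  case (Suc k)
  show ?case unfolding Ck.simps(2)[of k]
  proof (intro conjI ballI)
    show "f differentiable_on UNIV" using Suc.prems by simp
    fix e :: 'a assume "e \<in> Basis"
    then have "Ck (Suc k) (pd e f)" using Suc.prems unfolding Ck.simps(2)[of "Suc k"] by blast
    then show "Ck k (pd e f)" by (rule Suc.IH)
  qed
qed

lemma pd_add:
  assumes "f differentiable (at x)" "g differentiable (at x)"
  shows "pd e (\<lambda>x. f x + g x) x = pd e f x + pd e g x"
  using pd_eqI[OF has_derivative_add[OF assms[unfolded frechet_derivative_works]], of e]
  by (simp add: pd_def)

lemma pd_scaleR: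
  assumes "f differentiable (at x)"
  shows "pd e (\<lambda>x. c *\<^sub>R f x) x = c *\<^sub>R pd e f x"
  using pd_eqI[OF has_derivative_scaleR_right[OF assms[unfolded frechet_derivative_works]], of e]
  by (simp add: pd_def)

lemma pd_mult:
  fixes f g :: "'a::euclidean_space \<Rightarrow> real"
  assumes "f differentiable (at x)" "g differentiable (at x)"
  shows "pd e (\<lambda>x. f x * g x) x = pd e f x * g x + f x * pd e g x"
  using pd_eqI[OF has_derivative_mult[OF assms[unfolded frechet_derivative_works]], of e]
  by (simp add: pd_def)

lemma Ck_const: "Ck k (\<lambda>x. c)"
proof (induction k arbitrary: c)
  case (Suc k)
  have "pd e (\<lambda>x::'a. c) = (\<lambda>x. 0)" for e
    by (rule ext, rule pd_eqI) (rule has_derivative_const)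
  with Suc show ?case by simp
qed simp

lemma Ck_add: "Ck k f \<Longrightarrow> Ck k g \<Longrightarrow> Ck k (\<lambda>x. f x + g x)"
proof (induction k arbitrary: f g)
  case (Suc k)
  have "pd e (\<lambda>x. f x + g x) = (\<lambda>x. pd e f x + pd e g x)" for e
    by (rule ext, rule pd_add) (use Suc.prems in \<open>auto intro: Ck_differentiable simp del: Ck.simps\<close>)
  with Suc show ?case by (auto intro: differentiable_on_add)
qed (auto intro: continuous_intros)

lemma Ck_scaleR: "Ck k f \<Longrightarrow> Ck k (\<lambda>x. c *\<^sub>R f x)"
proof (induction k arbitrary: f)
  case (Suc k)
  have "pd e (\<lambda>x. c *\<^sub>R f x) = (\<lambda>x. c *\<^sub>R pd e f x)" for e
    by (rule ext, rule pd_scaleR) (use Suc.prems in \<open>auto intro: Ck_differentiable simp del: Ck.simps\<close>)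
  with Suc show ?case
    by (auto simp: differentiable_on_def)
qed (auto intro: continuous_intros)

lemma Ck_mult:
  fixes f g :: "'a::euclidean_space \<Rightarrow> real"
  shows "Ck k f \<Longrightarrow> Ck k g \<Longrightarrow> Ck k (\<lambda>x. f x * g x)"
proof (induction k arbitrary: f g)
  case (Suc k)
  have "pd e (\<lambda>x. f x * g x) = (\<lambda>x. pd e f x * g x + f x * pd e g x)" for e
    by (rule ext, rule pd_mult) (use Suc.prems in \<open>auto intro: Ck_differentiable simp del: Ck.simps\<close>)
  moreover have "Ck k (\<lambda>x. pd e f x * g x + f x * pd e g x)" if "e \<in> Basis" for e
    using Suc.prems that Ck_SucD[OF Suc.prems(1)] Ck_SucD[OF Suc.prems(2)]
    by (intro Ck_add Suc.IH) auto
  ultimately show ?case using Suc.prems by (auto intro: differentiable_on_mult)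
qed (auto intro: continuous_intros)

lemma Ck_prod:
  fixes f :: "'i \<Rightarrow> 'a::euclidean_space \<Rightarrow> real"
  assumes "\<And>i. i \<in> I \<Longrightarrow> Ck k (f i)"
  shows "Ck k (\<lambda>x. \<Prod>i\<in>I. f i x)"
  using assms
  by (induction I rule: infinite_finite_induct) (auto intro: Ck_mult Ck_const)

lemma test_fun_add:
  assumes "test_fun U \<phi>" "test_fun U \<psi>"
  shows "test_fun U (\<lambda>x. \<phi> x + \<psi> x)"
proof -
  obtain K L where "compact K" "K \<subseteq> U" "\<forall>x. x \<notin> K \<longrightarrow> \<phi> x = 0"
    and "compact L" "L \<subseteq> U" "\<forall>x. x \<notin> L \<longrightarrow> \<psi> x = 0"
    using assms unfolding test_fun_def by blast
  moreover from this have "compact (K \<union> L)" by auto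
  ultimately have "\<exists>K. compact K \<and> K \<subseteq> U \<and> (\<forall>x. x \<notin> K \<longrightarrow> \<phi> x + \<psi> x = 0)"
    by (intro exI[of _ "K \<union> L"]) auto
  with assms show ?thesis by (auto simp: test_fun_def intro: Ck_add)
qed

lemma test_fun_scaleR: "test_fun U \<phi> \<Longrightarrow> test_fun U (\<lambda>x. c *\<^sub>R \<phi> x)"
  unfolding test_fun_def by (auto intro: Ck_scaleR)

lemma test_fun_zero: "test_fun U (\<lambda>x. 0)"
  unfolding test_fun_def by (auto intro: Ck_const exI[of _ "{}"])

section \<open>Smooth cut-offs of boxes\<close>

text \<open>For \<open>n = 0\<close> this is the classical smooth function that is flat to infinite
  order at 0. The power in the denominator makes the family closed under differentiation up to
  linear combinations, so smoothness follows from a single induction over all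
  \<open>n\<close>.\<close>

definition smooth_step :: "nat \<Rightarrow> real \<Rightarrow> real" where
  "smooth_step n t = (if t > 0 then exp (- 1 / t) / t ^ n else 0)"

lemma smooth_step_at_0: "(smooth_step n \<longlongrightarrow> 0) (at 0)"
proof -
  have "((\<lambda>t. inverse t ^ n / exp (inverse t)) \<longlongrightarrow> (0::real)) (at_right 0)"
    using filterlim_compose[OF tendsto_power_div_exp_0 filterlim_inverse_at_top_right] .
  then have "(smooth_step n \<longlongrightarrow> 0) (at_right 0)"
    by (rule Lim_transform_eventually)
      (auto simp: eventually_at_filter smooth_step_def exp_minus field_simps)
  moreover have "(smooth_step n \<longlongrightarrow> 0) (at_left 0)"
    by (rule tendsto_eventually) (auto simp: eventually_at_filter smooth_step_def)
  ultimately show ?thesis by (simp add: filterlim_at_split)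
qed

lemma smooth_step_deriv:
  "(smooth_step n has_real_derivative smooth_step (n + 2) t - real n * smooth_step (n + 1) t) (at t)"
proof -
  consider "t > 0" | "t < 0" | "t = 0" by linarith
  then show ?thesis
  proof cases
    case 1
    have "((\<lambda>t. exp (- 1 / t) / t ^ n) has_real_derivative
        smooth_step (n + 2) t - real n * smooth_step (n + 1) t) (at t)"
      using 1 by (auto intro!: derivative_eq_intros simp: smooth_step_def field_simps power2_eq_square)
        (cases n; simp add: field_simps)+
    then show ?thesis
      by (rule has_field_derivative_transform_within_open[of _ _ _ "{0<..}"])
        (use 1 in \<open>auto simp: smooth_step_def\<close>)
  next
    case 2
    have "((\<lambda>t. 0) has_real_derivative 0) (at t)" by simp
    then have "(smooth_step n has_real_derivative 0) (at t)"
      by (rule has_field_derivative_transform_within_open[of _ _ _ "{..<0}"])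
        (use 2 in \<open>auto simp: smooth_step_def\<close>)
    then show ?thesis using 2 by (simp add: smooth_step_def)
  next
    case 3
    \<comment> \<open>At the origin the difference quotient is itself the next member of the family,
      whose limit at 0 is already known.\<close>
    have "(\<lambda>h. (smooth_step n (0 + h) - smooth_step n 0) / h) = smooth_step (Suc n)"
      by (auto simp: fun_eq_iff smooth_step_def)
    then show ?thesis
      using 3 smooth_step_at_0[of "Suc n"] by (simp add: DERIV_def smooth_step_def)
  qed
qed

text \<open>The form \<open>c * (x \<bullet> v) + d\<close> of the argument is stable: a partial
  derivative only produces the constant factor \<open>c * (e \<bullet> v)\<close> and members with
  larger \<open>n\<close>. It covers both faces of a box in every coordinate direction.\<close>

lemma Ck_smooth_step: "Ck k (\<lambda>x. smooth_step n (c * (x \<bullet> v) + d))"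
proof (induction k arbitrary: n)
  case 0
  have "continuous_on UNIV (smooth_step n)"
    by (intro continuous_at_imp_continuous_on ballI DERIV_isCont[OF smooth_step_deriv])
  then have "continuous_on UNIV (\<lambda>x. smooth_step n (c * (x \<bullet> v) + d))"
    by (rule continuous_on_compose2) (auto intro!: continuous_intros)
  then show ?case by simp
next
  case (Suc k)
  have der: "((\<lambda>x. smooth_step n (c * (x \<bullet> v) + d)) has_derivative
      (\<lambda>h. (smooth_step (n + 2) (c * (x \<bullet> v) + d) - real n * smooth_step (n + 1) (c * (x \<bullet> v) + d)) * (c * (h \<bullet> v)))) (at x)" for x
  proof -
    have "((\<lambda>x. c * (x \<bullet> v) + d) has_derivative (\<lambda>h. c * (h \<bullet> v))) (at x)"
      by (auto intro!: derivative_eq_intros)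
    from has_derivative_compose[OF this smooth_step_deriv[unfolded has_field_derivative_def]]
    show ?thesis .
  qed
  have "pd e (\<lambda>x. smooth_step n (c * (x \<bullet> v) + d)) =
      (\<lambda>x. (c * (e \<bullet> v)) *\<^sub>R (smooth_step (n + 2) (c * (x \<bullet> v) + d) + (- real n) *\<^sub>R smooth_step (n + 1) (c * (x \<bullet> v) + d)))" for e
    by (rule ext, subst pd_eqI[OF der]) (simp add: algebra_simps)
  moreover have "Ck k (\<lambda>x. (c * (e \<bullet> v)) *\<^sub>R (smooth_step (n + 2) (c * (x \<bullet> v) + d) + (- real n) *\<^sub>R smooth_step (n + 1) (c * (x \<bullet> v) + d)))" for e
    by (intro Ck_scaleR Ck_add Suc.IH)
  moreover have "(\<lambda>x. smooth_step n (c * (x \<bullet> v) + d)) differentiable_on UNIV"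
    using der by (auto simp: differentiable_on_def differentiable_def)
  ultimately show ?case by simp
qed

lemma smooth_step_range: "0 \<le> smooth_step 0 t" "smooth_step 0 t \<le> 1"
  by (auto simp: smooth_step_def)

text \<open>Steepening the step gives the Heaviside function: for \<open>t > 0\<close> the exponent
  \<open>- 1 / (m t)\<close> tends to 0, and otherwise the function vanishes for all
  \<open>m\<close>.\<close>

lemma smooth_step_limit: "(\<lambda>m. smooth_step 0 (real m * t)) \<longlonglongrightarrow> (if t > 0 then 1 else 0)"
proof (cases "t > 0")
  case True
  have "(\<lambda>m. exp (- (1 / t) * (1 / real m))) \<longlonglongrightarrow> exp (- (1 / t) * 0)"
    by (intro tendsto_intros lim_1_over_n)
  then have "(\<lambda>m. exp (- (1 / t) * (1 / real m))) \<longlonglongrightarrow> 1" by simp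
  then have "(\<lambda>m. smooth_step 0 (real m * t)) \<longlonglongrightarrow> 1"
    by (rule Lim_transform_eventually)
      (use True in \<open>auto simp: eventually_sequentially smooth_step_def intro!: exI[of _ 1]\<close>)
  with True show ?thesis by simp
next
  case False
  then have "\<not> real m * t > 0" for m
    by (simp add: mult_nonneg_nonpos not_less)
  with False show ?thesis by (simp add: smooth_step_def)
qed

text \<open>The cut-offs are products over the coordinates of an increasing and a decreasing smooth
  step. They vanish off the closed box, which is why \<open>cbox a b\<close> must lie in
  \<open>U\<close>, while the limit is 1 only inside the open one.\<close>

lemma box_indicator_limit_of_test_funs:
  fixes a b :: "'a::euclidean_space"
  assumes "cbox a b \<subseteq> U"
  shows "\<exists>\<phi>. (\<forall>m::nat. test_fun U (\<phi> m) \<and> (\<forall>x. \<bar>\<phi> m x\<bar> \<le> (1::real))) \<and>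
           (\<forall>x. (\<lambda>m. \<phi> m x) \<longlonglongrightarrow> indicator (box a b) x)"
proof -
  define \<phi> where "\<phi> m x = (\<Prod>e\<in>Basis. smooth_step 0 (real m * (x \<bullet> e) + - (real m * (a \<bullet> e))) *
      smooth_step 0 (- real m * (x \<bullet> e) + real m * (b \<bullet> e)))" for m and x :: 'a
  have eq: "\<phi> m x = (\<Prod>e\<in>Basis. smooth_step 0 (real m * (x \<bullet> e - a \<bullet> e)) *
      smooth_step 0 (real m * (b \<bullet> e - x \<bullet> e)))" for m x
    by (simp add: \<phi>_def algebra_simps)
  have "test_fun U (\<phi> m)" for m
  proof -
    have "Ck k (\<phi> m)" for k
      unfolding \<phi>_def by (intro Ck_prod Ck_mult Ck_smooth_step)
    moreover have "\<phi> m x = 0" if x: "x \<notin> cbox a b" for x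
    proof -
      obtain e where e: "e \<in> Basis" "\<not> (a \<bullet> e \<le> x \<bullet> e \<and> x \<bullet> e \<le> b \<bullet> e)"
        using x unfolding mem_box by blast
      then have "real m * (x \<bullet> e - a \<bullet> e) \<le> 0 \<or> real m * (b \<bullet> e - x \<bullet> e) \<le> 0"
        by (auto simp: mult_nonneg_nonpos)
      then have "smooth_step 0 (real m * (x \<bullet> e - a \<bullet> e)) *
          smooth_step 0 (real m * (b \<bullet> e - x \<bullet> e)) = 0"
        by (auto simp: smooth_step_def)
      then show ?thesis unfolding eq using e(1) by (intro prod_zero) auto
    qed
    ultimately show ?thesis
      unfolding test_fun_def using assms by (intro conjI allI exI[of _ "cbox a b"]) auto
  qed
  moreover have "\<bar>\<phi> m x\<bar> \<le> 1" for m x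
    unfolding \<phi>_def abs_prod
    by (intro prod_le_1) (auto simp: abs_mult smooth_step_range intro!: mult_le_one)
  moreover have "(\<lambda>m. \<phi> m x) \<longlonglongrightarrow> indicator (box a b) x" for x
  proof -
    have "(\<lambda>m. \<phi> m x) \<longlonglongrightarrow> (\<Prod>e\<in>Basis. (if x \<bullet> e - a \<bullet> e > 0 then 1 else 0) * (if b \<bullet> e - x \<bullet> e > 0 then 1 else 0))"
      unfolding eq by (intro tendsto_prod tendsto_mult smooth_step_limit)
    moreover have "(\<Prod>e\<in>Basis. (if x \<bullet> e - a \<bullet> e > 0 then 1 else 0) * (if b \<bullet> e - x \<bullet> e > 0 then 1 else 0)) =
        (indicator (box a b) x :: real)"
    proof (cases "x \<in> box a b")
      case True
      then show ?thesis by (auto simp: mem_box intro!: prod.neutral)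
    next
      case False
      then obtain e where "e \<in> Basis" "\<not> (a \<bullet> e < x \<bullet> e \<and> x \<bullet> e < b \<bullet> e)"
        unfolding mem_box by blast
      with False show ?thesis by (auto intro!: prod_zero)
    qed
    ultimately show ?thesis by simp
  qed
  ultimately show ?thesis by blast
qed

section \<open>The fundamental lemma of the calculus of variations\<close>

lemma sigma_finite_lebesgue: "sigma_finite_measure (lebesgue :: 'a::euclidean_space measure)"
proof
  obtain A :: "'a set set" where "countable A" "A \<subseteq> sets lborel" "\<Union>A = space lborel"
    "\<forall>a\<in>A. emeasure lborel a \<noteq> \<infinity>"
    using lborel.sigma_finite_countable by blast
  then show "\<exists>A::'a set set. countable A \<and> A \<subseteq> sets lebesgue \<and> \<Union>A = space lebesgue \<and>
      (\<forall>a\<in>A. emeasure lebesgue a \<noteq> \<infinity>)"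
    by (intro exI[of _ A]) auto
qed

text \<open>Open boxes are stable under intersection and generate the Borel sets, so the vanishing
  of integrals extends from boxes to Borel sets by Dynkin's argument. Intersecting with the fixed
  box \<open>box a0 b0\<close> keeps every box in question inside the region covered by the
  assumption.\<close>

lemma AE_zero_if_integral_boxes_zero:
  fixes v :: "'a::euclidean_space \<Rightarrow> 'b::euclidean_space"
  assumes int: "integrable lebesgue v"
    and boxes: "\<And>a b. box a b \<subseteq> box a0 b0 \<Longrightarrow> (LINT x:box a b|lebesgue. v x) = 0"
  shows "AE x in lebesgue. x \<in> box a0 b0 \<longrightarrow> v x = 0"
proof -
  let ?B = "box a0 b0" and ?G = "range (\<lambda>(a, b). box a b :: 'a set)"
  have sint: "set_integrable lebesgue A v" if "A \<in> sets lebesgue" for A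
    unfolding set_integrable_def by (rule integrable_mult_indicator[OF that int])
  have P: "(LINT x:A \<inter> ?B|lebesgue. v x) = 0" if "A \<in> sigma_sets UNIV ?G" for A
  proof (rule sigma_sets_induct_disjoint[where G = ?G and P = "\<lambda>A. (LINT x:A \<inter> ?B|lebesgue. v x) = 0"])
    have borel: "sigma_sets UNIV ?G = sets borel" by (simp add: borel_eq_box)
    show "Int_stable ?G" by (auto simp: Int_stable_def box_Int_box)
    show "?G \<subseteq> Pow UNIV" by simp
    show "A \<in> sigma_sets UNIV ?G" by fact
    show "(LINT x:A \<inter> ?B|lebesgue. v x) = 0" if "A \<in> ?G" for A
    proof -
      from that obtain a b where "A = box a b" by auto
      moreover have "\<exists>c d. box a b \<inter> ?B = box c d" unfolding box_Int_box by blast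
      then obtain c d where "box a b \<inter> ?B = box c d" by blast
      ultimately show ?thesis using boxes[of c d] by auto
    qed
    show "(LINT x:{} \<inter> ?B|lebesgue. v x) = 0" by (simp add: set_lebesgue_integral_def)
    show "(LINT x:(UNIV - A) \<inter> ?B|lebesgue. v x) = 0"
      if A: "A \<in> sigma_sets UNIV ?G" and 0: "(LINT x:A \<inter> ?B|lebesgue. v x) = 0" for A
    proof -
      have "A \<in> sets lebesgue" using A unfolding borel by auto
      moreover from this have "UNIV - A \<in> sets lebesgue"
        using sets.compl_sets[of A lebesgue] by simp
      ultimately have "(LINT x:?B|lebesgue. v x) =
          (LINT x:(UNIV - A) \<inter> ?B|lebesgue. v x) + (LINT x:A \<inter> ?B|lebesgue. v x)"
        by (subst set_integral_Un[symmetric]) (auto intro!: sint sets.Int arg_cong[of _ _ "\<lambda>S. set_lebesgue_integral lebesgue S v"])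
      with 0 boxes[of a0 b0] show ?thesis by simp
    qed
    show "(LINT x:(\<Union>i. A i) \<inter> ?B|lebesgue. v x) = 0"
      if A: "disjoint_family A" "range A \<subseteq> sigma_sets UNIV ?G"
        and 0: "\<And>i. (LINT x:A i \<inter> ?B|lebesgue. v x) = 0" for A :: "nat \<Rightarrow> 'a set"
    proof -
      have "A i \<in> sets lebesgue" for i using A(2) unfolding borel by auto
      then have "(LINT x:(\<Union>i. A i \<inter> ?B)|lebesgue. v x) = (\<Sum>i. (LINT x:A i \<inter> ?B|lebesgue. v x))"
        using A(1) by (intro lebesgue_integral_countable_add) (auto simp: disjoint_family_on_def intro!: sint)
      then show ?thesis using 0 by simp
    qed
  qed
  have "AE x in lebesgue. indicat_real ?B x *\<^sub>R v x = 0"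
  proof (rule sigma_finite_measure.density_zero[OF sigma_finite_lebesgue])
    show "integrable lebesgue (\<lambda>x. indicat_real ?B x *\<^sub>R v x)"
      by (rule integrable_mult_indicator[OF _ int]) simp
    fix A :: "'a set" assume A: "A \<in> sets lebesgue"
    \<comment> \<open>A Lebesgue set differs from its Borel main part only by a null set, which does
      not change the integral.\<close>
    define A' where "A' = main_part lborel A"
    have A': "A' \<in> sets borel" using main_part_sets[OF A] by (simp add: A'_def)
    have "AE x in lebesgue. x \<notin> null_part lborel A"
      using null_part_null_sets[OF A] by (rule AE_not_in)
    moreover have "A' \<union> null_part lborel A = A"
      using main_part_null_part_Un[OF A] by (simp add: A'_def)
    ultimately have "AE x in lebesgue. x \<in> A \<longleftrightarrow> x \<in> A'"
      by (auto elim!: eventually_mono)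
    then have "(LINT x:A|lebesgue. indicat_real ?B x *\<^sub>R v x) = (LINT x:A'|lebesgue. indicat_real ?B x *\<^sub>R v x)"
      using A A' unfolding set_lebesgue_integral_def
      by (intro integral_cong_AE borel_measurable_scaleR borel_measurable_indicator
          borel_measurable_integrable[OF int]) (auto elim!: eventually_mono simp: indicator_def)
    also have "\<dots> = (LINT x:A' \<inter> ?B|lebesgue. v x)"
      unfolding set_lebesgue_integral_def by (rule Bochner_Integration.integral_cong) (auto simp: indicator_def)
    also have "\<dots> = 0"
      by (rule P) (use A' in \<open>simp add: borel_eq_box\<close>)
    finally show "(LINT x:A|lebesgue. indicat_real ?B x *\<^sub>R v x) = 0" .
  qed
  then show ?thesis by (auto elim!: eventually_mono)
qed

text \<open>Test functions that converge boundedly to the indicator of a box carry the hypothesis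
  over to integrals over boxes. This makes \<open>w\<close> vanish almost everywhere in each small
  box, and countably many such boxes cover \<open>U\<close>.\<close>

theorem fundamental_lemma_calculus_of_variations:
  fixes w :: "'a::euclidean_space \<Rightarrow> 'b::euclidean_space"
  assumes U: "open U" and int: "set_integrable lebesgue U w"
    and zero: "\<And>\<phi> :: 'a \<Rightarrow> real. test_fun U \<phi> \<Longrightarrow> (LINT x:U|lebesgue. \<phi> x *\<^sub>R w x) = 0"
  shows "AE x in lebesgue. x \<in> U \<longrightarrow> w x = 0"
proof -
  define v where "v x = indicat_real U x *\<^sub>R w x" for x
  have v: "integrable lebesgue v" using int by (simp add: set_integrable_def v_def[abs_def])
  have box0: "(LINT x:box a b|lebesgue. v x) = 0" if ab: "cbox a b \<subseteq> U" for a b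
  proof -
    obtain \<phi> :: "nat \<Rightarrow> 'a \<Rightarrow> real" where \<phi>: "\<And>m. test_fun U (\<phi> m)" "\<And>m x. \<bar>\<phi> m x\<bar> \<le> 1"
      "\<And>x. (\<lambda>m. \<phi> m x) \<longlonglongrightarrow> indicator (box a b) x"
      using box_indicator_limit_of_test_funs[OF ab] by blast
    have meas: "\<phi> m \<in> borel_measurable lebesgue" for m
      using \<phi>(1)[of m] Ck_continuous[of 0 "\<phi> m"] borel_measurable_continuous_onI[of "\<phi> m"]
      by (auto simp: test_fun_def intro: measurable_completion)
    have "(\<lambda>m. LINT x|lebesgue. \<phi> m x *\<^sub>R v x) \<longlonglongrightarrow> (LINT x|lebesgue. indicat_real (box a b) x *\<^sub>R v x)"
    proof (rule integral_dominated_convergence[where w = "\<lambda>x. norm (v x)"])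
      show "(\<lambda>x. \<phi> m x *\<^sub>R v x) \<in> borel_measurable lebesgue" for m
        using meas v by (intro borel_measurable_scaleR) auto
      show "(\<lambda>x. indicat_real (box a b) x *\<^sub>R v x) \<in> borel_measurable lebesgue"
        using v by (intro borel_measurable_scaleR borel_measurable_indicator) auto
      show "integrable lebesgue (\<lambda>x. norm (v x))" using v by simp
      show "AE x in lebesgue. (\<lambda>m. \<phi> m x *\<^sub>R v x) \<longlonglongrightarrow> indicat_real (box a b) x *\<^sub>R v x"
        using \<phi>(3) by (auto intro!: tendsto_intros)
      show "AE x in lebesgue. norm (\<phi> m x *\<^sub>R v x) \<le> norm (v x)" for m
        using \<phi>(2) by (auto intro!: mult_left_le_one_le)
    qed
    moreover have "(LINT x|lebesgue. \<phi> m x *\<^sub>R v x) = 0" for m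
    proof -
      have "(LINT x|lebesgue. \<phi> m x *\<^sub>R v x) = (LINT x:U|lebesgue. \<phi> m x *\<^sub>R w x)"
        unfolding set_lebesgue_integral_def v_def
        by (rule Bochner_Integration.integral_cong) (auto simp: mult.commute)
      then show ?thesis using zero[OF \<phi>(1)] by simp
    qed
    ultimately show ?thesis
      by (simp add: set_lebesgue_integral_def LIMSEQ_const_iff)
  qed
  \<comment> \<open>Null sets may be united only countably often, hence the passage to a countable
    subcover by Lindelof's theorem.\<close>
  define F where "F = {B. \<exists>a b. B = box a b \<and> cbox a b \<subseteq> U}"
  obtain F' where F': "F' \<subseteq> F" "countable F'" "\<Union>F' = \<Union>F"
    using Lindelof[of F] by (auto simp: F_def)
  have cover: "U \<subseteq> \<Union>F"
  proof
    fix x assume "x \<in> U"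
    then obtain a b where "cbox a b \<subseteq> U" "x \<in> box a b"
      using open_contains_cbox[OF U] by metis
    then show "x \<in> \<Union>F" by (auto simp: F_def)
  qed
  have "AE x in lebesgue. x \<in> B \<longrightarrow> v x = 0" if "B \<in> F'" for B
  proof -
    from that F'(1) obtain a b where B: "B = box a b" "cbox a b \<subseteq> U" by (auto simp: F_def)
    show ?thesis unfolding B(1)
    proof (rule AE_zero_if_integral_boxes_zero[OF v])
      fix c d assume cd: "box c d \<subseteq> box a b"
      show "(LINT x:box c d|lebesgue. v x) = 0"
      \<comment> \<open>For a nonempty box \<open>cbox c d\<close> is the closure of
        \<open>box c d\<close> and therefore still inside \<open>cbox a b\<close>; an empty open box
        would not give this, but its integral is trivially 0.\<close>
      proof (cases "box c d = {}")
        case False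
        then have "cbox c d = closure (box c d)" by simp
        also have "\<dots> \<subseteq> cbox a b"
          using cd box_subset_cbox[of a b] by (intro closure_minimal) auto
        finally show ?thesis using B(2) by (intro box0) auto
      qed (simp add: set_lebesgue_integral_def)
    qed
  qed
  then have "AE x in lebesgue. \<forall>B\<in>F'. x \<in> B \<longrightarrow> v x = 0"
    unfolding AE_ball_countable[OF F'(2)] by blast
  then show ?thesis
  proof (rule eventually_mono, intro impI)
    fix x assume *: "\<forall>B\<in>F'. x \<in> B \<longrightarrow> v x = 0" and x: "x \<in> U"
    with cover F'(3) have "v x = 0" by blast
    with x show "w x = 0" by (simp add: v_def)
  qed
qed

section \<open>Bounded measurable functions\<close>

text \<open>Essential instead of pointwise boundedness, since a chosen representative of a weak
  derivative is controlled only almost everywhere. Unlike square integrability the property survives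
  products, so polynomial terms of any degree are integrable over a finite measure.\<close>

definition bdd_meas :: "'a measure \<Rightarrow> ('a \<Rightarrow> 'b::euclidean_space) \<Rightarrow> bool" where
  "bdd_meas M f \<longleftrightarrow> f \<in> borel_measurable M \<and> (\<exists>B. AE x in M. norm (f x) \<le> B)"

lemma bdd_meas_const: "bdd_meas M (\<lambda>x. c)"
  unfolding bdd_meas_def by auto

text \<open>
  On a Euclidean space a continuous function is bounded on bounded sets, so \<open>bdd_meas\<close> is
  closed under all pointwise continuous operations.
\<close>

lemma bdd_meas_continuous:
  assumes f: "bdd_meas M f" and h: "continuous_on UNIV h"
  shows "bdd_meas M (\<lambda>x. h (f x))"
proof -
  obtain B where B: "AE x in M. norm (f x) \<le> B" using f by (auto simp: bdd_meas_def)
  have "compact (h ` cball 0 B)"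
    using h by (intro compact_continuous_image) (auto intro: continuous_on_subset)
  then have "bounded (h ` cball 0 B)" by (rule compact_imp_bounded)
  then obtain C where "\<forall>z\<in>h ` cball 0 B. norm z \<le> C" unfolding bounded_iff by blast
  then have C: "norm (h y) \<le> C" if "norm y \<le> B" for y using that by simp
  have "AE x in M. norm (h (f x)) \<le> C"
    using B by eventually_elim (rule C)
  moreover have "(\<lambda>x. h (f x)) \<in> borel_measurable M"
    using f h by (auto simp: bdd_meas_def intro: borel_measurable_continuous_on)
  ultimately show ?thesis by (auto simp: bdd_meas_def)
qed

lemma bdd_meas_Pair:
  assumes "bdd_meas M f" "bdd_meas M g"
  shows "bdd_meas M (\<lambda>x. (f x, g x))"
proof -
  obtain B C where "AE x in M. norm (f x) \<le> B" "AE x in M. norm (g x) \<le> C"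
    using assms by (auto simp: bdd_meas_def)
  then have "AE x in M. norm (f x, g x) \<le> B + C"
    by eventually_elim (use norm_Pair_le order_trans add_mono in metis)
  with assms show ?thesis by (auto simp: bdd_meas_def intro: borel_measurable_Pair)
qed

lemma bdd_meas_continuous2:
  assumes "bdd_meas M f" "bdd_meas M g" and h: "continuous_on UNIV (\<lambda>p. h (fst p) (snd p))"
  shows "bdd_meas M (\<lambda>x. h (f x) (g x))"
  using bdd_meas_continuous[OF bdd_meas_Pair[OF assms(1,2)] h] by simp

lemma bdd_meas_add: "bdd_meas M f \<Longrightarrow> bdd_meas M g \<Longrightarrow> bdd_meas M (\<lambda>x. f x + g x)"
  by (rule bdd_meas_continuous2[where h = "\<lambda>a b. a + b"]) (auto intro!: continuous_intros)

lemma bdd_meas_diff: "bdd_meas M f \<Longrightarrow> bdd_meas M g \<Longrightarrow> bdd_meas M (\<lambda>x. f x - g x)"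
  by (rule bdd_meas_continuous2[where h = "\<lambda>a b. a - b"]) (auto intro!: continuous_intros)

lemma bdd_meas_inner: "bdd_meas M f \<Longrightarrow> bdd_meas M g \<Longrightarrow> bdd_meas M (\<lambda>x. f x \<bullet> g x)"
  by (rule bdd_meas_continuous2[where h = "\<lambda>a b. a \<bullet> b"]) (auto intro!: continuous_intros)

lemma bdd_meas_scaleR: "bdd_meas M f \<Longrightarrow> bdd_meas M g \<Longrightarrow> bdd_meas M (\<lambda>x. f x *\<^sub>R g x)"
  by (rule bdd_meas_continuous2[where h = "\<lambda>a b. a *\<^sub>R b"]) (auto intro!: continuous_intros)

lemma bdd_meas_sum: "(\<And>i. i \<in> I \<Longrightarrow> bdd_meas M (f i)) \<Longrightarrow> bdd_meas M (\<lambda>x. \<Sum>i\<in>I. f i x)"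
  by (induction I rule: infinite_finite_induct) (auto intro: bdd_meas_const bdd_meas_add)

lemma bdd_meas_cong_AE:
  assumes "bdd_meas M f" "g \<in> borel_measurable M" "AE x in M. g x = f x"
  shows "bdd_meas M g"
proof -
  obtain B where "AE x in M. norm (f x) \<le> B" using assms(1) by (auto simp: bdd_meas_def)
  with assms(3) have "AE x in M. norm (g x) \<le> B" by eventually_elim simp
  with assms(2) show ?thesis by (auto simp: bdd_meas_def)
qed

lemma bdd_meas_integrable: "finite_measure M \<Longrightarrow> bdd_meas M f \<Longrightarrow> integrable M f"
  unfolding bdd_meas_def using finite_measure.integrable_const_bound by blast

lemma set_lint_lebesgue_on:
  fixes f :: "'a::euclidean_space \<Rightarrow> 'b::euclidean_space"
  assumes "U \<in> sets lebesgue"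
  shows "(LINT x:U|lebesgue. f x) = (LINT x|lebesgue_on U. f x)"
  using assms by (simp add: set_lebesgue_integral_def integral_restrict_space)

lemma AE_lebesgue_on_iff:
  assumes "U \<in> sets lebesgue"
  shows "(AE x in lebesgue_on U. P x) \<longleftrightarrow> (AE x in lebesgue. x \<in> U \<longrightarrow> P x)"
  using assms by (simp add: AE_restrict_space_iff)

section \<open>Bounds for test functions\<close>

lemma test_fun_pd_outside:
  assumes "closed K" "\<And>x. x \<notin> K \<Longrightarrow> \<phi> x = 0" "x \<notin> K"
  shows "pd e \<phi> x = 0"
proof -
  have "(\<phi> has_derivative (\<lambda>h. 0)) (at x)"
    by (rule has_derivative_transform_within_open[of "\<lambda>x. 0" _ _ _ "- K"])
      (use assms in auto)
  then show ?thesis by (rule pd_eqI)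
qed

lemma test_fun_bounded:
  fixes \<phi> :: "'a::euclidean_space \<Rightarrow> 'b::euclidean_space"
  assumes "test_fun U \<phi>"
  shows "\<exists>B\<ge>0. (\<forall>x. norm (\<phi> x) \<le> B) \<and> (\<forall>e\<in>Basis. \<forall>x. norm (pd e \<phi> x) \<le> B)"
proof -
  obtain K where K: "compact K" "\<And>x. x \<notin> K \<Longrightarrow> \<phi> x = 0"
    using assms by (auto simp: test_fun_def)
  have bnd: "\<exists>B\<ge>0. \<forall>x. norm (f x) \<le> B" if f: "continuous_on UNIV f" "\<And>x. x \<notin> K \<Longrightarrow> f x = 0"
    for f :: "'a \<Rightarrow> 'b"
  proof -
    have "compact (f ` K)"
      using f K by (intro compact_continuous_image) (auto intro: continuous_on_subset)
    then have "bounded (f ` K)" by (rule compact_imp_bounded)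
    then have "\<exists>C. \<forall>x\<in>K. norm (f x) \<le> C" by (simp add: bounded_iff)
    then obtain C where "\<And>x. x \<in> K \<Longrightarrow> norm (f x) \<le> C" by blast
    then have "norm (f x) \<le> max 0 C" for x
      using f(2)[of x] by (cases "x \<in> K") (auto simp: max.coboundedI2)
    then show ?thesis by (intro exI[of _ "max 0 C"]) auto
  qed
  have Ck: "Ck 0 \<phi>" "Ck 1 \<phi>" using assms by (auto simp: test_fun_def simp del: Ck.simps)
  obtain B0 where B0: "B0 \<ge> 0" "\<forall>x. norm (\<phi> x) \<le> B0"
    using bnd[of \<phi>] K(2) Ck(1) unfolding Ck.simps by blast
  have "\<exists>B\<ge>0. \<forall>x. norm (pd e \<phi> x) \<le> B" if "e \<in> Basis" for e
    by (rule bnd) (use Ck(2) that K test_fun_pd_outside[of K \<phi>] compact_imp_closed in auto)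
  then obtain B where B: "\<And>e. e \<in> Basis \<Longrightarrow> B e \<ge> 0 \<and> (\<forall>x. norm (pd e \<phi> x) \<le> B e)"
    by metis
  have "norm (pd e \<phi> x) \<le> B0 + sum B Basis" if "e \<in> Basis" for e x
    using member_le_sum[of e Basis B] B that B0(1) by (smt (verit, best) finite_Basis DiffD1)
  moreover have "norm (\<phi> x) \<le> B0 + sum B Basis" for x
    using B0(2) B by (simp add: add_increasing2 sum_nonneg)
  ultimately show ?thesis
    using B0(1) B by (intro exI[of _ "B0 + sum B Basis"]) (auto intro!: add_nonneg_nonneg sum_nonneg)
qed

text \<open>Mean value inequality on the whole space: the operator norm of the derivative is at most
  the dimension times a common bound of the partial derivatives.\<close>

lemma test_fun_Lipschitz:
  fixes \<phi> :: "'a::euclidean_space \<Rightarrow> 'b::euclidean_space"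
  assumes "test_fun U \<phi>"
  shows "\<exists>L\<ge>0. \<forall>x y. norm (\<phi> x - \<phi> y) \<le> L * norm (x - y)"
proof -
  obtain B where B: "B \<ge> 0" "\<And>e x. e \<in> Basis \<Longrightarrow> norm (pd e \<phi> x) \<le> B"
    using test_fun_bounded[OF assms] by blast
  have der: "(\<phi> has_derivative frechet_derivative \<phi> (at x)) (at x)" for x
    using assms Ck_differentiable[of 0 \<phi> x]
    by (auto simp: test_fun_def frechet_derivative_works[symmetric] simp del: Ck.simps)
  have "onorm (frechet_derivative \<phi> (at x)) \<le> real DIM('a) * B" for x
  proof (rule onorm_bound)
    fix h :: 'a
    interpret linear "frechet_derivative \<phi> (at x)"
      using der has_derivative_linear by blast
    have "frechet_derivative \<phi> (at x) h = frechet_derivative \<phi> (at x) (\<Sum>e\<in>Basis. (h \<bullet> e) *\<^sub>R e)"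
      by (simp add: euclidean_representation)
    also have "\<dots> = (\<Sum>e\<in>Basis. (h \<bullet> e) *\<^sub>R pd e \<phi> x)"
      by (simp add: sum scale pd_def)
    also have "norm \<dots> \<le> (\<Sum>e\<in>(Basis::'a set). norm h * B)"
      by (rule sum_norm_le) (auto intro!: mult_mono B simp: Basis_le_norm)
    finally show "norm (frechet_derivative \<phi> (at x) h) \<le> real DIM('a) * B * norm h"
      by (simp add: mult_ac)
  qed (use B in auto)
  then have "norm (\<phi> x - \<phi> y) \<le> (real DIM('a) * B) * norm (x - y)" for x y
    by (intro differentiable_bound[of UNIV \<phi> "\<lambda>x. frechet_derivative \<phi> (at x)"]) (auto intro: der)
  with B(1) show ?thesis by (intro exI[of _ "real DIM('a) * B"]) auto
qed

section \<open>Weak derivatives on bounded open sets\<close>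

locale bounded_open =
  fixes U :: "(real^'n) set"
  assumes open_U: "open U" and bounded_U: "bounded U"
begin

lemma U_lebesgue: "U \<in> sets lebesgue"
  using open_U by auto

lemma finite_U: "finite_measure (lebesgue_on U)"
  using open_U bounded_U by (intro finite_measure_lebesgue_on lmeasurable_open)

lemmas lint_U = set_lint_lebesgue_on[OF U_lebesgue]
lemmas AE_U_iff = AE_lebesgue_on_iff[OF U_lebesgue]
lemmas integrable_U = bdd_meas_integrable[OF finite_U]

lemma measurable_U_iff:
  fixes v :: "real^'n \<Rightarrow> 'b::euclidean_space"
  shows "set_borel_measurable lebesgue U v \<longleftrightarrow> v \<in> borel_measurable (lebesgue_on U)"
  using borel_measurable_restrict_space_iff[of U lebesgue v] U_lebesgue
  by (simp add: set_borel_measurable_def)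

lemma integrable_U_iff:
  fixes v :: "real^'n \<Rightarrow> 'b::euclidean_space"
  shows "set_integrable lebesgue U v \<longleftrightarrow> integrable (lebesgue_on U) v"
  using U_lebesgue by (simp add: set_integrable_def integrable_restrict_space)

lemma L2_on_bdd_meas: "bdd_meas (lebesgue_on U) v \<Longrightarrow> L2_on U v"
  unfolding L2_on_def measurable_U_iff integrable_U_iff
  unfolding power2_norm_eq_inner
  by (intro conjI integrable_U bdd_meas_inner) (auto simp: bdd_meas_def)

lemma L2_on_integrable:
  assumes "L2_on U v"
  shows "integrable (lebesgue_on U) v"
proof (rule Bochner_Integration.integrable_bound)
  interpret finite_measure "lebesgue_on U" by (rule finite_U)
  show "integrable (lebesgue_on U) (\<lambda>x. 1 + (norm (v x))\<^sup>2)"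
    using assms by (simp add: L2_on_def integrable_U_iff)
  show "v \<in> borel_measurable (lebesgue_on U)"
    using assms by (simp add: L2_on_def measurable_U_iff)
  have "t \<le> 1 + t\<^sup>2" for t :: real
    using sum_power2_ge_zero[of "t - 1/2" 0] by (simp add: power2_eq_square algebra_simps)
  then show "AE x in lebesgue_on U. norm (v x) \<le> norm (1 + (norm (v x))\<^sup>2)"
    by (simp add: abs_of_nonneg)
qed

lemma bdd_meas_test_fun:
  fixes \<phi> :: "real^'n \<Rightarrow> 'b::euclidean_space"
  assumes "test_fun U \<phi>"
  shows "bdd_meas (lebesgue_on U) \<phi>" "e \<in> Basis \<Longrightarrow> bdd_meas (lebesgue_on U) (pd e \<phi>)"
proof -
  have meas: "f \<in> borel_measurable (lebesgue_on U)" if "continuous_on UNIV f" for f :: "real^'n \<Rightarrow> 'b"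
    using that by (intro continuous_imp_measurable_on_sets_lebesgue U_lebesgue) (auto intro: continuous_on_subset)
  have Ck: "Ck 0 \<phi>" "Ck 1 \<phi>" using assms by (auto simp: test_fun_def simp del: Ck.simps)
  obtain B where "\<And>x. norm (\<phi> x) \<le> B" "\<And>e x. e \<in> Basis \<Longrightarrow> norm (pd e \<phi> x) \<le> B"
    using test_fun_bounded[OF assms] by blast
  with Ck meas show "bdd_meas (lebesgue_on U) \<phi>"
    "e \<in> Basis \<Longrightarrow> bdd_meas (lebesgue_on U) (pd e \<phi>)"
    unfolding bdd_meas_def by (auto intro!: exI[of _ B])
qed

lemma integrable_bdd_scaleR:
  fixes \<phi> :: "real^'n \<Rightarrow> real" and g :: "real^'n \<Rightarrow> 'b::euclidean_space"
  assumes "bdd_meas (lebesgue_on U) \<phi>" "integrable (lebesgue_on U) g"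
  shows "integrable (lebesgue_on U) (\<lambda>x. \<phi> x *\<^sub>R g x)"
proof -
  obtain B where B: "AE x in lebesgue_on U. norm (\<phi> x) \<le> B" using assms(1) by (auto simp: bdd_meas_def)
  show ?thesis
  proof (rule Bochner_Integration.integrable_bound)
    show "integrable (lebesgue_on U) (\<lambda>x. B *\<^sub>R norm (g x))" using assms(2) by simp
    show "(\<lambda>x. \<phi> x *\<^sub>R g x) \<in> borel_measurable (lebesgue_on U)"
      using assms by (auto simp: bdd_meas_def)
    show "AE x in lebesgue_on U. norm (\<phi> x *\<^sub>R g x) \<le> norm (B *\<^sub>R norm (g x))"
      using B by eventually_elim (auto intro!: mult_right_mono)
  qed
qed

lemma has_weak_partial_unique:
  assumes "has_weak_partial U i v g" "has_weak_partial U i v h"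
  shows "AE x in lebesgue_on U. g x = h x"
proof -
  have int: "integrable (lebesgue_on U) g" "integrable (lebesgue_on U) h"
    using assms by (auto simp: has_weak_partial_def intro: L2_on_integrable)
  have "AE x in lebesgue. x \<in> U \<longrightarrow> g x - h x = 0"
  proof (rule fundamental_lemma_calculus_of_variations[OF open_U])
    show "set_integrable lebesgue U (\<lambda>x. g x - h x)"
      unfolding integrable_U_iff using int by simp
    fix \<phi> :: "real^'n \<Rightarrow> real" assume \<phi>: "test_fun U \<phi>"
    have "(LINT x|lebesgue_on U. \<phi> x *\<^sub>R g x) = (LINT x|lebesgue_on U. \<phi> x *\<^sub>R h x)"
      using assms \<phi> unfolding has_weak_partial_def lint_U by (metis minus_equation_iff)
    then show "(LINT x:U|lebesgue. \<phi> x *\<^sub>R (g x - h x)) = 0"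
      unfolding lint_U scaleR_diff_right
      using int \<phi> by (subst Bochner_Integration.integral_diff) (auto intro: integrable_bdd_scaleR bdd_meas_test_fun)
  qed
  then show ?thesis by (simp add: AE_U_iff)
qed

lemma wpd_eq_AE:
  assumes "has_weak_partial U i v g"
  shows "has_weak_partial U i v (wpd U i v)" "AE x in lebesgue_on U. wpd U i v x = g x"
proof -
  show "has_weak_partial U i v (wpd U i v)" unfolding wpd_def using assms by (rule someI[of "has_weak_partial U i v"])
  then show "AE x in lebesgue_on U. wpd U i v x = g x" using assms by (rule has_weak_partial_unique)
qed

lemma has_weak_partial_zero:
  fixes v :: "real^'n \<Rightarrow> 'b::euclidean_space"
  assumes "AE x in lebesgue_on U. v x = 0"
  shows "has_weak_partial U i v (\<lambda>x. 0)"
proof -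
  have "(LINT x|lebesgue_on U. pd (axis i 1) \<phi> x *\<^sub>R v x) = 0" for \<phi> :: "real^'n \<Rightarrow> real"
    using assms by (intro integral_eq_zero_AE) (auto elim: eventually_mono)
  then show ?thesis
    unfolding has_weak_partial_def lint_U by (auto intro!: L2_on_bdd_meas bdd_meas_const)
qed

text \<open>
  Finite element functions and test functions are tame, and products of tame functions and of their
  weak derivatives are integrable.
\<close>

definition tame :: "(real^'n \<Rightarrow> 'b::euclidean_space) \<Rightarrow> bool" where
  "tame v \<longleftrightarrow> bdd_meas (lebesgue_on U) v \<and>
     (\<forall>i. has_weak_partial U i v (wpd U i v) \<and> bdd_meas (lebesgue_on U) (wpd U i v))"

text \<open>One essentially bounded weak derivative is enough: by uniqueness the representative
  picked by \<open>wpd\<close> agrees with it almost everywhere and inherits the bound.\<close>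

lemma tameI:
  assumes "bdd_meas (lebesgue_on U) v"
    and "\<And>i. \<exists>g. has_weak_partial U i v g \<and> bdd_meas (lebesgue_on U) g"
  shows "tame v"
  unfolding tame_def
proof (intro conjI allI assms(1))
  fix i
  obtain g where g: "has_weak_partial U i v g" "bdd_meas (lebesgue_on U) g" using assms(2) by blast
  show "has_weak_partial U i v (wpd U i v)" by (rule wpd_eq_AE[OF g(1)])
  then have "wpd U i v \<in> borel_measurable (lebesgue_on U)"
    by (simp add: has_weak_partial_def L2_on_def measurable_U_iff)
  then show "bdd_meas (lebesgue_on U) (wpd U i v)"
    using bdd_meas_cong_AE[OF g(2)] wpd_eq_AE(2)[OF g(1)] by blast
qed

lemma tameD:
  assumes "tame v"
  shows "bdd_meas (lebesgue_on U) v" "has_weak_partial U i v (wpd U i v)"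
    "bdd_meas (lebesgue_on U) (wpd U i v)"
  using assms by (auto simp: tame_def)

lemma tame_H1: "tame v \<Longrightarrow> v \<in> H1 U"
  unfolding tame_def H1_def by (auto intro: L2_on_bdd_meas)

lemma has_weak_partial_add:
  fixes v w :: "real^'n \<Rightarrow> 'b::euclidean_space"
  assumes "tame v" "tame w"
  shows "has_weak_partial U i (\<lambda>x. v x + w x) (\<lambda>x. wpd U i v x + wpd U i w x)"
proof -
  have "(LINT x|lebesgue_on U. pd (axis i 1) \<phi> x *\<^sub>R (v x + w x)) =
      - (LINT x|lebesgue_on U. \<phi> x *\<^sub>R (wpd U i v x + wpd U i w x))"
    if \<phi>: "test_fun U \<phi>" for \<phi> :: "real^'n \<Rightarrow> real"
  proof -
    have b: "bdd_meas (lebesgue_on U) \<phi>" "bdd_meas (lebesgue_on U) (pd (axis i 1) \<phi>)"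
      using \<phi> by (auto intro: bdd_meas_test_fun)
    have "(LINT x|lebesgue_on U. pd (axis i 1) \<phi> x *\<^sub>R (v x + w x)) =
        (LINT x|lebesgue_on U. pd (axis i 1) \<phi> x *\<^sub>R v x) + (LINT x|lebesgue_on U. pd (axis i 1) \<phi> x *\<^sub>R w x)"
      unfolding scaleR_add_right using assms b
      by (intro Bochner_Integration.integral_add integrable_U bdd_meas_scaleR) (auto simp: tame_def)
    also have "\<dots> = - ((LINT x|lebesgue_on U. \<phi> x *\<^sub>R wpd U i v x) + (LINT x|lebesgue_on U. \<phi> x *\<^sub>R wpd U i w x))"
      using assms \<phi> by (simp add: tame_def has_weak_partial_def lint_U)
    also have "(LINT x|lebesgue_on U. \<phi> x *\<^sub>R wpd U i v x) + (LINT x|lebesgue_on U. \<phi> x *\<^sub>R wpd U i w x) =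
        (LINT x|lebesgue_on U. \<phi> x *\<^sub>R (wpd U i v x + wpd U i w x))"
      unfolding scaleR_add_right using assms b
      by (intro Bochner_Integration.integral_add[symmetric] integrable_U bdd_meas_scaleR) (auto simp: tame_def)
    finally show ?thesis .
  qed
  with assms show ?thesis
    unfolding has_weak_partial_def lint_U
    by (auto simp: tame_def intro!: L2_on_bdd_meas bdd_meas_add)
qed

lemma tame_add:
  assumes "tame v" "tame w"
  shows "tame (\<lambda>x. v x + w x)"
    "AE x in lebesgue_on U. wpd U i (\<lambda>x. v x + w x) x = wpd U i v x + wpd U i w x"
proof -
  show "tame (\<lambda>x. v x + w x)"
  proof (rule tameI)
    show "bdd_meas (lebesgue_on U) (\<lambda>x. v x + w x)"
      using assms by (auto simp: tame_def intro: bdd_meas_add)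
    show "\<exists>g. has_weak_partial U i (\<lambda>x. v x + w x) g \<and> bdd_meas (lebesgue_on U) g" for i
      using has_weak_partial_add[OF assms, of i] assms by (auto simp: tame_def intro: bdd_meas_add)
  qed
  show "AE x in lebesgue_on U. wpd U i (\<lambda>x. v x + w x) x = wpd U i v x + wpd U i w x"
    by (rule wpd_eq_AE(2)[OF has_weak_partial_add[OF assms]])
qed

text \<open>A bounded linear map commutes with the Bochner integral. Scalar multiples,
  \<open>sym_part\<close> and \<open>trace\<close>, which (S1) applies before differentiating, are
  all instances.\<close>

lemma has_weak_partial_linear:
  fixes v :: "real^'n \<Rightarrow> 'b::euclidean_space" and f :: "'b \<Rightarrow> 'c::euclidean_space"
  assumes v: "tame v" and f: "bounded_linear f"
  shows "has_weak_partial U i (\<lambda>x. f (v x)) (\<lambda>x. f (wpd U i v x))"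
proof -
  interpret f: bounded_linear f by fact
  have cont: "continuous_on UNIV f" by (rule f.continuous_on) (rule continuous_on_id)
  have "(LINT x|lebesgue_on U. pd (axis i 1) \<phi> x *\<^sub>R f (v x)) =
      - (LINT x|lebesgue_on U. \<phi> x *\<^sub>R f (wpd U i v x))"
    if \<phi>: "test_fun U \<phi>" for \<phi> :: "real^'n \<Rightarrow> real"
  proof -
    have b: "bdd_meas (lebesgue_on U) \<phi>" "bdd_meas (lebesgue_on U) (pd (axis i 1) \<phi>)"
      using \<phi> by (auto intro: bdd_meas_test_fun)
    have "(LINT x|lebesgue_on U. pd (axis i 1) \<phi> x *\<^sub>R f (v x)) =
        f (LINT x|lebesgue_on U. pd (axis i 1) \<phi> x *\<^sub>R v x)"
      unfolding f.scaleR[symmetric] using v b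
      by (intro integral_bounded_linear[OF f] integrable_U bdd_meas_scaleR) (auto simp: tame_def)
    also have "\<dots> = - f (LINT x|lebesgue_on U. \<phi> x *\<^sub>R wpd U i v x)"
      using v \<phi> by (simp add: tame_def has_weak_partial_def lint_U f.neg)
    also have "f (LINT x|lebesgue_on U. \<phi> x *\<^sub>R wpd U i v x) = (LINT x|lebesgue_on U. \<phi> x *\<^sub>R f (wpd U i v x))"
      unfolding f.scaleR[symmetric] using v b
      by (intro integral_bounded_linear[OF f, symmetric] integrable_U bdd_meas_scaleR) (auto simp: tame_def)
    finally show ?thesis .
  qed
  with v show ?thesis
    unfolding has_weak_partial_def lint_U
    by (auto simp: tame_def intro!: L2_on_bdd_meas bdd_meas_continuous[OF _ cont])
qed

lemma tame_linear:
  fixes v :: "real^'n \<Rightarrow> 'b::euclidean_space" and f :: "'b \<Rightarrow> 'c::euclidean_space"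
  assumes "tame v" "bounded_linear f"
  shows "tame (\<lambda>x. f (v x))" "AE x in lebesgue_on U. wpd U i (\<lambda>x. f (v x)) x = f (wpd U i v x)"
proof -
  have cont: "continuous_on UNIV f"
    using assms(2) by (intro linear_continuous_on)
  show "tame (\<lambda>x. f (v x))"
  proof (rule tameI)
    show "bdd_meas (lebesgue_on U) (\<lambda>x. f (v x))"
      using assms(1) by (auto simp: tame_def intro: bdd_meas_continuous[OF _ cont])
    show "\<exists>g. has_weak_partial U i (\<lambda>x. f (v x)) g \<and> bdd_meas (lebesgue_on U) g" for i
      using has_weak_partial_linear[OF assms, of i] assms(1)
      by (auto simp: tame_def intro: bdd_meas_continuous[OF _ cont])
  qed
  show "AE x in lebesgue_on U. wpd U i (\<lambda>x. f (v x)) x = f (wpd U i v x)"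
    by (rule wpd_eq_AE(2)[OF has_weak_partial_linear[OF assms]])
qed

lemmas tame_scaleR = tame_linear[OF _ bounded_linear_scaleR_right]

lemma tame_zero:
  fixes v :: "real^'n \<Rightarrow> 'b::euclidean_space"
  assumes "v \<in> borel_measurable (lebesgue_on U)" "AE x in lebesgue_on U. v x = 0"
  shows "tame v" "AE x in lebesgue_on U. wpd U i v x = 0"
proof -
  show "tame v"
  proof (rule tameI)
    show "bdd_meas (lebesgue_on U) v" by (rule bdd_meas_cong_AE[OF bdd_meas_const assms])
    show "\<exists>g. has_weak_partial U i v g \<and> bdd_meas (lebesgue_on U) g" for i
      using has_weak_partial_zero[OF assms(2)] bdd_meas_const by blast
  qed
  show "AE x in lebesgue_on U. wpd U i v x = 0"
    by (rule wpd_eq_AE(2)[OF has_weak_partial_zero[OF assms(2)]])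
qed

lemma tame_sum:
  fixes v :: "'i \<Rightarrow> real^'n \<Rightarrow> 'b::euclidean_space"
  assumes "finite I" "\<And>j. j \<in> I \<Longrightarrow> tame (v j)"
  shows "tame (\<lambda>x. \<Sum>j\<in>I. c j *\<^sub>R v j x)"
    "AE x in lebesgue_on U. wpd U i (\<lambda>x. \<Sum>j\<in>I. c j *\<^sub>R v j x) x = (\<Sum>j\<in>I. c j *\<^sub>R wpd U i (v j) x)"
proof -
  have "tame (\<lambda>x. \<Sum>j\<in>I. c j *\<^sub>R v j x) \<and>
    (AE x in lebesgue_on U. wpd U i (\<lambda>x. \<Sum>j\<in>I. c j *\<^sub>R v j x) x = (\<Sum>j\<in>I. c j *\<^sub>R wpd U i (v j) x))"
    using assms
  proof (induction I rule: finite_induct)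
    case empty
    then show ?case using tame_zero[of "\<lambda>x. 0 :: 'b"] by simp
  next
    case (insert k I)
    let ?s = "\<lambda>x. \<Sum>j\<in>I. c j *\<^sub>R v j x"
    have k: "tame (\<lambda>x. c k *\<^sub>R v k x)" by (rule tame_scaleR(1)) (use insert.prems in simp)
    have s: "tame ?s" using insert by simp
    have "AE x in lebesgue_on U. wpd U i (\<lambda>x. c k *\<^sub>R v k x + ?s x) x =
        c k *\<^sub>R wpd U i (v k) x + (\<Sum>j\<in>I. c j *\<^sub>R wpd U i (v j) x)"
    proof -
      have "AE x in lebesgue_on U. wpd U i ?s x = (\<Sum>j\<in>I. c j *\<^sub>R wpd U i (v j) x)"
        using insert by simp
      moreover have "AE x in lebesgue_on U. wpd U i (\<lambda>x. c k *\<^sub>R v k x) x = c k *\<^sub>R wpd U i (v k) x"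
        by (rule tame_scaleR(2)) (use insert.prems in simp)
      ultimately show ?thesis using tame_add(2)[OF k s, of i] by eventually_elim simp
    qed
    with tame_add(1)[OF k s] insert.hyps show ?case by simp
  qed
  then show "tame (\<lambda>x. \<Sum>j\<in>I. c j *\<^sub>R v j x)"
    "AE x in lebesgue_on U. wpd U i (\<lambda>x. \<Sum>j\<in>I. c j *\<^sub>R v j x) x = (\<Sum>j\<in>I. c j *\<^sub>R wpd U i (v j) x)"
    by blast+
qed

end

section \<open>Weak derivatives of Lipschitz functions\<close>

text \<open>A fixed sequence of step lengths is used because dominated convergence and the
  measurability of limits are statements about sequences.\<close>

lemma pd_sequential:
  fixes f :: "'a::euclidean_space \<Rightarrow> 'b::real_normed_vector"
  assumes f: "f differentiable (at x)" and e: "e \<noteq> 0"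
  shows "(\<lambda>n. real (Suc n) *\<^sub>R (f (x + inverse (real (Suc n)) *\<^sub>R e) - f x)) \<longlonglongrightarrow> pd e f x"
proof -
  define D where "D = frechet_derivative f (at x)"
  have der: "(f has_derivative D) (at x)"
    using f by (simp add: D_def frechet_derivative_works[symmetric])
  interpret D: bounded_linear D using der by (rule has_derivative_bounded_linear)
  define h where "h n = inverse (real (Suc n)) *\<^sub>R e" for n
  have "h \<longlonglongrightarrow> 0"
    unfolding h_def using tendsto_scaleR[OF LIMSEQ_inverse_real_of_nat tendsto_const, of e] by simp
  then have "filterlim h (at 0) sequentially"
    using e by (auto simp: filterlim_at h_def)
  moreover have "((\<lambda>h. norm (f (x + h) - f x - D h) / norm h) \<longlongrightarrow> 0) (at 0)"
    using der by (simp add: has_derivative_at)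
  ultimately have "(\<lambda>n. norm (f (x + h n) - f x - D (h n)) / norm (h n)) \<longlonglongrightarrow> 0"
    by (rule filterlim_compose[rotated])
  then have "(\<lambda>n. norm (f (x + h n) - f x - D (h n)) / norm (h n) * norm e) \<longlonglongrightarrow> 0 * norm e"
    by (intro tendsto_intros)
  moreover have "norm (f (x + h n) - f x - D (h n)) / norm (h n) * norm e =
      norm (real (Suc n) *\<^sub>R (f (x + h n) - f x) - D e)" for n
  proof -
    have "real (Suc n) *\<^sub>R D (h n) = D e" by (simp add: h_def D.scaleR)
    then have "real (Suc n) *\<^sub>R (f (x + h n) - f x) - D e = real (Suc n) *\<^sub>R (f (x + h n) - f x - D (h n))"
      by (metis scaleR_diff_right)
    moreover have "norm (h n) = inverse (real (Suc n)) * norm e" by (simp add: h_def)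
    ultimately show ?thesis using e by (simp add: divide_inverse del: of_nat_Suc)
  qed
  ultimately have "(\<lambda>n. real (Suc n) *\<^sub>R (f (x + h n) - f x) - D e) \<longlonglongrightarrow> 0"
    by (simp add: tendsto_norm_zero_iff)
  then show ?thesis
    unfolding pd_def D_def[symmetric] h_def by (simp add: LIM_zero_iff)
qed

text \<open>
  Translation invariance makes the integral of every difference quotient vanish, which replaces
  integration by parts along lines.
\<close>

lemma integral_difference_quotient_zero:
  fixes f :: "'a::euclidean_space \<Rightarrow> 'b::euclidean_space"
  assumes "integrable lborel f"
  shows "(LINT x|lborel. c *\<^sub>R (f (x + h) - f x)) = 0"
proof -
  have f: "f \<in> borel_measurable borel" using assms by auto
  have shift: "(LINT x|lborel. f (x + h)) = (LINT x|lborel. f x)"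
    using integral_distr[of "(+) h" lborel borel f] f by (simp add: lborel_distr_plus add.commute)
  have "integrable lborel (\<lambda>x. f (x + h))"
    using integrable_distr_eq[of "(+) h" lborel borel f] f assms by (simp add: lborel_distr_plus add.commute)
  with assms shift show ?thesis by simp
qed

context bounded_open
begin

text \<open>The difference quotients of \<open>\<phi> v\<close> have integral 0, are bounded by a
  Lipschitz constant on a bounded region, and converge almost everywhere to the product rule
  expression. Dominated convergence turns this into the integration by parts formula.\<close>

lemma Lipschitz_has_weak_partial:
  fixes v :: "real^'n \<Rightarrow> 'b::euclidean_space"
  assumes lip: "\<And>x y. x \<in> U \<Longrightarrow> y \<in> U \<Longrightarrow> norm (v x - v y) \<le> L * norm (x - y)"
    and bnd: "\<And>x. x \<in> U \<Longrightarrow> norm (v x) \<le> B"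
    and diff: "AE x in lebesgue. x \<in> U \<longrightarrow> v differentiable (at x)"
  shows "\<exists>g. has_weak_partial U i v g \<and> bdd_meas (lebesgue_on U) g"
proof -
  define e :: "real^'n" where "e = axis i 1"
  have e: "e \<noteq> 0" "norm e = 1" "e \<in> Basis" by (simp_all add: e_def)
  define h where "h n = inverse (real (Suc n)) *\<^sub>R e" for n
  have h0: "h \<longlonglongrightarrow> 0"
    unfolding h_def using tendsto_scaleR[OF LIMSEQ_inverse_real_of_nat tendsto_const, of e] by simp
  have hn: "norm (h n) \<le> 1" "real (Suc n) * norm (h n) = 1" for n
    by (simp_all add: h_def e divide_simps)
  have cball_finite: "emeasure lborel (cball (0::real^'n) r) < top" for r
    using emeasure_bounded_finite[of "cball (0::real^'n) r"] by simp
  \<comment> \<open>Extension by zero makes sense of the shifted values \<open>w (x + h n)\<close>.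
    Its jump across the boundary of \<open>U\<close> does no harm, because \<open>w\<close> is only
    used close to points of \<open>U\<close> or multiplied by a test function.\<close>
  define w where "w x = indicat_real U x *\<^sub>R v x" for x
  have "lipschitz_on \<bar>L\<bar> U v"
  proof (rule lipschitz_onI)
    fix x y assume "x \<in> U" "y \<in> U"
    then have "norm (v x - v y) \<le> L * norm (x - y)" by (rule lip)
    also have "\<dots> \<le> \<bar>L\<bar> * norm (x - y)" by (intro mult_right_mono) auto
    finally show "dist (v x) (v y) \<le> \<bar>L\<bar> * dist x y" by (simp add: dist_norm)
  qed simp
  then have cont: "continuous_on U v" by (rule lipschitz_on_continuous_on)
  have w_meas: "w \<in> borel_measurable borel"
    unfolding w_def using cont open_U by (intro borel_measurable_continuous_on_indicator) auto
  \<comment> \<open>Defined as a sequential limit at every point, so that Borel measurability comes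
    for free; it is identified with \<open>pd e v\<close> only where \<open>v\<close> is
    differentiable.\<close>
  define g where "g x = lim (\<lambda>n. real (Suc n) *\<^sub>R (w (x + h n) - w x))" for x
  have shift_meas: "(\<lambda>x. f (x + h n)) \<in> borel_measurable borel" if "f \<in> borel_measurable borel"
    for f :: "real^'n \<Rightarrow> 'b" and n
    by (rule measurable_compose[OF _ that]) auto
  have g_meas: "g \<in> borel_measurable borel"
    unfolding g_def using w_meas shift_meas[OF w_meas] by (intro borel_measurable_lim_metric) auto
  have near: "eventually (\<lambda>n. x + h n \<in> U) sequentially" if "x \<in> U" for x
  proof -
    have "(\<lambda>n. x + h n) \<longlonglongrightarrow> x + 0" by (intro tendsto_intros h0)
    then show ?thesis using open_U that by (auto dest: topological_tendstoD)
  qed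
  have w_diff: "(w has_derivative D) (at x)" if "x \<in> U" "(v has_derivative D) (at x)" for x D
    by (rule has_derivative_transform_within_open[OF that(2) open_U that(1)]) (simp add: w_def)
  have glim: "(\<lambda>n. real (Suc n) *\<^sub>R (w (x + h n) - w x)) \<longlonglongrightarrow> g x"
    and g_eq: "g x = pd e v x"
    if x: "x \<in> U" "v differentiable (at x)" for x
  proof -
    obtain D where D: "(v has_derivative D) (at x)" using x(2) by (auto simp: differentiable_def)
    have "(\<lambda>n. real (Suc n) *\<^sub>R (w (x + h n) - w x)) \<longlonglongrightarrow> pd e w x"
      unfolding h_def using w_diff[OF x(1) D] e by (intro pd_sequential) (auto simp: differentiable_def)
    moreover have "pd e w x = pd e v x"
      using pd_eqI[OF w_diff[OF x(1) D]] pd_eqI[OF D] by simp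
    ultimately show "g x = pd e v x"
      and "(\<lambda>n. real (Suc n) *\<^sub>R (w (x + h n) - w x)) \<longlonglongrightarrow> g x"
      by (auto simp: g_def limI)
  qed
  have g_bound: "norm (g x) \<le> \<bar>L\<bar>" if x: "x \<in> U" "v differentiable (at x)" for x
  proof (rule Lim_norm_ubound[OF _ glim[OF x]])
    show "eventually (\<lambda>n. norm (real (Suc n) *\<^sub>R (w (x + h n) - w x)) \<le> \<bar>L\<bar>) sequentially"
      using near[OF x(1)]
    proof eventually_elim
      case (elim n)
      then have "norm (w (x + h n) - w x) \<le> L * norm (h n)"
        using lip[of "x + h n" x] x by (simp add: w_def)
      also have "\<dots> \<le> \<bar>L\<bar> * norm (h n)" by (intro mult_right_mono) auto
      finally have "real (Suc n) * norm (w (x + h n) - w x) \<le> real (Suc n) * (\<bar>L\<bar> * norm (h n))"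
        by (intro mult_left_mono) auto
      also have "\<dots> = \<bar>L\<bar>" using hn(2)[of n] by (simp add: mult.left_commute)
      finally show ?case by simp
    qed
  qed simp
  have g_bdd: "bdd_meas (lebesgue_on U) g"
  proof -
    have "AE x in lebesgue_on U. norm (g x) \<le> \<bar>L\<bar>"
      unfolding AE_U_iff using diff by eventually_elim (auto intro: g_bound)
    moreover have "g \<in> borel_measurable (lebesgue_on U)"
      using g_meas by (intro measurable_restrict_space1 measurable_completion) simp
    ultimately show ?thesis by (auto simp: bdd_meas_def)
  qed
  have v_bdd: "bdd_meas (lebesgue_on U) v"
  proof -
    have "AE x in lebesgue_on U. norm (v x) \<le> B"
      unfolding AE_U_iff using bnd by auto
    moreover have "v \<in> borel_measurable (lebesgue_on U)"
      using cont by (intro continuous_imp_measurable_on_sets_lebesgue U_lebesgue)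
    ultimately show ?thesis by (auto simp: bdd_meas_def)
  qed
  have "(LINT x|lebesgue_on U. pd e \<phi> x *\<^sub>R v x) = - (LINT x|lebesgue_on U. \<phi> x *\<^sub>R g x)"
    if \<phi>: "test_fun U \<phi>" for \<phi> :: "real^'n \<Rightarrow> real"
  proof -
    obtain K where K: "compact K" "K \<subseteq> U" "\<And>x. x \<notin> K \<Longrightarrow> \<phi> x = 0"
      using \<phi> by (auto simp: test_fun_def)
    obtain C where C: "C \<ge> 0" "\<And>x. norm (\<phi> x) \<le> C" using test_fun_bounded[OF \<phi>] by blast
    obtain L' where L': "L' \<ge> 0" "\<And>x y. norm (\<phi> x - \<phi> y) \<le> L' * norm (x - y)"
      using test_fun_Lipschitz[OF \<phi>] by blast
    have \<phi>_cont: "continuous_on UNIV \<phi>" using \<phi> Ck_continuous by (auto simp: test_fun_def)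
    have \<phi>_diff: "\<phi> differentiable (at x)" for x
      using \<phi> Ck_differentiable[of 0 \<phi> x] by (auto simp: test_fun_def simp del: Ck.simps)
    have \<phi>_meas: "\<phi> \<in> borel_measurable borel" using \<phi>_cont by (rule borel_measurable_continuous_onI)
    define f where "f x = \<phi> x *\<^sub>R w x" for x
    define d where "d n x = real (Suc n) *\<^sub>R (f (x + h n) - f x)" for n x
    define G where "G x = indicat_real U x *\<^sub>R (pd e \<phi> x *\<^sub>R v x + \<phi> x *\<^sub>R g x)" for x
    obtain R where R: "\<And>x. x \<in> U \<Longrightarrow> norm x \<le> R"
      using bounded_U by (auto simp: bounded_iff)
    have f_meas: "f \<in> borel_measurable borel" unfolding f_def using \<phi>_meas w_meas by auto
    have f_outside: "f x = 0" if "x \<notin> U" for x using that by (simp add: f_def w_def)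
    have B0: "norm (w x) \<le> \<bar>B\<bar>" for x
      using bnd[of x] by (auto simp: w_def indicator_def)
    have f_int: "integrable lborel f"
    proof (rule Bochner_Integration.integrable_bound)
      show "integrable lborel (\<lambda>x. indicat_real (cball (0::real^'n) R) x *\<^sub>R (C * \<bar>B\<bar>))"
        by (intro integrable_scaleR_left integrable_real_indicator) (auto simp: cball_finite)
      show "f \<in> borel_measurable lborel" using f_meas by simp
      have "norm (f x) \<le> norm (indicat_real (cball (0::real^'n) R) x *\<^sub>R (C * \<bar>B\<bar>))" for x
      proof (cases "x \<in> U")
        case True
        then show ?thesis using R[of x] C B0[of x]
          by (auto simp: f_def abs_mult intro!: mult_mono)
      qed (simp add: f_outside)
      then show "AE x in lborel. norm (f x) \<le> norm (indicat_real (cball (0::real^'n) R) x *\<^sub>R (C * \<bar>B\<bar>))" by simp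
    qed
    \<comment> \<open>The Lipschitz constant of a product. It is valid across the boundary of
      \<open>U\<close> as well: if one of the two points is outside, \<open>\<phi>\<close> vanishes
      there, and only the increment of \<open>\<phi>\<close> times a bound for \<open>w\<close>
      remains.\<close>
    define A where "A = C * \<bar>L\<bar> + L' * \<bar>B\<bar>"
    have f_lip: "norm (f y - f x) \<le> A * norm (y - x)" for x y
    proof -
      consider "x \<in> U" "y \<in> U" | "y \<notin> U" | "x \<notin> U" by blast
      then show ?thesis
      proof cases
        case 1
        have "f y - f x = \<phi> y *\<^sub>R (v y - v x) + (\<phi> y - \<phi> x) *\<^sub>R v x"
          using 1 by (simp add: f_def w_def algebra_simps)
        also have "norm \<dots> \<le> norm (\<phi> y) * norm (v y - v x) + norm (\<phi> y - \<phi> x) * norm (v x)"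
          by (rule norm_triangle_le) simp
        also have "\<dots> \<le> C * (\<bar>L\<bar> * norm (y - x)) + (L' * norm (y - x)) * \<bar>B\<bar>"
        proof (intro add_mono mult_mono C L')
          show "norm (v y - v x) \<le> \<bar>L\<bar> * norm (y - x)"
            using lip[OF 1(2,1)] mult_right_mono[OF abs_ge_self norm_ge_zero, of L "y - x"] by linarith
          show "norm (v x) \<le> \<bar>B\<bar>" using bnd[OF 1(1)] by simp
        qed (use L' C in auto)
        also have "\<dots> = A * norm (y - x)" by (simp add: A_def algebra_simps)
        finally show ?thesis .
      next
        case 2
        then have "\<phi> y = 0" using K by blast
        then have "norm (f y - f x) = norm (\<phi> y - \<phi> x) * norm (w x)"
          by (simp add: f_def)
        also have "\<dots> \<le> (L' * norm (y - x)) * \<bar>B\<bar>" by (intro mult_mono L' B0) (use L' in auto)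
        also have "\<dots> \<le> A * norm (y - x)" using C by (simp add: A_def algebra_simps)
        finally show ?thesis .
      next
        case 3
        then have "\<phi> x = 0" using K by blast
        then have "norm (f y - f x) = norm (\<phi> y - \<phi> x) * norm (w y)"
          by (simp add: f_def)
        also have "\<dots> \<le> (L' * norm (y - x)) * \<bar>B\<bar>" by (intro mult_mono L' B0) (use L' in auto)
        also have "\<dots> \<le> A * norm (y - x)" using C by (simp add: A_def algebra_simps)
        finally show ?thesis .
      qed
    qed
    have pd_meas: "pd e \<phi> \<in> borel_measurable borel"
    proof -
      have "Ck 1 \<phi>" using \<phi> by (auto simp: test_fun_def simp del: Ck.simps)
      then show ?thesis using e(3) by (intro borel_measurable_continuous_onI) simp
    qed
    have "(\<lambda>n. LINT x|lebesgue. d n x) \<longlonglongrightarrow> (LINT x|lebesgue. G x)"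
    \<comment> \<open>\<open>U\<close> lies in the ball of radius \<open>R\<close> and the steps
      have length at most 1, so all quotients vanish outside the ball of radius
      \<open>R + 1\<close>.\<close>
    proof (rule integral_dominated_convergence[where w = "\<lambda>x. indicat_real (cball (0::real^'n) (R + 1)) x *\<^sub>R A"])
      have "G = (\<lambda>x. pd e \<phi> x *\<^sub>R w x + (indicat_real U x * \<phi> x) *\<^sub>R g x)"
        by (auto simp: G_def w_def fun_eq_iff scaleR_add_right)
      moreover have "\<dots> \<in> borel_measurable borel"
        using pd_meas w_meas g_meas \<phi>_meas open_U by (auto intro!: borel_measurable_add borel_measurable_scaleR)
      ultimately show "G \<in> borel_measurable lebesgue" by (auto intro: measurable_completion)
      show "d n \<in> borel_measurable lebesgue" for n
        unfolding d_def using f_meas shift_meas[OF f_meas] by (auto intro!: measurable_completion)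
      show "integrable lebesgue (\<lambda>x. indicat_real (cball (0::real^'n) (R + 1)) x *\<^sub>R A)"
        by (intro integrable_scaleR_left integrable_real_indicator) (auto simp: cball_finite)
      show "AE x in lebesgue. norm (d n x) \<le> indicat_real (cball (0::real^'n) (R + 1)) x *\<^sub>R A" for n
      proof (rule AE_I2)
        fix x
        show "norm (d n x) \<le> indicat_real (cball (0::real^'n) (R + 1)) x *\<^sub>R A"
        proof (cases "norm x \<le> R + 1")
          case True
          have "real (Suc n) * norm (f (x + h n) - f x) \<le> real (Suc n) * (A * norm (h n))"
            using f_lip[of "x + h n" x] by (intro mult_left_mono) auto
          also have "\<dots> = A" using hn(2)[of n] by (simp add: mult.left_commute)
          finally show ?thesis using True by (simp add: d_def)
        next
          case False
          have "norm x \<le> norm (x + h n) + norm (h n)"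
            using norm_triangle_ineq4[of "x + h n" "h n"] by simp
          then have "\<not> norm (x + h n) \<le> R" "\<not> norm x \<le> R" using False hn(1)[of n] by auto
          then have "x + h n \<notin> U" "x \<notin> U" using R by blast+
          then show ?thesis using False by (simp add: d_def f_outside)
        qed
      qed
      show "AE x in lebesgue. (\<lambda>n. d n x) \<longlonglongrightarrow> G x"
        using diff
      proof eventually_elim
        case (elim x)
        show ?case
        proof (cases "x \<in> U")
          case True
          with elim have vd: "v differentiable (at x)" by simp
          obtain D where D: "(v has_derivative D) (at x)" using vd by (auto simp: differentiable_def)
          note wD = w_diff[OF True D]
          obtain E where E: "(\<phi> has_derivative E) (at x)" using \<phi>_diff by (auto simp: differentiable_def)
          have fD: "(f has_derivative (\<lambda>y. \<phi> x *\<^sub>R D y + E y *\<^sub>R w x)) (at x)"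
            unfolding f_def by (rule has_derivative_scaleR[OF E wD])
          have "(\<lambda>n. d n x) \<longlonglongrightarrow> pd e f x"
            unfolding d_def h_def using fD e by (intro pd_sequential) (auto simp: differentiable_def)
          moreover have "pd e f x = G x"
            using True pd_eqI[OF fD, of e] pd_eqI[OF D, of e] pd_eqI[OF E, of e] g_eq[OF True vd]
            by (simp add: G_def w_def add.commute)
          ultimately show ?thesis by simp
        next
          \<comment> \<open>A point outside \<open>U\<close> has positive distance from the compact
            support of \<open>\<phi>\<close>, so the quotients are eventually 0. Boundary points of
            \<open>U\<close> are included.\<close>
          case False
          have "open (- K)" using K(1) by (simp add: compact_imp_closed open_Compl)
          moreover have "x \<in> - K" using False K(2) by blast
          moreover have "(\<lambda>n. x + h n) \<longlonglongrightarrow> x + 0" by (intro tendsto_intros h0)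
          ultimately have "eventually (\<lambda>n. x + h n \<in> - K) sequentially"
            by (auto dest: topological_tendstoD)
          then have "eventually (\<lambda>n. d n x = 0) sequentially"
            by eventually_elim (use K(3) False in \<open>auto simp: d_def f_def w_def\<close>)
          then show ?thesis using False by (auto simp: G_def intro: tendsto_eventually)
        qed
      qed
    qed
    moreover have "(LINT x|lebesgue. d n x) = 0" for n
    proof -
      have "d n \<in> borel_measurable lborel" unfolding d_def using f_meas shift_meas[OF f_meas] by simp
      then have "(LINT x|lebesgue. d n x) = (LINT x|lborel. d n x)" by (rule integral_completion)
      then show ?thesis unfolding d_def integral_difference_quotient_zero[OF f_int] .
    qed
    ultimately have "(LINT x|lebesgue. G x) = 0" by (simp add: LIMSEQ_const_iff)
    then have "(LINT x|lebesgue_on U. pd e \<phi> x *\<^sub>R v x + \<phi> x *\<^sub>R g x) = 0"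
      unfolding G_def using U_lebesgue by (simp add: integral_restrict_space)
    moreover have "(LINT x|lebesgue_on U. pd e \<phi> x *\<^sub>R v x + \<phi> x *\<^sub>R g x) =
        (LINT x|lebesgue_on U. pd e \<phi> x *\<^sub>R v x) + (LINT x|lebesgue_on U. \<phi> x *\<^sub>R g x)"
      using g_bdd v_bdd bdd_meas_test_fun[OF \<phi>] e
      by (intro Bochner_Integration.integral_add integrable_U bdd_meas_scaleR) auto
    ultimately show ?thesis by (simp add: eq_neg_iff_add_eq_0)
  qed
  then show ?thesis
    unfolding has_weak_partial_def lint_U e_def[symmetric]
    using g_bdd L2_on_bdd_meas by blast
qed

lemma tame_Lipschitz:
  fixes v :: "real^'n \<Rightarrow> 'b::euclidean_space"
  assumes lip: "\<And>x y. x \<in> U \<Longrightarrow> y \<in> U \<Longrightarrow> norm (v x - v y) \<le> L * norm (x - y)"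
    and bnd: "\<And>x. x \<in> U \<Longrightarrow> norm (v x) \<le> B"
    and diff: "AE x in lebesgue. x \<in> U \<longrightarrow> v differentiable (at x)"
    and meas: "v \<in> borel_measurable (lebesgue_on U)"
  shows "tame v"
proof (rule tameI)
  have "AE x in lebesgue_on U. norm (v x) \<le> B"
    unfolding AE_U_iff using bnd by auto
  with meas show "bdd_meas (lebesgue_on U) v" by (auto simp: bdd_meas_def)
qed (use Lipschitz_has_weak_partial[OF lip bnd diff] in blast)

lemma tame_test_fun:
  assumes \<phi>: "test_fun U \<phi>"
  shows "tame \<phi>"
proof -
  obtain B where B: "\<And>x. norm (\<phi> x) \<le> B" using test_fun_bounded[OF \<phi>] by blast
  obtain L where L: "\<And>x y. norm (\<phi> x - \<phi> y) \<le> L * norm (x - y)" using test_fun_Lipschitz[OF \<phi>] by blast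
  have "\<phi> differentiable (at x)" for x
    using \<phi> Ck_differentiable[of 0 \<phi> x] by (auto simp: test_fun_def simp del: Ck.simps)
  then show ?thesis
    using tame_Lipschitz[of \<phi> L B] L B bdd_meas_test_fun(1)[OF \<phi>] by (simp add: bdd_meas_def)
qed

end

section \<open>Piecewise affine functions on the mesh\<close>

locale mesh = bounded_open U for U :: "(real^'n) set" +
  fixes Tr :: "(real^'n) set set"
  assumes convex_U: "convex U"
    and finite_Tr: "finite Tr"
    and cover: "\<Union>Tr = closure U"
    and element: "K \<in> Tr \<Longrightarrow> \<exists>C. finite C \<and> K = convex hull C"
begin

lemma element_closed: "K \<in> Tr \<Longrightarrow> closed K"
  using element[of K] finite_imp_compact_convex_hull compact_imp_closed by blast

lemma element_convex: "K \<in> Tr \<Longrightarrow> convex K"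
  using element[of K] convex_convex_hull by blast

text \<open>Convexity keeps the segment between two points in \<open>closure U\<close>. The elements
  divide its parameter interval into finitely many closed pieces, on each of which the function is
  Lipschitz, and such bounds glue together along an interval. Since neighbouring affine pieces share
  values on closed elements, no jump can occur.\<close>

lemma affine_Lipschitz:
  fixes v :: "real^'n \<Rightarrow> 'b::euclidean_space"
  assumes v: "affine_on_elements Tr v"
  shows "\<exists>L\<ge>0. \<forall>x\<in>closure U. \<forall>y\<in>closure U. norm (v x - v y) \<le> L * norm (x - y)"
proof -
  have "\<exists>L\<ge>0. \<forall>x\<in>K. \<forall>y\<in>K. norm (v x - v y) \<le> L * norm (x - y)" if K: "K \<in> Tr" for K
  proof -
    obtain A c where A: "linear A" "\<forall>x\<in>K. v x = A x + c"
      using v K unfolding affine_on_elements_def by blast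
    obtain L where L: "L > 0" "\<And>z. norm (A z) \<le> L * norm z"
      using linear_bounded_pos[OF A(1)] by blast
    have "norm (v x - v y) \<le> L * norm (x - y)" if "x \<in> K" "y \<in> K" for x y
      using that A(2) L(2)[of "x - y"] by (simp add: linear_diff[OF A(1)])
    with L(1) show ?thesis by (intro exI[of _ L]) auto
  qed
  then obtain L where L: "\<And>K. K \<in> Tr \<Longrightarrow> L K \<ge> 0"
    "\<And>K x y. K \<in> Tr \<Longrightarrow> x \<in> K \<Longrightarrow> y \<in> K \<Longrightarrow> norm (v x - v y) \<le> L K * norm (x - y)"
    by metis
  define S where "S = sum L Tr"
  have S0: "S \<ge> 0" unfolding S_def using L(1) by (rule sum_nonneg)
  have LS: "L K \<le> S" if "K \<in> Tr" for K
    unfolding S_def by (rule member_le_sum[OF that]) (use L(1) finite_Tr in auto)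
  have "norm (v x - v y) \<le> S * norm (x - y)" if x: "x \<in> closure U" and y: "y \<in> closure U" for x y
  proof -
    define p where "p t = x + t *\<^sub>R (y - x)" for t :: real
    define I where "I K = {0..1} \<inter> p -` K" for K
    have cont: "continuous_on {0..1} p" unfolding p_def by (intro continuous_intros)
    have "lipschitz_on (S * norm (y - x)) {0..1} (\<lambda>t. v (p t))"
    proof (rule lipschitz_on_closed_Union[where U = I and I = Tr])
      show "lipschitz_on (S * norm (y - x)) (I K) (\<lambda>t. v (p t))" if K: "K \<in> Tr" for K
      proof (rule lipschitz_onI)
        fix s t assume "s \<in> I K" "t \<in> I K"
        then have "norm (v (p s) - v (p t)) \<le> L K * norm (p s - p t)"
          using L(2)[OF K] by (auto simp: I_def)
        also have "\<dots> \<le> S * norm (p s - p t)" by (intro mult_right_mono LS K) auto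
        also have "p s - p t = (s - t) *\<^sub>R (y - x)" by (simp add: p_def algebra_simps)
        finally show "dist (v (p s)) (v (p t)) \<le> S * norm (y - x) * dist s t"
          by (simp add: dist_norm mult_ac)
      qed (use S0 in auto)
      show "closed (I K)" if "K \<in> Tr" for K
        unfolding I_def using cont element_closed[OF that] by (intro continuous_closed_preimage) auto
      show "finite Tr" by (rule finite_Tr)
      show "0 \<le> S * norm (y - x)" using S0 by simp
      show "{0..1} \<subseteq> (\<Union>K\<in>Tr. I K)"
      proof
        fix t :: real assume t: "t \<in> {0..1}"
        have "p t = (1 - t) *\<^sub>R x + t *\<^sub>R y" by (simp add: p_def algebra_simps)
        also have "\<dots> \<in> closure U"
          using t x y convex_closure[OF convex_U] by (intro convexD) auto
        finally show "t \<in> (\<Union>K\<in>Tr. I K)" using t cover by (auto simp: I_def)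
      qed
    qed
    then have "dist (v (p 0)) (v (p 1)) \<le> S * norm (y - x) * dist 0 (1::real)"
      by (rule lipschitz_onD) auto
    then show ?thesis by (simp add: p_def dist_norm norm_minus_commute)
  qed
  with S0 show ?thesis by (intro exI[of _ S]) auto
qed

lemma affine_bounded:
  fixes v :: "real^'n \<Rightarrow> 'b::euclidean_space"
  assumes v: "affine_on_elements Tr v"
  shows "\<exists>B. \<forall>x\<in>U. norm (v x) \<le> B"
proof (cases "U = {}")
  case False
  then obtain x0 where x0: "x0 \<in> U" by blast
  obtain L where L: "L \<ge> 0" "\<And>x y. x \<in> closure U \<Longrightarrow> y \<in> closure U \<Longrightarrow> norm (v x - v y) \<le> L * norm (x - y)"
    using affine_Lipschitz[OF v] by blast
  obtain R where R: "\<And>x. x \<in> U \<Longrightarrow> norm x \<le> R" using bounded_U by (auto simp: bounded_iff)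
  have "norm (v x) \<le> norm (v x0) + L * (R + R)" if x: "x \<in> U" for x
  proof -
    have cl: "x \<in> closure U" "x0 \<in> closure U" using x x0 closure_subset by blast+
    have "norm (v x) \<le> norm (v x0) + norm (v x - v x0)" by (rule norm_triangle_sub)
    also have "norm (v x - v x0) \<le> L * norm (x - x0)" by (rule L(2)[OF cl])
    also have "norm (x - x0) \<le> R + R" using norm_triangle_ineq4[of x x0] R[OF x] R[OF x0] by linarith
    finally show ?thesis using L(1) by (simp add: mult_left_mono)
  qed
  then show ?thesis by blast
qed simp

text \<open>In the interior of an element the function coincides locally with an affine map. The
  exceptional set lies in the frontiers of finitely many convex sets, which are null sets.\<close>

lemma affine_differentiable_AE:
  fixes v :: "real^'n \<Rightarrow> 'b::euclidean_space"
  assumes v: "affine_on_elements Tr v"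
  shows "AE x in lebesgue. x \<in> U \<longrightarrow> v differentiable (at x)"
proof -
  have "frontier K \<in> null_sets lebesgue" if "K \<in> Tr" for K
    using negligible_convex_frontier[OF element_convex[OF that]] by (simp add: negligible_iff_null_sets)
  then have "AE x in lebesgue. x \<notin> frontier K" if "K \<in> Tr" for K
    using that by (intro AE_not_in)
  then have "AE x in lebesgue. \<forall>K\<in>Tr. x \<notin> frontier K"
    unfolding AE_ball_countable[OF countable_finite[OF finite_Tr]] by blast
  then show ?thesis
  proof eventually_elim
    case (elim x)
    show ?case
    proof
      assume "x \<in> U"
      then have "x \<in> \<Union>Tr" using cover closure_subset by blast
      then obtain K where K: "K \<in> Tr" "x \<in> K" by blast
      then have int: "x \<in> interior K"
        using elim closure_subset[of K] by (auto simp: frontier_def)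
      obtain A c where A: "linear A" "\<forall>x\<in>K. v x = A x + c"
        using v K(1) unfolding affine_on_elements_def by blast
      have "((\<lambda>x. A x + c) has_derivative A) (at x)"
        by (intro has_derivative_add_const linear_imp_has_derivative A(1))
      then have "(v has_derivative A) (at x)"
        by (rule has_derivative_transform_within_open[OF _ open_interior int])
          (metis A(2) interior_subset subsetD)
      then show "v differentiable (at x)" by (auto simp: differentiable_def)
    qed
  qed
qed

lemma affine_tame:
  fixes v :: "real^'n \<Rightarrow> 'b::euclidean_space"
  assumes v: "affine_on_elements Tr v"
  shows "tame v"
proof -
  obtain L where L: "L \<ge> 0" "\<And>x y. x \<in> closure U \<Longrightarrow> y \<in> closure U \<Longrightarrow> norm (v x - v y) \<le> L * norm (x - y)"
    using affine_Lipschitz[OF v] by blast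
  obtain B where B: "\<And>x. x \<in> U \<Longrightarrow> norm (v x) \<le> B" using affine_bounded[OF v] by blast
  have lip: "norm (v x - v y) \<le> L * norm (x - y)" if "x \<in> U" "y \<in> U" for x y
    using L(2) that closure_subset[of U] by blast
  have "lipschitz_on L U v"
    using L(1) lip by (intro lipschitz_onI) (auto simp: dist_norm)
  then have "continuous_on U v" by (rule lipschitz_on_continuous_on)
  then have "v \<in> borel_measurable (lebesgue_on U)"
    by (rule continuous_imp_measurable_on_sets_lebesgue[OF _ U_lebesgue])
  then show ?thesis using tame_Lipschitz[OF lip B affine_differentiable_AE[OF v]] by blast
qed

end

section \<open>Linear structure of \<open>H10\<close> and of the finite element spaces\<close>

context bounded_open
begin

lemma H1_inner_nonneg: "0 \<le> H1_inner U v v"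
  unfolding H1_inner_def lint_U by (intro add_nonneg_nonneg sum_nonneg Bochner_Integration.integral_nonneg) auto

text \<open>A rough substitute for the triangle inequality that follows from
  \<open>|a + b|^2 \<le> 2 |a|^2 + 2 |b|^2\<close> under the integrals. The factor 2 is irrelevant,
  since the estimate is only applied to sequences tending to 0.\<close>

lemma H1_norm_add_le:
  fixes v w :: "real^'n \<Rightarrow> 'b::euclidean_space"
  assumes "tame v" "tame w"
  shows "H1_norm U (\<lambda>x. v x + w x) \<le> 2 * H1_norm U v + 2 * H1_norm U w"
proof -
  have pt: "(a + b) \<bullet> (a + b) \<le> 2 * (a \<bullet> a) + 2 * (b \<bullet> b)" for a b :: 'b
    using inner_ge_zero[of "a - b"] by (simp add: inner_simps inner_commute)
  have int: "(LINT x|lebesgue_on U. s x \<bullet> s x) \<le>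
      2 * (LINT x|lebesgue_on U. f x \<bullet> f x) + 2 * (LINT x|lebesgue_on U. g x \<bullet> g x)"
    if "bdd_meas (lebesgue_on U) f" "bdd_meas (lebesgue_on U) g" "bdd_meas (lebesgue_on U) s"
      "AE x in lebesgue_on U. s x = f x + g x" for f g s :: "real^'n \<Rightarrow> 'b"
  proof -
    note i = integrable_U[OF bdd_meas_inner[OF that(1) that(1)]] integrable_U[OF bdd_meas_inner[OF that(2) that(2)]]
      integrable_U[OF bdd_meas_inner[OF that(3) that(3)]]
    have "(LINT x|lebesgue_on U. s x \<bullet> s x) \<le> (LINT x|lebesgue_on U. 2 * (f x \<bullet> f x) + 2 * (g x \<bullet> g x))"
      by (rule integral_mono_AE) (use i that(4) pt in \<open>auto elim!: eventually_mono\<close>)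
    also have "\<dots> = 2 * (LINT x|lebesgue_on U. f x \<bullet> f x) + 2 * (LINT x|lebesgue_on U. g x \<bullet> g x)"
      using i by simp
    finally show ?thesis .
  qed
  have "H1_inner U (\<lambda>x. v x + w x) (\<lambda>x. v x + w x) \<le> 2 * H1_inner U v v + 2 * H1_inner U w w"
  proof -
    note a = tame_add[OF assms]
    have "(LINT x|lebesgue_on U. (v x + w x) \<bullet> (v x + w x)) \<le>
      2 * (LINT x|lebesgue_on U. v x \<bullet> v x) + 2 * (LINT x|lebesgue_on U. w x \<bullet> w x)"
      by (rule int) (use assms a in \<open>auto simp: tame_def\<close>)
    moreover have "(\<Sum>i\<in>UNIV. LINT x|lebesgue_on U. wpd U i (\<lambda>x. v x + w x) x \<bullet> wpd U i (\<lambda>x. v x + w x) x) \<le>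
      (\<Sum>i\<in>UNIV. 2 * (LINT x|lebesgue_on U. wpd U i v x \<bullet> wpd U i v x) + 2 * (LINT x|lebesgue_on U. wpd U i w x \<bullet> wpd U i w x))"
      by (rule sum_mono, rule int) (use assms a in \<open>auto simp: tame_def\<close>)
    ultimately show ?thesis
      unfolding H1_inner_def lint_U by (simp add: sum.distrib sum_distrib_left[symmetric] algebra_simps)
  qed
  also have "\<dots> \<le> (2 * H1_norm U v + 2 * H1_norm U w)\<^sup>2"
  proof -
    define a b where "a = H1_norm U v" and "b = H1_norm U w"
    have ab: "a \<ge> 0" "b \<ge> 0" "H1_inner U v v = a\<^sup>2" "H1_inner U w w = b\<^sup>2"
      by (simp_all add: a_def b_def H1_norm_def H1_inner_nonneg)
    have "(2 * a + 2 * b)\<^sup>2 = 2 * a\<^sup>2 + 2 * b\<^sup>2 + (2 * a\<^sup>2 + 2 * b\<^sup>2 + 8 * (a * b))"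
      by (simp add: power2_eq_square algebra_simps)
    then show ?thesis using ab by (simp add: a_def[symmetric] b_def[symmetric])
  qed
  finally show ?thesis
    unfolding H1_norm_def by (intro real_le_lsqrt) (auto intro!: add_nonneg_nonneg H1_inner_nonneg)
qed

lemma H1_norm_scaleR:
  fixes v :: "real^'n \<Rightarrow> 'b::euclidean_space"
  assumes "tame v"
  shows "H1_norm U (\<lambda>x. c *\<^sub>R v x) = \<bar>c\<bar> * H1_norm U v"
proof -
  have 1: "(LINT x|lebesgue_on U. (c *\<^sub>R v x) \<bullet> (c *\<^sub>R v x)) = c\<^sup>2 * (LINT x|lebesgue_on U. v x \<bullet> v x)"
    by (simp add: power2_eq_square mult.assoc)
  have 2: "(LINT x|lebesgue_on U. wpd U i (\<lambda>x. c *\<^sub>R v x) x \<bullet> wpd U i (\<lambda>x. c *\<^sub>R v x) x) =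
      c\<^sup>2 * (LINT x|lebesgue_on U. wpd U i v x \<bullet> wpd U i v x)" for i
  proof -
    have "(LINT x|lebesgue_on U. wpd U i (\<lambda>x. c *\<^sub>R v x) x \<bullet> wpd U i (\<lambda>x. c *\<^sub>R v x) x) =
      (LINT x|lebesgue_on U. c\<^sup>2 * (wpd U i v x \<bullet> wpd U i v x))"
    proof (rule integral_cong_AE)
      have m: "wpd U i (\<lambda>x. c *\<^sub>R v x) \<in> borel_measurable (lebesgue_on U)" "wpd U i v \<in> borel_measurable (lebesgue_on U)"
        using assms tame_scaleR(1)[OF assms, of c] by (auto simp: tame_def bdd_meas_def)
      show "(\<lambda>x. wpd U i (\<lambda>x. c *\<^sub>R v x) x \<bullet> wpd U i (\<lambda>x. c *\<^sub>R v x) x) \<in> borel_measurable (lebesgue_on U)"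
        "(\<lambda>x. c\<^sup>2 * (wpd U i v x \<bullet> wpd U i v x)) \<in> borel_measurable (lebesgue_on U)"
        using m by auto
      show "AE x in lebesgue_on U. wpd U i (\<lambda>x. c *\<^sub>R v x) x \<bullet> wpd U i (\<lambda>x. c *\<^sub>R v x) x = c\<^sup>2 * (wpd U i v x \<bullet> wpd U i v x)"
        using tame_scaleR(2)[OF assms, of i c] by eventually_elim (simp add: power2_eq_square)
    qed
    then show ?thesis by simp
  qed
  have "H1_inner U (\<lambda>x. c *\<^sub>R v x) (\<lambda>x. c *\<^sub>R v x) = c\<^sup>2 * H1_inner U v v"
    unfolding H1_inner_def lint_U 1 2 by (simp add: algebra_simps sum_distrib_left)
  then show ?thesis unfolding H1_norm_def by (simp add: real_sqrt_mult)
qed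

text \<open>The sums of the approximating test functions approximate the sum. Tameness of all
  functions involved makes \<open>wpd\<close> of a sum equal to the sum of the \<open>wpd\<close>
  almost everywhere, which the norm estimate rests on.\<close>

lemma H10_add:
  fixes v w :: "real^'n \<Rightarrow> 'b::euclidean_space"
  assumes "v \<in> H10 U" "w \<in> H10 U" "tame v" "tame w"
  shows "(\<lambda>x. v x + w x) \<in> H10 U"
proof -
  obtain \<phi> \<psi> where \<phi>: "\<And>k. test_fun U (\<phi> k)" "(\<lambda>k::nat. H1_norm U (\<lambda>x. v x - \<phi> k x)) \<longlonglongrightarrow> 0"
    and \<psi>: "\<And>k. test_fun U (\<psi> k)" "(\<lambda>k::nat. H1_norm U (\<lambda>x. w x - \<psi> k x)) \<longlonglongrightarrow> 0"
    using assms(1,2) unfolding H10_def by blast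
  have sub: "tame (\<lambda>x. f x - \<eta> x)" if "tame f" "test_fun U \<eta>" for f \<eta> :: "real^'n \<Rightarrow> 'b"
    using tame_add(1)[OF that(1) tame_scaleR(1)[OF tame_test_fun[OF that(2)], of "-1"]] by simp
  have "(\<lambda>k. H1_norm U (\<lambda>x. (v x + w x) - (\<phi> k x + \<psi> k x))) \<longlonglongrightarrow> 0"
  proof (rule Lim_null_comparison)
    show "(\<lambda>k. 2 * H1_norm U (\<lambda>x. v x - \<phi> k x) + 2 * H1_norm U (\<lambda>x. w x - \<psi> k x)) \<longlonglongrightarrow> 0"
      using tendsto_add[OF tendsto_mult_right_zero[OF \<phi>(2), of 2] tendsto_mult_right_zero[OF \<psi>(2), of 2]] by simp
    have "H1_norm U (\<lambda>x. (v x + w x) - (\<phi> k x + \<psi> k x)) \<le>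
        2 * H1_norm U (\<lambda>x. v x - \<phi> k x) + 2 * H1_norm U (\<lambda>x. w x - \<psi> k x)" for k
      using H1_norm_add_le[OF sub[OF assms(3) \<phi>(1)] sub[OF assms(4) \<psi>(1)], of k k]
      by (simp add: algebra_simps)
    moreover have "0 \<le> H1_norm U f" for f :: "real^'n \<Rightarrow> 'b" by (simp add: H1_norm_def H1_inner_nonneg)
    ultimately show "eventually (\<lambda>k. norm (H1_norm U (\<lambda>x. (v x + w x) - (\<phi> k x + \<psi> k x))) \<le>
        2 * H1_norm U (\<lambda>x. v x - \<phi> k x) + 2 * H1_norm U (\<lambda>x. w x - \<psi> k x)) sequentially"
      by simp
  qed
  moreover have "(\<lambda>x. v x + w x) \<in> H1 U" by (rule tame_H1[OF tame_add(1)[OF assms(3,4)]])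
  ultimately show ?thesis
    unfolding H10_def using test_fun_add[OF \<phi>(1) \<psi>(1)]
    by (auto intro!: exI[of _ "\<lambda>k x. \<phi> k x + \<psi> k x"])
qed

lemma H10_scaleR:
  fixes v :: "real^'n \<Rightarrow> 'b::euclidean_space"
  assumes "v \<in> H10 U" "tame v"
  shows "(\<lambda>x. c *\<^sub>R v x) \<in> H10 U"
proof -
  obtain \<phi> where \<phi>: "\<And>k. test_fun U (\<phi> k)" "(\<lambda>k::nat. H1_norm U (\<lambda>x. v x - \<phi> k x)) \<longlonglongrightarrow> 0"
    using assms(1) unfolding H10_def by blast
  have "tame (\<lambda>x. v x - \<phi> k x)" for k
    using tame_add(1)[OF assms(2) tame_scaleR(1)[OF tame_test_fun[OF \<phi>(1)], of "-1"]] by simp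
  then have "H1_norm U (\<lambda>x. c *\<^sub>R v x - c *\<^sub>R \<phi> k x) = \<bar>c\<bar> * H1_norm U (\<lambda>x. v x - \<phi> k x)" for k
    using H1_norm_scaleR[of "\<lambda>x. v x - \<phi> k x" c] by (simp add: scaleR_diff_right)
  then have "(\<lambda>k. H1_norm U (\<lambda>x. c *\<^sub>R v x - c *\<^sub>R \<phi> k x)) \<longlonglongrightarrow> 0"
    using tendsto_mult_right_zero[OF \<phi>(2), of "\<bar>c\<bar>"] by simp
  moreover have "(\<lambda>x. c *\<^sub>R v x) \<in> H1 U" by (rule tame_H1[OF tame_scaleR(1)[OF assms(2)]])
  ultimately show ?thesis
    unfolding H10_def using test_fun_scaleR[OF \<phi>(1)]
    by (auto intro!: exI[of _ "\<lambda>k x. c *\<^sub>R \<phi> k x"])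
qed

lemma H10_zero: "(\<lambda>x. 0 :: 'b::euclidean_space) \<in> H10 U"
proof -
  have t: "tame (\<lambda>x. 0 :: 'b)" by (rule tame_zero) auto
  have "H1_norm U (\<lambda>x. 0 :: 'b) = 0" using H1_norm_scaleR[OF t, of 0] by simp
  then show ?thesis
    unfolding H10_def using tame_H1[OF t] test_fun_zero
    by (auto intro!: exI[of _ "\<lambda>k x. 0"])
qed

end

context mesh
begin

lemma P1_zero_affine: "v \<in> P1_zero U Tr \<Longrightarrow> affine_on_elements Tr v"
  by (simp add: P1_zero_def)

lemma affine_add: "affine_on_elements Tr v \<Longrightarrow> affine_on_elements Tr w \<Longrightarrow> affine_on_elements Tr (\<lambda>x. v x + w x)"
  unfolding affine_on_elements_def
proof
  fix K assume vw: "\<forall>K\<in>Tr. \<exists>A c. linear A \<and> (\<forall>x\<in>K. v x = A x + c)"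
    "\<forall>K\<in>Tr. \<exists>A c. linear A \<and> (\<forall>x\<in>K. w x = A x + c)" and K: "K \<in> Tr"
  obtain A c A' c' where "linear A" "\<forall>x\<in>K. v x = A x + c" "linear A'" "\<forall>x\<in>K. w x = A' x + c'"
    using vw K by meson
  then show "\<exists>A c. linear A \<and> (\<forall>x\<in>K. v x + w x = A x + c)"
    by (intro exI[of _ "\<lambda>x. A x + A' x"] exI[of _ "c + c'"]) (auto intro: linear_compose_add)
qed

lemma affine_scaleR: "affine_on_elements Tr v \<Longrightarrow> affine_on_elements Tr (\<lambda>x. r *\<^sub>R v x)"
  unfolding affine_on_elements_def
proof
  fix K assume v: "\<forall>K\<in>Tr. \<exists>A c. linear A \<and> (\<forall>x\<in>K. v x = A x + c)" and K: "K \<in> Tr"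
  obtain A c where "linear A" "\<forall>x\<in>K. v x = A x + c" using v K by meson
  then show "\<exists>A c. linear A \<and> (\<forall>x\<in>K. r *\<^sub>R v x = A x + c)"
    by (intro exI[of _ "\<lambda>x. r *\<^sub>R A x"] exI[of _ "r *\<^sub>R c"]) (auto intro: linear_compose_scale_right simp: scaleR_add_right)
qed

lemma P1_zero_tame: "v \<in> P1_zero U Tr \<Longrightarrow> tame v"
  using P1_zero_affine affine_tame by blast

lemma P1_zero_add: "v \<in> P1_zero U Tr \<Longrightarrow> w \<in> P1_zero U Tr \<Longrightarrow> (\<lambda>x. v x + w x) \<in> P1_zero U Tr"
  using H10_add P1_zero_tame affine_add unfolding P1_zero_def by blast

lemma P1_zero_scaleR: "v \<in> P1_zero U Tr \<Longrightarrow> (\<lambda>x. r *\<^sub>R v x) \<in> P1_zero U Tr"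
  using H10_scaleR P1_zero_tame affine_scaleR unfolding P1_zero_def by blast

lemma P1_zero_zero: "(\<lambda>x. 0) \<in> P1_zero U Tr"
  using H10_zero unfolding P1_zero_def affine_on_elements_def
  by (auto intro!: exI[of _ "\<lambda>x. 0"] linear_zero)

lemma P1_zero_sum:
  assumes "finite I" "\<And>j. j \<in> I \<Longrightarrow> v j \<in> P1_zero U Tr"
  shows "(\<lambda>x. \<Sum>j\<in>I. c j *\<^sub>R v j x) \<in> P1_zero U Tr"
  using assms
proof (induction I rule: finite_induct)
  case (insert k I)
  have "(\<lambda>x. c k *\<^sub>R v k x + (\<Sum>j\<in>I. c j *\<^sub>R v j x)) \<in> P1_zero U Tr"
    by (rule P1_zero_add[OF P1_zero_scaleR]) (use insert in auto)
  with insert.hyps show ?case by simp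
qed (simp add: P1_zero_zero)

text \<open>The zero set of an affine map is convex, hence contains an element as soon as it
  contains its vertices. The finite set \<open>V\<close> does not depend on \<open>v\<close>; this
  is the finite-dimensionality of the finite element space in a form that ignores values off
  \<open>closure U\<close>.\<close>

lemma affine_zero_at_vertices:
  "\<exists>V. finite V \<and> (\<forall>v :: real^'n \<Rightarrow> 'b::euclidean_space. affine_on_elements Tr v \<longrightarrow>
     (\<forall>x\<in>V. v x = 0) \<longrightarrow> (\<forall>x\<in>closure U. v x = 0))"
proof -
  obtain C where C: "\<And>K. K \<in> Tr \<Longrightarrow> finite (C K) \<and> K = convex hull (C K)"
    using element by metis
  have "v x = 0" if v: "affine_on_elements Tr v" "\<forall>x\<in>(\<Union>K\<in>Tr. C K). v x = 0" and x: "x \<in> closure U"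
    for v :: "real^'n \<Rightarrow> 'b" and x
  proof -
    obtain K where K: "K \<in> Tr" "x \<in> K" using x cover by blast
    obtain A c where A: "linear A" "\<forall>x\<in>K. v x = A x + c"
      using v(1) K(1) unfolding affine_on_elements_def by blast
    have "convex {z. A z + c = 0}"
    proof (rule convexI, simp)
      fix y z :: "real^'n" and s t :: real
      assume *: "A y + c = 0" "A z + c = 0" "0 \<le> s" "0 \<le> t" "s + t = 1"
      have "A (s *\<^sub>R y + t *\<^sub>R z) + c = s *\<^sub>R (A y + c) + t *\<^sub>R (A z + c)"
        using *(5) by (simp add: linear_add[OF A(1)] linear_scale[OF A(1)] algebra_simps
            scaleR_add_left[symmetric])
      with * show "A (s *\<^sub>R y + t *\<^sub>R z) + c = 0" by simp
    qed
    moreover have "C K \<subseteq> {z. A z + c = 0}"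
    proof
      fix z assume z: "z \<in> C K"
      then have "z \<in> K" using C[OF K(1)] hull_inc by metis
      with A(2) v(2) K(1) z show "z \<in> {z. A z + c = 0}" by auto
    qed
    ultimately have "K \<subseteq> {z. A z + c = 0}"
      using C[OF K(1)] hull_minimal by metis
    with K(2) A(2) show ?thesis by auto
  qed
  moreover have "finite (\<Union>K\<in>Tr. C K)" using finite_Tr C by blast
  ultimately show ?thesis by blast
qed

end

section \<open>Orthonormal systems for degenerate inner products\<close>

text \<open>Definiteness is left out on purpose: a nonzero total function that vanishes on the
  domain is a null vector. Linearity is demanded in the first argument only; symmetry supplies the
  second.\<close>

locale semi_inner_space =
  fixes V :: "('a \<Rightarrow> 'b::real_vector) set" and ip :: "('a \<Rightarrow> 'b) \<Rightarrow> ('a \<Rightarrow> 'b) \<Rightarrow> real"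
  assumes zero_in: "(\<lambda>x. 0) \<in> V"
    and add_in: "u \<in> V \<Longrightarrow> v \<in> V \<Longrightarrow> (\<lambda>x. u x + v x) \<in> V"
    and scale_in: "v \<in> V \<Longrightarrow> (\<lambda>x. c *\<^sub>R v x) \<in> V"
    and ip_add: "u \<in> V \<Longrightarrow> v \<in> V \<Longrightarrow> w \<in> V \<Longrightarrow> ip (\<lambda>x. u x + v x) w = ip u w + ip v w"
    and ip_scale: "v \<in> V \<Longrightarrow> w \<in> V \<Longrightarrow> ip (\<lambda>x. c *\<^sub>R v x) w = c * ip v w"
    and ip_sym: "v \<in> V \<Longrightarrow> w \<in> V \<Longrightarrow> ip v w = ip w v"
    and ip_nonneg: "v \<in> V \<Longrightarrow> 0 \<le> ip v v"
begin

lemma diff_in: "u \<in> V \<Longrightarrow> v \<in> V \<Longrightarrow> (\<lambda>x. u x - v x) \<in> V"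
  using add_in[of u "\<lambda>x. (-1) *\<^sub>R v x"] scale_in[of v "-1"] by simp

lemma ip_diff: "u \<in> V \<Longrightarrow> v \<in> V \<Longrightarrow> w \<in> V \<Longrightarrow> ip (\<lambda>x. u x - v x) w = ip u w - ip v w"
  using ip_add[of u "\<lambda>x. (-1) *\<^sub>R v x" w] ip_scale[of v w "-1"] scale_in[of v "-1"] by simp

lemma sum_in:
  assumes "\<And>i. i < (m::nat) \<Longrightarrow> w i \<in> V"
  shows "(\<lambda>x. \<Sum>i<m. c i *\<^sub>R w i x) \<in> V"
  using assms
proof (induction m)
  case 0
  show ?case using zero_in by simp
next
  case (Suc m)
  then show ?case using add_in[OF Suc.IH scale_in[of "w m" "c m"]] by simp
qed

lemma ip_sum:
  assumes "\<And>i. i < (m::nat) \<Longrightarrow> w i \<in> V" "u \<in> V"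
  shows "ip (\<lambda>x. \<Sum>i<m. c i *\<^sub>R w i x) u = (\<Sum>i<m. c i * ip (w i) u)"
  using assms(1)
proof (induction m)
  case 0
  show ?case using ip_scale[OF zero_in assms(2), of 0] by simp
next
  case (Suc m)
  have "ip (\<lambda>x. (\<Sum>i<m. c i *\<^sub>R w i x) + c m *\<^sub>R w m x) u =
      ip (\<lambda>x. \<Sum>i<m. c i *\<^sub>R w i x) u + ip (\<lambda>x. c m *\<^sub>R w m x) u"
    using Suc.prems assms(2) by (intro ip_add sum_in scale_in) auto
  with Suc show ?case using assms(2) by (simp add: ip_scale)
qed

lemma ip_sum_orthonormal:
  assumes "\<And>i. i < (m::nat) \<Longrightarrow> w i \<in> V"
    and "\<And>i j. i < m \<Longrightarrow> j < m \<Longrightarrow> ip (w i) (w j) = of_bool (i = j)"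
  shows "ip (\<lambda>x. \<Sum>i<m. c i *\<^sub>R w i x) (\<lambda>x. \<Sum>i<m. c i *\<^sub>R w i x) = (\<Sum>i<m. (c i)\<^sup>2)"
proof -
  let ?s = "\<lambda>x. \<Sum>i<m. c i *\<^sub>R w i x"
  have s: "?s \<in> V" using assms(1) by (rule sum_in)
  have "ip (w i) ?s = c i" if i: "i < m" for i
  proof -
    have "ip (w i) ?s = (\<Sum>j<m. c j * ip (w j) (w i))"
      using ip_sym[OF assms(1)[OF i] s] ip_sum[OF assms(1) assms(1)[OF i]] by simp
    also have "\<dots> = (\<Sum>j<m. if j = i then c j else 0)"
      by (rule sum.cong) (use assms(2) i in auto)
    finally show ?thesis using i by simp
  qed
  then show ?thesis using ip_sum[where w = w and c = c and m = m, OF assms(1) s] by (simp add: power2_eq_square)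
qed

text \<open>Polarisation in place of Cauchy-Schwarz: for null vectors the squares of
  \<open>u + v\<close> and \<open>u - v\<close> are \<open>2 * ip u v\<close> and
  \<open>- 2 * ip u v\<close>, and both must be nonnegative.\<close>

lemma null_add:
  assumes "u \<in> V" "v \<in> V" "ip u u = 0" "ip v v = 0"
  shows "ip (\<lambda>x. u x + v x) (\<lambda>x. u x + v x) = 0"
proof -
  note i = assms(1,2) add_in[OF assms(1,2)] diff_in[OF assms(1,2)]
  have "ip (\<lambda>x. u x + v x) (\<lambda>x. u x + v x) = 2 * ip u v"
    using i assms by (simp add: ip_add ip_sym[of _ "\<lambda>x. u x + v x"] ip_sym[of v u])
  moreover have "ip (\<lambda>x. u x - v x) (\<lambda>x. u x - v x) = - 2 * ip u v"
    using i assms by (simp add: ip_diff ip_sym[of _ "\<lambda>x. u x - v x"] ip_sym[of v u])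
  ultimately show ?thesis using ip_nonneg[OF i(3)] ip_nonneg[OF i(4)] by linarith
qed

lemma null_scale: "v \<in> V \<Longrightarrow> ip v v = 0 \<Longrightarrow> ip (\<lambda>x. c *\<^sub>R v x) (\<lambda>x. c *\<^sub>R v x) = 0"
  by (simp add: ip_scale scale_in ip_sym[of _ "\<lambda>x. c *\<^sub>R v x"])

end

text \<open>
  Induction on the number of functionals: the basis of the kernel of one functional is extended by
  at most one vector.
\<close>

lemma orthonormal_basis_exists:
  fixes ev :: "'l \<Rightarrow> ('a \<Rightarrow> 'b::real_vector) \<Rightarrow> real"
  assumes "finite \<Lambda>" "semi_inner_space V ip"
    and "\<And>l u v. l \<in> \<Lambda> \<Longrightarrow> ev l (\<lambda>x. u x + v x) = ev l u + ev l v"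
    and "\<And>l c v. l \<in> \<Lambda> \<Longrightarrow> ev l (\<lambda>x. c *\<^sub>R v x) = c * ev l v"
    and "\<And>v. v \<in> V \<Longrightarrow> (\<And>l. l \<in> \<Lambda> \<Longrightarrow> ev l v = 0) \<Longrightarrow> ip v v = 0"
  shows "\<exists>(m::nat) w. (\<forall>i<m. w i \<in> V) \<and> (\<forall>i<m. \<forall>j<m. ip (w i) (w j) = of_bool (i = j)) \<and>
    (\<forall>v\<in>V. \<exists>c. ip (\<lambda>x. v x - (\<Sum>i<m. c i *\<^sub>R w i x)) (\<lambda>x. v x - (\<Sum>i<m. c i *\<^sub>R w i x)) = 0)"
  using assms
proof (induction \<Lambda> arbitrary: V rule: finite_induct)
  case empty
  have "ip (\<lambda>x. v x - (\<Sum>i<0. c i *\<^sub>R w i x)) (\<lambda>x. v x - (\<Sum>i<0. c i *\<^sub>R w i x)) = 0" if "v \<in> V"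
    for v and c :: "nat \<Rightarrow> real" and w :: "nat \<Rightarrow> 'a \<Rightarrow> 'b"
    using empty.prems(4)[OF that] by simp
  then show ?case by (intro exI[of _ "0::nat"]) auto
next
  case (insert l \<Lambda>)
  interpret semi_inner_space V ip by fact
  have ev: "ev l (\<lambda>x. u x + v x) = ev l u + ev l v" "ev l (\<lambda>x. c *\<^sub>R v x) = c * ev l v" for u v c
    using insert.prems by auto
  define V' where "V' = {v \<in> V. ev l v = 0}"
  have V': "semi_inner_space V' ip"
  proof
    have "ev l (\<lambda>x. 0) = 0" using ev(2)[of 0 "\<lambda>x. 0"] by simp
    then show "(\<lambda>x. 0) \<in> V'" using zero_in by (simp add: V'_def)
  qed (auto simp: V'_def ev intro: add_in scale_in ip_add ip_scale ip_sym ip_nonneg)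
  have "\<exists>(m::nat) w. (\<forall>i<m. w i \<in> V') \<and> (\<forall>i<m. \<forall>j<m. ip (w i) (w j) = of_bool (i = j)) \<and>
    (\<forall>v\<in>V'. \<exists>c. ip (\<lambda>x. v x - (\<Sum>i<m. c i *\<^sub>R w i x)) (\<lambda>x. v x - (\<Sum>i<m. c i *\<^sub>R w i x)) = 0)"
    using V'
  proof (rule insert.IH)
    fix v assume v: "v \<in> V'" and 0: "\<And>k. k \<in> \<Lambda> \<Longrightarrow> ev k v = 0"
    show "ip v v = 0" by (rule insert.prems(4)) (use v 0 in \<open>auto simp: V'_def\<close>)
  qed (use insert.prems in auto)
  then obtain m :: nat and w where w: "\<And>i. i < m \<Longrightarrow> w i \<in> V'"
    and on: "\<And>i j. i < m \<Longrightarrow> j < m \<Longrightarrow> ip (w i) (w j) = of_bool (i = j)"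
    and span: "\<And>v. v \<in> V' \<Longrightarrow> \<exists>c. ip (\<lambda>x. v x - (\<Sum>i<m. c i *\<^sub>R w i x)) (\<lambda>x. v x - (\<Sum>i<m. c i *\<^sub>R w i x)) = 0"
    by blast
  have wV: "w i \<in> V" if "i < m" for i using w[OF that] by (simp add: V'_def)
  show ?case
  proof (cases "\<forall>v\<in>V. ev l v = 0")
    case True
    then have "V' = V" by (auto simp: V'_def)
    with wV on span show ?thesis by blast
  next
    case False
    then obtain v0 where v0: "v0 \<in> V" "ev l v0 \<noteq> 0" by blast
    \<comment> \<open>A Gram-Schmidt step: \<open>r\<close> is \<open>v0\<close> minus its
      projection onto the system found in the kernel of the functional.\<close>
    define c0 where "c0 i = ip v0 (w i)" for i
    define r where "r x = v0 x - (\<Sum>i<m. c0 i *\<^sub>R w i x)" for x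
    have s0: "(\<lambda>x. \<Sum>i<m. c0 i *\<^sub>R w i x) \<in> V" by (rule sum_in[OF wV])
    have r: "r \<in> V" unfolding r_def by (rule diff_in[OF v0(1) s0])
    have r_orth: "ip r (w j) = 0" if j: "j < m" for j
    proof -
      have "ip r (w j) = c0 j - (\<Sum>i<m. c0 i * ip (w i) (w j))"
        unfolding r_def using ip_diff[OF v0(1) s0 wV[OF j]] ip_sum[OF wV wV[OF j]] by (simp add: c0_def)
      also have "(\<Sum>i<m. c0 i * ip (w i) (w j)) = (\<Sum>i<m. if i = j then c0 i else 0)"
        by (rule sum.cong) (use on j in auto)
      finally show ?thesis using j by simp
    qed
    \<comment> \<open>Subtracting the right multiple of \<open>v0\<close> brings \<open>v\<close>
      into the kernel \<open>V'\<close>, where the old system spans up to a null vector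
      \<open>n\<close>. Replacing \<open>v0\<close> by \<open>r\<close> then only shifts the
      coefficients by \<open>t * c0 i\<close>.\<close>
    have decomp: "\<exists>t c n. n \<in> V \<and> ip n n = 0 \<and> (\<forall>x. v x - (\<Sum>i<m. c i *\<^sub>R w i x) = n x + t *\<^sub>R r x)"
      if v: "v \<in> V" for v
    proof -
      define t where "t = ev l v / ev l v0"
      define v' where "v' x = v x + (- t) *\<^sub>R v0 x" for x
      have "ev l v' = ev l v - t * ev l v0" unfolding v'_def ev by simp
      then have "ev l v' = 0" using v0(2) by (simp add: t_def)
      moreover have "v' \<in> V" unfolding v'_def by (rule add_in[OF v scale_in[OF v0(1)]])
      ultimately have v': "v' \<in> V'" by (simp add: V'_def)
      obtain c where c: "ip (\<lambda>x. v' x - (\<Sum>i<m. c i *\<^sub>R w i x)) (\<lambda>x. v' x - (\<Sum>i<m. c i *\<^sub>R w i x)) = 0"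
        using span[OF v'] by blast
      have "v x - (\<Sum>i<m. (c i + t * c0 i) *\<^sub>R w i x) = (v' x - (\<Sum>i<m. c i *\<^sub>R w i x)) + t *\<^sub>R r x" for x
        by (simp add: v'_def r_def algebra_simps sum.distrib scaleR_sum_right)
      moreover have "(\<lambda>x. v' x - (\<Sum>i<m. c i *\<^sub>R w i x)) \<in> V"
        using v' by (intro diff_in sum_in wV) (auto simp: V'_def)
      ultimately show ?thesis using c
        by (intro exI[of _ t] exI[of _ "\<lambda>i. c i + t * c0 i"] exI[of _ "\<lambda>x. v' x - (\<Sum>i<m. c i *\<^sub>R w i x)"]) blast
    qed
    show ?thesis
    \<comment> \<open>If \<open>r\<close> is null, the old system already spans modulo null vectors;
      otherwise the normalised \<open>r\<close> is appended to it.\<close>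
    proof (cases "ip r r = 0")
      case True
      have "\<exists>c. ip (\<lambda>x. v x - (\<Sum>i<m. c i *\<^sub>R w i x)) (\<lambda>x. v x - (\<Sum>i<m. c i *\<^sub>R w i x)) = 0"
        if v: "v \<in> V" for v
      proof -
        obtain t c n where n: "n \<in> V" "ip n n = 0"
          and eq: "\<And>x. v x - (\<Sum>i<m. c i *\<^sub>R w i x) = n x + t *\<^sub>R r x"
          using decomp[OF v] by blast
        have "ip (\<lambda>x. n x + t *\<^sub>R r x) (\<lambda>x. n x + t *\<^sub>R r x) = 0"
          by (rule null_add[OF n(1) scale_in[OF r] n(2) null_scale[OF r True]])
        then show ?thesis unfolding eq[symmetric] by blast
      qed
      with wV on show ?thesis by blast
    next
      case False
      define s where "s = sqrt (ip r r)"
      have s: "s > 0" "s * s = ip r r" using False ip_nonneg[OF r] by (auto simp: s_def)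
      define w' where "w' i = (if i < m then w i else (\<lambda>x. (1 / s) *\<^sub>R r x))" for i
      have w'V: "w' i \<in> V" if "i < Suc m" for i using wV r by (auto simp: w'_def intro: scale_in)
      have last: "w' m = (\<lambda>x. (1 / s) *\<^sub>R r x)" by (simp add: w'_def)
      have lm: "ip (w' m) (w j) = 0" if "j < m" for j
        unfolding last using ip_scale[OF r wV[OF that]] r_orth[OF that] by simp
      have mm: "ip (w' m) (w' m) = 1"
      proof -
        have "ip (w' m) (w' m) = (1 / s) * ip r (w' m)"
          using ip_scale[OF r w'V[of m], of "1 / s"] by (simp add: last)
        also have "ip r (w' m) = (1 / s) * ip r r"
          using ip_scale[OF r r, of "1 / s"] ip_sym[OF r w'V[of m]] by (simp add: last)
        finally show ?thesis using s False by (simp add: field_simps)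
      qed
      have on': "ip (w' i) (w' j) = of_bool (i = j)" if "i < Suc m" "j < Suc m" for i j
      proof -
        consider "i < m" "j < m" | "i = m" "j < m" | "i < m" "j = m" | "i = m" "j = m"
          using \<open>i < Suc m\<close> \<open>j < Suc m\<close> by linarith
        then show ?thesis
        proof cases
          case 1
          then show ?thesis using on by (simp add: w'_def)
        next
          case 2
          then show ?thesis using lm by (simp add: w'_def[of j])
        next
          case 3
          then show ?thesis using lm ip_sym[OF wV w'V[of m], of i] by (simp add: w'_def[of i])
        next
          case 4
          then show ?thesis using mm by simp
        qed
      qed
      have "\<exists>c. ip (\<lambda>x. v x - (\<Sum>i<Suc m. c i *\<^sub>R w' i x)) (\<lambda>x. v x - (\<Sum>i<Suc m. c i *\<^sub>R w' i x)) = 0"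
        if v: "v \<in> V" for v
      proof -
        obtain t c n where n: "n \<in> V" "ip n n = 0"
          and eq: "\<And>x. v x - (\<Sum>i<m. c i *\<^sub>R w i x) = n x + t *\<^sub>R r x"
          using decomp[OF v] by blast
        \<comment> \<open>The last coefficient is \<open>t * s\<close> because the new vector is
          \<open>r / s\<close>.\<close>
        define c' where "c' i = (if i < m then c i else t * s)" for i
        have "v x - (\<Sum>i<Suc m. c' i *\<^sub>R w' i x) = n x" for x
        proof -
          have "(\<Sum>i<m. c' i *\<^sub>R w' i x) = (\<Sum>i<m. c i *\<^sub>R w i x)"
            by (rule sum.cong) (auto simp: c'_def w'_def)
          moreover have "c' m *\<^sub>R w' m x = t *\<^sub>R r x" using s(1) by (simp add: c'_def last)
          ultimately show ?thesis using eq[of x] by (simp add: algebra_simps)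
        qed
        then show ?thesis using n(2) by (intro exI[of _ c']) simp
      qed
      with w'V on' show ?thesis by blast
    qed
  qed
qed

section \<open>Divided differences of the truncation\<close>

definition divided_difference :: "(real \<Rightarrow> real) \<Rightarrow> (real \<Rightarrow> real) \<Rightarrow> real \<Rightarrow> real \<Rightarrow> real" where
  "divided_difference f f' s t = (if s \<noteq> t then (f s - f t) / (s - t) else f' t)"

text \<open>Serves two purposes: a bound on \<open>f'\<close> passes to the divided difference, and
  the distance bound on the intermediate point yields continuity at the diagonal.\<close>

lemma divided_difference_mean_value:
  assumes "\<And>x. (f has_real_derivative f' x) (at x)"
  shows "\<exists>\<xi>. \<bar>\<xi> - t\<bar> \<le> \<bar>s - t\<bar> \<and> divided_difference f f' s t = f' \<xi>"
proof -
  consider "s < t" | "t < s" | "s = t" by linarith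
  then show ?thesis
  proof cases
    case 1
    then obtain z where "s < z" "z < t" "f t - f s = (t - s) * f' z"
      using MVT2[of s t f f'] assms by blast
    with 1 show ?thesis
      by (intro exI[of _ z]) (auto simp: divided_difference_def field_simps)
  next
    case 2
    then obtain z where "t < z" "z < s" "f s - f t = (s - t) * f' z"
      using MVT2[of t s f f'] assms by blast
    with 2 show ?thesis
      by (intro exI[of _ z]) (auto simp: divided_difference_def field_simps)
  qed (auto simp: divided_difference_def)
qed

lemma divided_difference_continuous:
  assumes der: "\<And>x. (f has_real_derivative f' x) (at x)" and f': "continuous_on UNIV f'"
  shows "continuous_on UNIV (\<lambda>p. divided_difference f f' (fst p) (snd p))"
proof (rule continuous_at_imp_continuous_on, rule ballI)
  fix p :: "real \<times> real"
  obtain s t where p: "p = (s, t)" by (cases p)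
  show "isCont (\<lambda>p. divided_difference f f' (fst p) (snd p)) p"
  proof (cases "s = t")
    case False
    have fc: "continuous_on UNIV f" by (intro continuous_at_imp_continuous_on ballI DERIV_isCont[OF der])
    have "continuous_on {p. fst p \<noteq> snd p} (\<lambda>p. (f (fst p) - f (snd p)) / (fst p - snd p))"
      by (intro continuous_intros continuous_on_compose2[OF fc]) auto
    then have "continuous_on {p. fst p \<noteq> snd p} (\<lambda>p. divided_difference f f' (fst p) (snd p))"
      by (rule continuous_on_eq) (simp add: divided_difference_def)
    moreover have "open {p :: real \<times> real. fst p \<noteq> snd p}"
      by (intro open_Collect_neq continuous_intros)
    ultimately show ?thesis using False p by (auto simp: continuous_on_eq_continuous_at)
  next
    case True
    show ?thesis unfolding continuous_at_eps_delta
    proof (intro allI impI)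
      fix e :: real assume e: "e > 0"
      have "isCont f' t" using f' by (simp add: continuous_on_eq_continuous_at)
      then obtain d where d: "d > 0" "\<And>x. \<bar>x - t\<bar> < d \<Longrightarrow> \<bar>f' x - f' t\<bar> < e"
        using e unfolding continuous_at_eps_delta dist_real_def by blast
      show "\<exists>d>0. \<forall>q. dist q p < d \<longrightarrow>
          dist (divided_difference f f' (fst q) (snd q)) (divided_difference f f' (fst p) (snd p)) < e"
      proof (intro exI conjI allI impI)
        \<comment> \<open>The arguments differ by less than \<open>2 d / 3\<close>, so the
          intermediate point is within \<open>2 d / 3\<close> of \<open>snd q\<close>, which is
          within \<open>d / 3\<close> of \<open>t\<close>.\<close>
        show "d / 3 > 0" using d by simp
        fix q :: "real \<times> real" assume q: "dist q p < d / 3"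
        have 1: "\<bar>fst q - t\<bar> < d / 3" "\<bar>snd q - t\<bar> < d / 3"
          using q dist_fst_le[of q p] dist_snd_le[of q p] p True by (auto simp: dist_real_def)
        obtain \<xi> where \<xi>: "\<bar>\<xi> - snd q\<bar> \<le> \<bar>fst q - snd q\<bar>"
          "divided_difference f f' (fst q) (snd q) = f' \<xi>"
          using divided_difference_mean_value[OF der] by blast
        have "\<bar>\<xi> - t\<bar> < d" using 1 \<xi>(1) by linarith
        then show "dist (divided_difference f f' (fst q) (snd q)) (divided_difference f f' (fst p) (snd p)) < e"
          using d(2) \<xi>(2) p True by (simp add: dist_real_def divided_difference_def)
      qed
    qed
  qed
qed

lemma norm_le_sum_entries: "norm (A :: real^'n^'m) \<le> (\<Sum>i\<in>UNIV. \<Sum>j\<in>UNIV. \<bar>A $ i $ j\<bar>)"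
proof -
  have "norm A \<le> (\<Sum>i\<in>UNIV. norm (A $ i))" unfolding norm_vec_def by (rule L2_set_le_sum) simp
  also have "\<dots> \<le> (\<Sum>i\<in>UNIV. \<Sum>j\<in>UNIV. \<bar>A $ i $ j\<bar>)" by (intro sum_mono norm_le_l1_cart)
  finally show ?thesis .
qed

lemma axis_axis_Basis: "(axis i (axis j 1) :: real^'n^'m) \<in> Basis"
  by (simp add: axis_in_Basis_iff)

text \<open>Since \<open>TR\<close> acts entrywise, its entry \<open>(i, j)\<close> is a scalar
  function of that entry of the argument. It can be recovered along the line spanned by the matrix
  unit \<open>E\<close>, which reduces both branches of \<open>Ptilde\<close> to one real
  variable.\<close>

lemma Ptilde_eq_divided_difference:
  fixes TR :: "real^'n^'n \<Rightarrow> real^'n^'n" and i j :: 'n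
  assumes tr: "truncation R C TR"
  shows "\<exists>f f'. (\<forall>x. (f has_real_derivative f' x) (at x)) \<and> continuous_on UNIV f' \<and> (\<forall>x. \<bar>f' x\<bar> \<le> C) \<and>
     (\<forall>A B. Ptilde TR A B $ i $ j = divided_difference f f' (A $ i $ j) (B $ i $ j))"
proof -
  define E :: "real^'n^'n" where "E = axis i (axis j 1)"
  have E: "E \<in> Basis" "E $ i $ j = 1" by (simp_all add: E_def axis_axis_Basis)
  define g where "g A = TR A $ i $ j" for A
  define f where "f s = g (s *\<^sub>R E)" for s
  define f' where "f' s = pd E TR (s *\<^sub>R E) $ i $ j" for s
  have gf: "g A = f (A $ i $ j)" for A
  proof -
    have "A $ i $ j = ((A $ i $ j) *\<^sub>R E) $ i $ j" using E by simp
    then show ?thesis using tr unfolding truncation_def g_def f_def by blast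
  qed
  have Ck: "Ck 2 TR" using tr by (simp add: truncation_def)
  then have diff: "TR differentiable (at A)" for A
    by (simp add: numeral_2_eq_2 differentiable_on_def)
  have Ck1: "Ck 1 (pd E TR)" using Ck E(1) by (simp add: numeral_2_eq_2)
  have f_der: "(f has_real_derivative f' s) (at s)" for s
  proof -
    obtain D where D: "(TR has_derivative D) (at (s *\<^sub>R E))" using diff by (auto simp: differentiable_def)
    have D': "D = frechet_derivative TR (at (s *\<^sub>R E))" using frechet_derivative_at[OF D] by simp
    interpret D: bounded_linear D using D by (rule has_derivative_bounded_linear)
    have "((\<lambda>s. s *\<^sub>R E) has_derivative (\<lambda>h. h *\<^sub>R E)) (at s)"
      by (auto intro!: derivative_eq_intros)
    from has_derivative_compose[OF this D]
    have "((\<lambda>s. TR (s *\<^sub>R E)) has_derivative (\<lambda>h. D (h *\<^sub>R E))) (at s)" .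
    then have "((\<lambda>s. TR (s *\<^sub>R E) $ i $ j) has_derivative (\<lambda>h. D (h *\<^sub>R E) $ i $ j)) (at s)"
      by (intro bounded_linear.has_derivative[OF bounded_linear_vec_nth])
    moreover have "(\<lambda>h. D (h *\<^sub>R E) $ i $ j) = (*) (f' s)"
      by (simp add: fun_eq_iff D.scaleR f'_def pd_def D'[symmetric])
    ultimately show ?thesis
      unfolding has_field_derivative_def f_def g_def by simp
  qed
  have f'_cont: "continuous_on UNIV f'"
  proof -
    have "continuous_on UNIV (pd E TR)"
      using Ck1 by (auto intro: differentiable_imp_continuous_on)
    then have "continuous_on UNIV (\<lambda>s. pd E TR (s *\<^sub>R E))"
      by (rule continuous_on_compose2) (auto intro!: continuous_intros)
    then show ?thesis unfolding f'_def by (intro continuous_intros)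
  qed
  have pd_g: "pd E (\<lambda>Q. TR Q $ i $ j) B = f' (B $ i $ j)" for B
  proof -
    have 1: "((\<lambda>Q. Q $ i $ j) has_derivative (\<lambda>H. H $ i $ j)) (at B)"
      by (intro bounded_linear_imp_has_derivative bounded_linear_compose[OF bounded_linear_vec_nth bounded_linear_vec_nth])
    have "((\<lambda>Q. f (Q $ i $ j)) has_derivative (\<lambda>H. f' (B $ i $ j) * (H $ i $ j))) (at B)"
      using has_derivative_compose[OF 1 f_der[unfolded has_field_derivative_def]] .
    then have "((\<lambda>Q. TR Q $ i $ j) has_derivative (\<lambda>H. f' (B $ i $ j) * (H $ i $ j))) (at B)"
      unfolding gf[symmetric] g_def .
    from frechet_derivative_at[OF this] have "pd E (\<lambda>Q. TR Q $ i $ j) B = f' (B $ i $ j) * (E $ i $ j)"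
      unfolding pd_def by (metis (no_types))
    then show ?thesis using E by simp
  qed
  have "\<bar>f' s\<bar> \<le> C" for s
  proof -
    have "\<bar>pd E (\<lambda>Q. TR Q $ i $ j) (s *\<^sub>R E)\<bar> \<le> C" using tr E(1) unfolding truncation_def by blast
    then show ?thesis unfolding pd_g using E by simp
  qed
  moreover have "Ptilde TR A B $ i $ j = divided_difference f f' (A $ i $ j) (B $ i $ j)" for A B
    using gf pd_g[of B] by (simp add: Ptilde_def divided_difference_def E_def g_def)
  ultimately show ?thesis using f_der f'_cont by blast
qed

lemma Ptilde_continuous:
  assumes "truncation R C TR"
  shows "continuous_on UNIV (\<lambda>p. Ptilde TR (fst p) (snd p))"
proof -
  have entries: "continuous_on UNIV (\<lambda>p. Ptilde TR (fst p) (snd p) $ i $ j)" for i j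
  proof -
    obtain f f' where f: "\<And>x. (f has_real_derivative f' x) (at x)" "continuous_on UNIV f'"
      and eq: "\<And>A B. Ptilde TR A B $ i $ j = divided_difference f f' (A $ i $ j) (B $ i $ j)"
      using Ptilde_eq_divided_difference[OF assms] by metis
    have "continuous_on UNIV (\<lambda>p. divided_difference f f' (fst (fst p $ i $ j, snd p $ i $ j)) (snd (fst p $ i $ j, snd p $ i $ j)))"
      by (rule continuous_on_compose2[OF divided_difference_continuous[OF f]]) (auto intro!: continuous_intros)
    then show ?thesis by (simp add: eq)
  qed
  have "continuous_on UNIV (\<lambda>p. \<chi> i j. Ptilde TR (fst p) (snd p) $ i $ j)"
    by (intro continuous_on_vec_lambda entries)
  then show ?thesis by simp
qed

lemma Ptilde_bound:
  assumes "truncation R C TR"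
  shows "\<bar>Ptilde TR A B $ i $ j\<bar> \<le> C"
proof -
  obtain f f' where f: "\<And>x. (f has_real_derivative f' x) (at x)" "\<And>x. \<bar>f' x\<bar> \<le> C"
    and eq: "\<And>A B. Ptilde TR A B $ i $ j = divided_difference f f' (A $ i $ j) (B $ i $ j)"
    using Ptilde_eq_divided_difference[OF assms] by metis
  then show ?thesis using divided_difference_mean_value[OF f(1)] by metis
qed

lemma truncation_continuous: "truncation R C TR \<Longrightarrow> continuous_on UNIV TR"
  by (auto simp: truncation_def numeral_2_eq_2 intro: differentiable_imp_continuous_on)

lemma norm_matrix_vector_le: "norm ((A :: real^'n^'m) *v x) \<le> norm A * norm x"
proof -
  have "norm (A *v x) \<le> L2_set (\<lambda>i. norm (A $ i) * norm x) UNIV"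
    unfolding norm_vec_def[of "A *v x"]
    by (rule L2_set_mono) (auto simp: matrix_vector_mul_component Cauchy_Schwarz_ineq2)
  also have "\<dots> = norm A * norm x"
    by (simp add: L2_set_left_distrib[symmetric] norm_vec_def[of A])
  finally show ?thesis .
qed

text \<open>\<open>d\<^sup>2\<close> entries of absolute value at most \<open>R / d\<close> have
  Frobenius norm at most \<open>R\<close>. This is where the scaling of the truncation by the
  dimension pays off.\<close>

lemma truncation_norm_le:
  fixes TR :: "real^'n^'n \<Rightarrow> real^'n^'n"
  assumes "truncation R C TR"
  shows "norm (TR A) \<le> R"
proof -
  let ?d = "real CARD('n)"
  have e: "\<bar>TR A $ i $ j\<bar> \<le> R / ?d" for i j
    using assms unfolding truncation_def by (metis abs_le_iff atLeastAtMost_iff minus_le_iff)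
  then have "R / ?d \<ge> 0" using abs_ge_zero order_trans by blast
  then have R: "R \<ge> 0" by (simp add: zero_le_divide_iff)
  have row: "norm (TR A $ i) \<le> sqrt ?d * (R / ?d)" for i
  proof -
    have "norm (TR A $ i) \<le> L2_set (\<lambda>j::'n. R / ?d) UNIV"
      unfolding norm_vec_def[of "TR A $ i"] by (rule L2_set_mono) (auto simp: e)
    also have "\<dots> = sqrt ?d * (R / ?d)" using R by (simp add: L2_set_constant)
    finally show ?thesis .
  qed
  have "norm (TR A) \<le> L2_set (\<lambda>i::'n. sqrt ?d * (R / ?d)) UNIV"
    unfolding norm_vec_def[of "TR A"] by (rule L2_set_mono[OF row]) simp
  also have "\<dots> = sqrt ?d * (sqrt ?d * (R / ?d))" using R by (simp add: L2_set_constant)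
  also have "\<dots> = R" by (simp add: mult.assoc[symmetric])
  finally show ?thesis .
qed

section \<open>The pointwise operator of the scheme\<close>

text \<open>The orthogonal projection onto symmetric trace-free matrices, written exactly as the
  coupling term of \<open>eq_S1\<close> so that it can be folded there.\<close>

definition dev_sym :: "real^'n^'n \<Rightarrow> real^'n^'n" where
  "dev_sym A = sym_part A - (1 / real CARD('n)) *\<^sub>R trace A *\<^sub>R mat 1"

lemma continuous_on_trace [continuous_intros]:
  "continuous_on S f \<Longrightarrow> continuous_on S (\<lambda>x. trace (f x :: real^'n^'n))"
  unfolding trace_def by (intro continuous_intros)

lemma continuous_on_transpose [continuous_intros]:
  "continuous_on S f \<Longrightarrow> continuous_on S (\<lambda>x. transpose (f x :: real^'n^'m))"
  unfolding transpose_def by (intro continuous_intros)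

lemma continuous_on_matrix_mult [continuous_intros]:
  "continuous_on S f \<Longrightarrow> continuous_on S g \<Longrightarrow> continuous_on S (\<lambda>x. (f x :: real^'n^'m) ** (g x :: real^'k^'n))"
  unfolding matrix_matrix_mult_def by (intro continuous_intros)

lemma continuous_on_matrix_vector_mult [continuous_intros]:
  "continuous_on S f \<Longrightarrow> continuous_on S g \<Longrightarrow> continuous_on S (\<lambda>x. (f x :: real^'n^'m) *v (g x))"
  unfolding matrix_vector_mult_def by (intro continuous_intros)

lemma continuous_on_hadamard [continuous_intros]:
  "continuous_on S f \<Longrightarrow> continuous_on S g \<Longrightarrow> continuous_on S (\<lambda>x. f x \<odot> g x)"
  unfolding hadamard_def by (intro continuous_intros)

lemma continuous_on_outer [continuous_intros]:
  "continuous_on S f \<Longrightarrow> continuous_on S g \<Longrightarrow> continuous_on S (\<lambda>x. outer (f x) (g x))"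
  unfolding outer_def by (intro continuous_intros)

lemma continuous_on_dev [continuous_intros]: "continuous_on S f \<Longrightarrow> continuous_on S (\<lambda>x. dev (f x))"
  unfolding dev_def divide_inverse by (intro continuous_intros)

lemma continuous_on_dev_sym [continuous_intros]: "continuous_on S f \<Longrightarrow> continuous_on S (\<lambda>x. dev_sym (f x))"
  unfolding dev_sym_def sym_part_def by (intro continuous_intros)

lemma continuous_on_dF1 [continuous_intros]: "continuous_on S f \<Longrightarrow> continuous_on S (\<lambda>x. dF1 b \<beta>1 \<beta>2 (f x))"
  unfolding dF1_def by (intro continuous_intros)

lemma continuous_on_dF2 [continuous_intros]: "continuous_on S f \<Longrightarrow> continuous_on S (\<lambda>x. dF2 a c \<beta>1 \<beta>2 (f x))"
  unfolding dF2_def by (intro continuous_intros)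

text \<open>Scaling reduces the claim to the unit ball, where compactness gives the constant. It is
  applied with \<open>n = 2\<close> to the quadratic bulk term and with \<open>n = 1\<close> to
  linear maps, which avoids computing any of these constants.\<close>

lemma homogeneous_bound:
  fixes h :: "'a::euclidean_space \<Rightarrow> 'b::euclidean_space"
  assumes cont: "continuous_on UNIV h" and hom: "\<And>t x. h (t *\<^sub>R x) = t ^ n *\<^sub>R h x" and n: "n > 0"
  shows "\<exists>K\<ge>0. \<forall>x. norm (h x) \<le> K * norm x ^ n"
proof -
  have "compact (h ` cball 0 1)"
    using cont by (intro compact_continuous_image) (auto intro: continuous_on_subset)
  then have "bounded (h ` cball 0 1)" by (rule compact_imp_bounded)
  then obtain K where K: "\<forall>z\<in>h ` cball 0 1. norm z \<le> K" unfolding bounded_iff by blast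
  then have K1: "norm (h x) \<le> K" if "norm x \<le> 1" for x using that by simp
  have K0: "K \<ge> 0" using K1[of 0] norm_ge_zero[of "h 0"] by (simp del: norm_ge_zero)
  have "norm (h x) \<le> K * norm x ^ n" for x
  proof (cases "x = 0")
    case True
    then show ?thesis using hom[of 0 x] n by (simp add: zero_power)
  next
    case False
    have "h x = norm x ^ n *\<^sub>R h (inverse (norm x) *\<^sub>R x)"
      using False hom[of "norm x" "inverse (norm x) *\<^sub>R x"] by simp
    then have "norm (h x) = norm x ^ n * norm (h (inverse (norm x) *\<^sub>R x))" by simp
    also have "\<dots> \<le> norm x ^ n * K" using False by (intro mult_left_mono K1) auto
    finally show ?thesis by (simp add: mult.commute)
  qed
  with K0 show ?thesis by blast
qed

lemma trace_scaleR: "trace (t *\<^sub>R A) = t * trace (A :: real^'n^'n)"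
  by (simp add: trace_def sum_distrib_left)

lemma dev_scaleR: "dev (t *\<^sub>R A) = t *\<^sub>R dev A"
  by (simp add: dev_def trace_scaleR scaleR_diff_right)

lemma dev_sym_scaleR: "dev_sym (t *\<^sub>R A) = t *\<^sub>R dev_sym A"
  by (simp add: dev_sym_def sym_part_def trace_scaleR transpose_scalar algebra_simps)

text \<open>The adjoint of the terms \<open>w \<cdot> div (\<Phi>\<^sub>S) - (1/d) w \<cdot> \<nabla> tr \<Phi>\<close> in the scheme.\<close>

lemma inner_mat_1: "(mat 1 :: real^'n^'n) \<bullet> A = trace A"
  by (simp add: inner_vec_def mat_def trace_def if_distrib[of "\<lambda>t. t * _"] cong: if_cong)

lemma inner_transpose: "transpose A \<bullet> B = A \<bullet> transpose (B :: real^'n^'m)"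
proof -
  have "transpose A \<bullet> B = (\<Sum>i\<in>UNIV. \<Sum>j\<in>UNIV. A $ j $ i * B $ i $ j)"
    by (simp add: inner_vec_def transpose_def)
  also have "\<dots> = A \<bullet> transpose B"
    by (subst sum.swap) (simp add: inner_vec_def transpose_def)
  finally show ?thesis .
qed

lemma inner_dev_sym: "dev_sym A \<bullet> B = A \<bullet> sym_part B - trace A * trace B / real CARD('n)"
  for A B :: "real^'n^'n"
  by (simp add: dev_sym_def sym_part_def inner_simps inner_transpose inner_mat_1)

lemma inner_outer_axis: "outer w (axis k 1) \<bullet> A = (\<Sum>i\<in>UNIV. w $ i * A $ i $ k)"
  for A :: "real^'n^'m"
  by (simp add: outer_def inner_vec_def axis_def if_distrib[of "\<lambda>t. _ * t * _"] if_distrib[of "\<lambda>t. t * _"] cong: if_cong)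

lemma trace_outer_axis: "trace (outer w (axis k 1)) = w $ k"
  by (simp add: outer_def trace_def axis_def if_distrib[of "\<lambda>t. _ * t"] cong: if_cong)

text \<open>\<open>dev_sym\<close> is self-adjoint, so symmetrisation and trace correction can be
  moved from the derivatives \<open>D $ k\<close> of the test function to the matrix
  \<open>outer w (axis k 1)\<close>. The divergence then appears by summing over
  \<open>k\<close>.\<close>

lemma adjoint_div_sym:
  fixes w :: "real^'n" and D :: "real^'n^'n^'n"
  shows "(\<Sum>k\<in>UNIV. dev_sym (outer w (axis k 1)) \<bullet> D $ k) =
    w \<bullet> (\<chi> i. \<Sum>j\<in>UNIV. sym_part (D $ j) $ i $ j) - (1 / real CARD('n)) * (w \<bullet> (\<chi> k. trace (D $ k)))"
proof -
  have "(\<Sum>k\<in>UNIV. \<Sum>i\<in>UNIV. w $ i * sym_part (D $ k) $ i $ k) =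
      w \<bullet> (\<chi> i. \<Sum>j\<in>UNIV. sym_part (D $ j) $ i $ j)"
    by (subst sum.swap) (simp add: inner_vec_def sum_distrib_left)
  moreover have "(\<Sum>k\<in>UNIV. w $ k * trace (D $ k) / real CARD('n)) =
      (1 / real CARD('n)) * (w \<bullet> (\<chi> k. trace (D $ k)))"
    by (simp add: inner_vec_def sum_divide_distrib)
  ultimately show ?thesis
    by (simp add: inner_dev_sym inner_outer_axis trace_outer_axis sum_subtractf)
qed

text \<open>
  A state collects the values of \<open>Q\<close>, of its gradient (index \<open>k\<close> for \<open>\<partial>\<^sub>k\<close>) and of \<open>\<nabla>u\<close>. Paired with a
  test state, \<open>pointwise_op\<close> is the integrand of (S1), with all terms on one side, plus that of (S2).
\<close>

type_synonym 'n state = "(real^'n^'n) \<times> (real^'n^'n^'n) \<times> (real^'n)"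

definition div_of :: "real^'n^'n^'n \<Rightarrow> real^'n" where
  "div_of D = (\<chi> i. \<Sum>j\<in>UNIV. D $ j $ i $ j)"

text \<open>Everything in (S1) that is paired with the gradient of the test function. The halves
  come from the midpoint rule, because \<open>flux\<close> is applied to the sum of old and new
  values.\<close>

definition flux :: "real \<Rightarrow> real \<Rightarrow> (real^'n^'n^'n) \<times> (real^'n) \<Rightarrow> real^'n^'n^'n" where
  "flux L \<epsilon>3 p = (\<chi> k. (L / 2) *\<^sub>R (fst p $ k) - (\<epsilon>3 / 2) *\<^sub>R dev_sym (outer (snd p) (axis k 1)))"

locale scheme_data =
  fixes TR :: "real^'n^'n \<Rightarrow> real^'n^'n" and L \<epsilon>1 \<epsilon>2 \<epsilon>3 a b c \<beta>1 \<beta>2 \<Delta>t R C :: real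
  assumes trunc: "truncation R C TR" and \<beta>2_pos: "\<beta>2 > 0" and elliptic: "\<epsilon>1 > \<bar>\<epsilon>2\<bar> * R"
begin

definition pointwise_op :: "'n state \<Rightarrow> 'n state \<Rightarrow> 'n state" where
  "pointwise_op y0 y = (case y0 of (q0, d0, g0) \<Rightarrow> case y of (q, d, g) \<Rightarrow>
     ((1 / \<Delta>t) *\<^sub>R (q - q0) + (dF1 b \<beta>1 \<beta>2 q - dF2 a c \<beta>1 \<beta>2 q0)
        - (\<epsilon>2 / 2) *\<^sub>R dev_sym (Ptilde TR q q0 \<odot> outer g0 g),
      flux L \<epsilon>3 (d0 + d, g0 + g),
      \<epsilon>1 *\<^sub>R g + \<epsilon>2 *\<^sub>R (TR q *v g) + \<epsilon>3 *\<^sub>R div_of d))"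

lemma flux_continuous: "continuous_on UNIV (flux L \<epsilon>3 :: _ \<Rightarrow> real^'n^'n^'n)"
  unfolding flux_def[abs_def] by (intro continuous_intros)

lemma div_of_continuous: "continuous_on UNIV (div_of :: _ \<Rightarrow> real^'n)"
  unfolding div_of_def[abs_def] by (intro continuous_intros)

lemma pointwise_op_continuous: "continuous_on UNIV (\<lambda>p. pointwise_op (fst p) (snd p))"
proof -
  have P: "continuous_on UNIV (\<lambda>p :: 'n state \<times> 'n state. Ptilde TR (fst (snd p)) (fst (fst p)))"
  proof -
    have "continuous_on UNIV (\<lambda>p :: 'n state \<times> 'n state. (fst (snd p), fst (fst p)))"
      by (intro continuous_intros)
    from continuous_on_compose2[OF Ptilde_continuous[OF trunc] this] show ?thesis by simp
  qed
  have T: "continuous_on UNIV (\<lambda>p :: 'n state \<times> 'n state. TR (fst (snd p)))"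
    by (rule continuous_on_compose2[OF truncation_continuous[OF trunc]]) (auto intro!: continuous_intros)
  have F: "continuous_on UNIV (\<lambda>p :: 'n state \<times> 'n state.
      flux L \<epsilon>3 (fst (snd (fst p)) + fst (snd (snd p)), snd (snd (fst p)) + snd (snd (snd p))))"
    by (rule continuous_on_compose2[OF flux_continuous]) (auto intro!: continuous_intros)
  have D: "continuous_on UNIV (\<lambda>p :: 'n state \<times> 'n state. div_of (fst (snd (snd p))))"
    by (rule continuous_on_compose2[OF div_of_continuous]) (auto intro!: continuous_intros)
  show ?thesis
    unfolding pointwise_op_def case_prod_beta by (intro continuous_intros P T F D)
qed

text \<open>
  The quartic part of \<open>dF1\<close> and the elliptic part of (S2) dominate: the fields below are bounded
  pointwise by the coefficient norms \<open>s\<close> and \<open>G\<close>, so that every other term is at most a multiple of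
  \<open>(1 + s)\<^sup>3 + (1 + s) (1 + G)\<close>.
\<close>

lemma pointwise_op_coercive:
  assumes B: "B \<ge> 1"
  shows "\<exists>K\<ge>0. \<forall>q0 d0 g0 q d g P D p s G.
    norm q0 \<le> B \<longrightarrow> norm d0 \<le> B \<longrightarrow> norm g0 \<le> B \<longrightarrow> norm q \<le> B \<longrightarrow> norm d \<le> B \<longrightarrow> norm g \<le> B \<longrightarrow>
    0 \<le> s \<longrightarrow> 0 \<le> G \<longrightarrow> norm P \<le> B * s \<longrightarrow> norm D \<le> B * s \<longrightarrow> norm p \<le> B * G \<longrightarrow>
    pointwise_op (q0, d0, g0) (q + P, d + D, g + p) \<bullet> (P, D, p) \<ge>
      \<beta>2 * norm P ^ 4 + (\<epsilon>1 - \<bar>\<epsilon>2\<bar> * R) * (norm p)\<^sup>2 - K * ((1 + s) ^ 3 + (1 + s) * (1 + G))"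
proof -
  define M where "M Q = dev (Q ** transpose Q + transpose Q ** Q + Q ** Q)" for Q :: "real^'n^'n"
  have "\<exists>K\<ge>0. \<forall>Q. norm (M Q) \<le> K * norm Q ^ 2"
  proof (rule homogeneous_bound)
    show "continuous_on UNIV M" unfolding M_def[abs_def] by (intro continuous_intros)
    show "M (t *\<^sub>R Q) = t\<^sup>2 *\<^sub>R M Q" for t Q
      unfolding M_def dev_scaleR[symmetric]
      by (simp add: transpose_scalar scalar_matrix_assoc[symmetric] matrix_scalar_ac power2_eq_square
          scaleR_add_right)
  qed simp
  then obtain KM where KM: "KM \<ge> 0" "\<And>Q. norm (M Q) \<le> KM * norm Q ^ 2" by blast
  have "\<exists>K\<ge>0. \<forall>A :: real^'n^'n. norm (dev_sym A) \<le> K * norm A ^ 1"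
  proof (rule homogeneous_bound)
    show "continuous_on UNIV (dev_sym :: real^'n^'n \<Rightarrow> _)"
      using continuous_on_dev_sym[OF continuous_on_id] by simp
    show "dev_sym (t *\<^sub>R A) = t ^ 1 *\<^sub>R dev_sym A" for t and A :: "real^'n^'n"
      by (simp add: dev_sym_scaleR)
  qed simp
  then obtain KS where KS: "KS \<ge> 0" "\<And>A :: real^'n^'n. norm (dev_sym A) \<le> KS * norm A" by auto
  have "\<exists>K\<ge>0. \<forall>x :: (real^'n^'n^'n) \<times> (real^'n). norm (flux L \<epsilon>3 x) \<le> K * norm x ^ 1"
  proof (rule homogeneous_bound[OF flux_continuous])
    show "flux L \<epsilon>3 (t *\<^sub>R x) = t ^ 1 *\<^sub>R flux L \<epsilon>3 x" for t and x :: "(real^'n^'n^'n) \<times> (real^'n)"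
    proof -
      have o: "outer (t *\<^sub>R snd x) (axis k 1) = t *\<^sub>R outer (snd x) (axis k 1)" for k :: 'n
        by (simp add: vec_eq_iff outer_def)
      show ?thesis
        by (simp add: vec_eq_iff flux_def o dev_sym_scaleR algebra_simps)
    qed
  qed simp
  then obtain KF where KF: "KF \<ge> 0" "\<And>x :: (real^'n^'n^'n) \<times> (real^'n). norm (flux L \<epsilon>3 x) \<le> KF * norm x" by auto
  have "\<exists>K\<ge>0. \<forall>x :: real^'n^'n^'n. norm (div_of x) \<le> K * norm x ^ 1"
  proof (rule homogeneous_bound[OF div_of_continuous])
    show "div_of (t *\<^sub>R x) = t ^ 1 *\<^sub>R div_of x" for t and x :: "real^'n^'n^'n"
      by (simp add: vec_eq_iff div_of_def sum_distrib_left)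
  qed simp
  then obtain KD where KD: "KD \<ge> 0" "\<And>x :: real^'n^'n^'n. norm (div_of x) \<le> KD * norm x" by auto
  have C0: "C \<ge> 0" using Ptilde_bound[OF trunc] abs_ge_zero order_trans by blast
  have R0: "R \<ge> 0" using truncation_norm_le[OF trunc] norm_ge_zero order_trans by blast
  define n2 where "n2 = real CARD('n) * real CARD('n)"
  have had: "norm (Ptilde TR A A' \<odot> outer x y) \<le> n2 * (C * (norm x * norm y))" for A A' and x y :: "real^'n"
  proof -
    have "norm (Ptilde TR A A' \<odot> outer x y) \<le> (\<Sum>i\<in>UNIV. \<Sum>j\<in>UNIV. \<bar>(Ptilde TR A A' \<odot> outer x y) $ i $ j\<bar>)"
      by (rule norm_le_sum_entries)
    also have "\<dots> \<le> (\<Sum>i\<in>(UNIV::'n set). \<Sum>j\<in>(UNIV::'n set). C * (norm x * norm y))"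
      by (intro sum_mono) (auto simp: hadamard_def outer_def abs_mult
          intro!: mult_mono Ptilde_bound[OF trunc] C0 component_le_norm_cart)
    finally show ?thesis by (simp add: n2_def mult_ac)
  qed
  \<comment> \<open>One constant for each part of the pairing: time difference, linear and quadratic
    bulk terms, old bulk term, lower order part of the quartic term, coupling through
    \<open>Ptilde\<close>, gradient terms, and (S2).\<close>
  define Kdt where "Kdt = \<bar>1 / \<Delta>t\<bar> * (2 * B) * B"
  define Kb where "Kb = (\<bar>\<beta>1\<bar> * B + \<bar>b / 3\<bar> * (KM * B\<^sup>2)) * B"
  define K2 where "K2 = (\<bar>\<beta>1 - a\<bar> * B + \<bar>\<beta>2 - c\<bar> * B\<^sup>2 * B) * B"
  define Kq where "Kq = \<beta>2 * (4 * B ^ 4)"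
  define KP where "KP = \<bar>\<epsilon>2 / 2\<bar> * (KS * (n2 * (C * (B * B)))) * B"
  define Kf where "Kf = KF * (2 * B) * B"
  define Ku where "Ku = (\<bar>\<epsilon>1\<bar> + \<bar>\<epsilon>2\<bar> * R) * B * B + \<bar>\<epsilon>3\<bar> * (KD * B) * B"
  define K where "K = Kdt + Kb + K2 + Kq + KP + Kf + Ku"
  have K0: "K \<ge> 0"
    unfolding K_def Kdt_def Kb_def K2_def Kq_def KP_def Kf_def Ku_def n2_def
    using B KM(1) KS(1) KF(1) KD(1) C0 R0 \<beta>2_pos by (intro add_nonneg_nonneg mult_nonneg_nonneg) auto
  show ?thesis
  proof (intro exI[of _ K] conjI allI impI)
    fix q0 q P :: "real^'n^'n" and d0 d D :: "real^'n^'n^'n" and g0 g p :: "real^'n" and s G :: real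
    assume h: "norm q0 \<le> B" "norm d0 \<le> B" "norm g0 \<le> B" "norm q \<le> B" "norm d \<le> B" "norm g \<le> B"
      "0 \<le> s" "0 \<le> G" "norm P \<le> B * s" "norm D \<le> B * s" "norm p \<le> B * G"
    show "pointwise_op (q0, d0, g0) (q + P, d + D, g + p) \<bullet> (P, D, p) \<ge>
      \<beta>2 * norm P ^ 4 + (\<epsilon>1 - \<bar>\<epsilon>2\<bar> * R) * (norm p)\<^sup>2 - K * ((1 + s) ^ 3 + (1 + s) * (1 + G))"
    proof -
      define Q where "Q = q + P"
      define D' where "D' = d + D"
      define g' where "g' = g + p"
      \<comment> \<open>With quantities that are at least 1, lower powers are absorbed by higher
        ones, and a single expression \<open>W\<close> dominates all error terms.\<close>
      define S1 where "S1 = 1 + s"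
      define G1 where "G1 = 1 + G"
      define W where "W = S1 ^ 3 + S1 * G1"
      have S1: "S1 \<ge> 1" and G1: "G1 \<ge> 1" using h by (simp_all add: S1_def G1_def)
      have B0: "B \<ge> 0" using B by simp
      have pw: "S1 \<le> S1\<^sup>2" "S1\<^sup>2 \<le> S1 ^ 3"
        using power_increasing[OF _ S1, of 1 2] power_increasing[OF _ S1, of 2 3] by simp_all
      have S1G1: "G1 \<le> S1 * G1" "0 \<le> S1 * G1" using S1 G1 mult_right_mono[of 1 S1 G1] by auto
      have W: "S1 \<le> W" "S1\<^sup>2 \<le> W" "S1 ^ 3 \<le> W" "S1 * G1 \<le> W" "G1 \<le> W" "S1\<^sup>2 + S1 * G1 \<le> W"
        using pw S1G1 S1 by (auto simp: W_def)
      have P: "norm P \<le> B * S1" and Dn: "norm D \<le> B * S1" and pn: "norm p \<le> B * G1"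
        using h(7-11) B0 unfolding S1_def G1_def by (auto simp: algebra_simps)
      have BS: "B \<le> B * S1" "B \<le> B * G1" using S1 G1 B0 mult_left_mono[of 1 _ B] by auto
      have Q: "norm Q \<le> B * S1"
        using norm_triangle_ineq[of q P] h(4,9) unfolding Q_def S1_def by (simp add: algebra_simps)
      have D': "norm D' \<le> B * S1"
        using norm_triangle_ineq[of d D] h(5,10) unfolding D'_def S1_def by (simp add: algebra_simps)
      have g': "norm g' \<le> B * G1"
        using norm_triangle_ineq[of g p] h(6,11) unfolding g'_def G1_def by (simp add: algebra_simps)
      have ip: "\<bar>x \<bullet> y\<bar> \<le> X * Y" if "norm x \<le> X" "norm y \<le> Y" for X Y and x y :: "'z::real_inner"
        using Cauchy_Schwarz_ineq2[of x y] mult_mono[OF that order_trans[OF norm_ge_zero that(1)] norm_ge_zero]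
        by linarith
      have t1: "\<bar>((1 / \<Delta>t) *\<^sub>R (Q - q0)) \<bullet> P\<bar> \<le> Kdt * W"
      proof -
        have "norm (Q - q0) \<le> 2 * B * S1"
          using norm_triangle_ineq4[of Q q0] Q h(1) BS by simp
        then have "\<bar>(Q - q0) \<bullet> P\<bar> \<le> (2 * B * S1) * (B * S1)" by (rule ip[OF _ P])
        then have "\<bar>((1 / \<Delta>t) *\<^sub>R (Q - q0)) \<bullet> P\<bar> \<le> \<bar>1 / \<Delta>t\<bar> * ((2 * B * S1) * (B * S1))"
          unfolding inner_scaleR_left abs_mult by (rule mult_left_mono) simp
        also have "\<dots> = Kdt * S1\<^sup>2" by (simp add: Kdt_def power2_eq_square)
        also have "\<dots> \<le> Kdt * W" using W B0 by (intro mult_left_mono) (auto simp: Kdt_def)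
        finally show ?thesis .
      qed
      have t2: "\<bar>(\<beta>1 *\<^sub>R Q - (b / 3) *\<^sub>R M Q) \<bullet> P\<bar> \<le> Kb * W"
      proof -
        have "norm (M Q) \<le> KM * (B * S1)\<^sup>2"
          using KM(2)[of Q] mult_left_mono[OF power_mono[OF Q norm_ge_zero, of 2] KM(1)] by linarith
        also have "\<dots> = KM * B\<^sup>2 * S1\<^sup>2" by (simp add: power_mult_distrib)
        finally have MQ: "\<bar>b / 3\<bar> * norm (M Q) \<le> \<bar>b / 3\<bar> * (KM * B\<^sup>2 * S1\<^sup>2)" by (rule mult_left_mono) simp
        have "\<bar>\<beta>1\<bar> * norm Q \<le> \<bar>\<beta>1\<bar> * (B * S1\<^sup>2)"
          using Q mult_left_mono[OF pw(1) B0] by (intro mult_left_mono) auto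
        with MQ have "norm (\<beta>1 *\<^sub>R Q - (b / 3) *\<^sub>R M Q) \<le> (\<bar>\<beta>1\<bar> * B + \<bar>b / 3\<bar> * (KM * B\<^sup>2)) * S1\<^sup>2"
          using norm_triangle_ineq4[of "\<beta>1 *\<^sub>R Q" "(b / 3) *\<^sub>R M Q"]
          unfolding norm_scaleR real_norm_def by (simp only: algebra_simps)
        then have "\<bar>(\<beta>1 *\<^sub>R Q - (b / 3) *\<^sub>R M Q) \<bullet> P\<bar> \<le> ((\<bar>\<beta>1\<bar> * B + \<bar>b / 3\<bar> * (KM * B\<^sup>2)) * S1\<^sup>2) * (B * S1)"
          by (rule ip[OF _ P])
        also have "\<dots> = Kb * S1 ^ 3" by (simp add: Kb_def power2_eq_square power3_eq_cube)
        also have "\<dots> \<le> Kb * W" using W B0 KM by (intro mult_left_mono) (auto simp: Kb_def)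
        finally show ?thesis .
      qed
      have t3: "\<bar>dF2 a c \<beta>1 \<beta>2 q0 \<bullet> P\<bar> \<le> K2 * W"
      proof -
        have 1: "norm ((\<beta>1 - a) *\<^sub>R q0) \<le> \<bar>\<beta>1 - a\<bar> * B"
          using mult_left_mono[OF h(1), of "\<bar>\<beta>1 - a\<bar>"] by simp
        have "(norm q0)\<^sup>2 * norm q0 \<le> B\<^sup>2 * B"
          using h(1) by (intro mult_mono power_mono) auto
        then have "norm (((\<beta>2 - c) * (norm q0)\<^sup>2) *\<^sub>R q0) \<le> \<bar>\<beta>2 - c\<bar> * (B\<^sup>2 * B)"
          using mult_left_mono[of "(norm q0)\<^sup>2 * norm q0" "B\<^sup>2 * B" "\<bar>\<beta>2 - c\<bar>"] by (simp add: abs_mult mult.assoc)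
        then have "norm (dF2 a c \<beta>1 \<beta>2 q0) \<le> \<bar>\<beta>1 - a\<bar> * B + \<bar>\<beta>2 - c\<bar> * (B\<^sup>2 * B)"
          unfolding dF2_def using 1 by (rule norm_triangle_le[OF add_mono, rotated])
        then have "\<bar>dF2 a c \<beta>1 \<beta>2 q0 \<bullet> P\<bar> \<le> (\<bar>\<beta>1 - a\<bar> * B + \<bar>\<beta>2 - c\<bar> * (B\<^sup>2 * B)) * (B * S1)"
          by (rule ip[OF _ P])
        also have "\<dots> = K2 * S1" by (simp add: K2_def)
        also have "\<dots> \<le> K2 * W" using W B0 by (intro mult_left_mono) (auto simp: K2_def)
        finally show ?thesis .
      qed
      \<comment> \<open>With \<open>\<alpha> = q \<bullet> P\<close> the product expands into
        \<open>norm P ^ 4\<close>, two terms linear in \<open>\<alpha>\<close>, and nonnegative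
        remainders. The linear ones cost \<open>3 * B ^ 4 * S1 ^ 3\<close> and
        \<open>B ^ 4 * S1\<close>, whence the factor 4.\<close>
      have t4: "(norm Q)\<^sup>2 * (Q \<bullet> P) \<ge> norm P ^ 4 - 4 * B ^ 4 * W"
      proof -
        define \<alpha> where "\<alpha> = q \<bullet> P"
        have "\<bar>\<alpha>\<bar> \<le> B * norm P" unfolding \<alpha>_def by (rule ip[OF h(4)]) simp
        then have \<alpha>: "\<alpha> \<ge> - (B * norm P)" by linarith
        have e1: "(norm Q)\<^sup>2 = (norm P)\<^sup>2 + 2 * \<alpha> + (norm q)\<^sup>2"
          by (simp add: Q_def \<alpha>_def power2_norm_eq_inner inner_simps inner_commute)
        have e2: "Q \<bullet> P = (norm P)\<^sup>2 + \<alpha>"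
          by (simp add: Q_def \<alpha>_def power2_norm_eq_inner inner_simps)
        have "(norm Q)\<^sup>2 * (Q \<bullet> P) =
            norm P ^ 4 + 3 * (norm P)\<^sup>2 * \<alpha> + (norm q)\<^sup>2 * \<alpha> + (2 * \<alpha>\<^sup>2 + (norm q)\<^sup>2 * (norm P)\<^sup>2)"
          unfolding e1 e2 by (simp add: power2_eq_square power4_eq_xxxx algebra_simps)
        moreover have "3 * (norm P)\<^sup>2 * \<alpha> \<ge> - (3 * (B ^ 4 * S1 ^ 3))"
        proof -
          have "(norm P)\<^sup>2 * (B * norm P) \<le> (B * S1)\<^sup>2 * (B * (B * S1))"
            using P B0 by (intro mult_mono power_mono) auto
          also have "\<dots> = B ^ 4 * S1 ^ 3" by (simp add: power2_eq_square power3_eq_cube power4_eq_xxxx)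
          finally have "(norm P)\<^sup>2 * (B * norm P) \<le> B ^ 4 * S1 ^ 3" .
          moreover have "(norm P)\<^sup>2 * \<alpha> \<ge> (norm P)\<^sup>2 * - (B * norm P)" using \<alpha> by (rule mult_left_mono) simp
          ultimately have "(norm P)\<^sup>2 * \<alpha> \<ge> - (B ^ 4 * S1 ^ 3)" by linarith
          then show ?thesis unfolding mult.assoc by linarith
        qed
        moreover have "(norm q)\<^sup>2 * \<alpha> \<ge> - (B ^ 4 * S1)"
        proof -
          have "(norm q)\<^sup>2 * (B * norm P) \<le> B\<^sup>2 * (B * (B * S1))"
            using P B0 h(4) by (intro mult_mono power_mono) auto
          also have "\<dots> = B ^ 4 * S1" by (simp add: power2_eq_square power4_eq_xxxx)
          finally have "(norm q)\<^sup>2 * (B * norm P) \<le> B ^ 4 * S1" .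
          moreover have "(norm q)\<^sup>2 * \<alpha> \<ge> (norm q)\<^sup>2 * - (B * norm P)" using \<alpha> by (rule mult_left_mono) simp
          ultimately show ?thesis by simp
        qed
        moreover have "2 * \<alpha>\<^sup>2 + (norm q)\<^sup>2 * (norm P)\<^sup>2 \<ge> 0" by simp
        moreover have "B ^ 4 * S1 \<le> B ^ 4 * W" "B ^ 4 * S1 ^ 3 \<le> B ^ 4 * W"
          using W B0 by (auto intro!: mult_left_mono)
        ultimately show ?thesis by linarith
      qed
      have t5: "\<bar>((\<epsilon>2 / 2) *\<^sub>R dev_sym (Ptilde TR Q q0 \<odot> outer g0 g')) \<bullet> P\<bar> \<le> KP * W"
      proof -
        have "norm (Ptilde TR Q q0 \<odot> outer g0 g') \<le> n2 * (C * (B * (B * G1)))"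
        proof (rule order_trans[OF had])
          show "n2 * (C * (norm g0 * norm g')) \<le> n2 * (C * (B * (B * G1)))"
            using C0 B0 h(3) g' by (intro mult_left_mono mult_mono) (auto simp: n2_def)
        qed
        then have "norm (dev_sym (Ptilde TR Q q0 \<odot> outer g0 g')) \<le> KS * (n2 * (C * (B * (B * G1))))"
          using KS(2)[of "Ptilde TR Q q0 \<odot> outer g0 g'"] mult_left_mono[OF _ KS(1)] order_trans by blast
        then have "\<bar>dev_sym (Ptilde TR Q q0 \<odot> outer g0 g') \<bullet> P\<bar> \<le> (KS * (n2 * (C * (B * (B * G1))))) * (B * S1)"
          by (rule ip[OF _ P])
        then have "\<bar>((\<epsilon>2 / 2) *\<^sub>R dev_sym (Ptilde TR Q q0 \<odot> outer g0 g')) \<bullet> P\<bar> \<le>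
            \<bar>\<epsilon>2 / 2\<bar> * ((KS * (n2 * (C * (B * (B * G1))))) * (B * S1))"
          unfolding inner_scaleR_left abs_mult by (rule mult_left_mono) simp
        also have "\<dots> = KP * (S1 * G1)" by (simp add: KP_def)
        also have "\<dots> \<le> KP * W" using W B0 KS C0 by (intro mult_left_mono) (auto simp: KP_def n2_def)
        finally show ?thesis .
      qed
      \<comment> \<open>The gradient terms are bilinear and of size
        \<open>S1\<^sup>2 + S1 * G1\<close>; this stays within \<open>W\<close>, so an estimate by
        absolute values is good enough.\<close>
      have t6: "\<bar>flux L \<epsilon>3 (d0 + D', g0 + g') \<bullet> D\<bar> \<le> Kf * W"
      proof -
        have "norm (d0 + D', g0 + g') \<le> norm (d0 + D') + norm (g0 + g')" by (rule norm_Pair_le)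
        also have "\<dots> \<le> 2 * B * (S1 + G1)"
          using norm_triangle_ineq[of d0 D'] norm_triangle_ineq[of g0 g'] h(2,3) D' g' BS by (simp add: algebra_simps)
        finally have "norm (flux L \<epsilon>3 (d0 + D', g0 + g')) \<le> KF * (2 * B * (S1 + G1))"
          using KF(2)[of "(d0 + D', g0 + g')"] mult_left_mono[OF _ KF(1)] order_trans by blast
        then have "\<bar>flux L \<epsilon>3 (d0 + D', g0 + g') \<bullet> D\<bar> \<le> (KF * (2 * B * (S1 + G1))) * (B * S1)"
          by (rule ip[OF _ Dn])
        also have "\<dots> = Kf * (S1\<^sup>2 + S1 * G1)" by (simp add: Kf_def power2_eq_square algebra_simps)
        also have "\<dots> \<le> Kf * W" using W B0 KF by (intro mult_left_mono) (auto simp: Kf_def)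
        finally show ?thesis .
      qed
      \<comment> \<open>Only the parts quadratic in \<open>p\<close> matter, and they keep the
        factor \<open>\<epsilon>1 - \<bar>\<epsilon>2\<bar> * R\<close>. The boundary extension
        \<open>g\<close> and the divergence contribute terms linear in \<open>p\<close>, of size at
        most \<open>S1 * G1\<close>.\<close>
      have t7: "(\<epsilon>1 *\<^sub>R g' + \<epsilon>2 *\<^sub>R (TR Q *v g') + \<epsilon>3 *\<^sub>R div_of D') \<bullet> p \<ge>
          (\<epsilon>1 - \<bar>\<epsilon>2\<bar> * R) * (norm p)\<^sup>2 - Ku * W"
      proof -
        have gp: "\<bar>g \<bullet> p\<bar> \<le> B * (B * G1)" by (rule ip[OF h(6) pn])
        have 1: "\<epsilon>1 * (g' \<bullet> p) \<ge> \<epsilon>1 * (norm p)\<^sup>2 - \<bar>\<epsilon>1\<bar> * (B * (B * G1))"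
        proof -
          have "\<bar>\<epsilon>1 * (g \<bullet> p)\<bar> \<le> \<bar>\<epsilon>1\<bar> * (B * (B * G1))" unfolding abs_mult using gp by (rule mult_left_mono) simp
          moreover have "g' \<bullet> p = g \<bullet> p + (norm p)\<^sup>2" by (simp add: g'_def inner_simps power2_norm_eq_inner)
          ultimately show ?thesis by (simp add: algebra_simps abs_le_iff)
        qed
        have 2: "\<epsilon>2 * ((TR Q *v g') \<bullet> p) \<ge> - (\<bar>\<epsilon>2\<bar> * R * (norm p)\<^sup>2) - \<bar>\<epsilon>2\<bar> * R * (B * (B * G1))"
        proof -
          have "norm (TR Q *v g') \<le> R * norm g'"
            using norm_matrix_vector_le[of "TR Q" g'] mult_right_mono[OF truncation_norm_le[OF trunc] norm_ge_zero] order_trans by blast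
          then have "\<bar>(TR Q *v g') \<bullet> p\<bar> \<le> (R * norm g') * norm p" by (rule ip) simp
          also have "\<dots> \<le> R * ((norm g + norm p) * norm p)"
            using norm_triangle_ineq[of g p] R0 unfolding g'_def mult.assoc by (intro mult_left_mono mult_right_mono) auto
          also have "\<dots> \<le> R * ((norm p)\<^sup>2 + B * (B * G1))"
            using mult_mono[OF h(6) pn B0 norm_ge_zero] R0 by (intro mult_left_mono) (auto simp: algebra_simps power2_eq_square)
          finally have "\<bar>\<epsilon>2 * ((TR Q *v g') \<bullet> p)\<bar> \<le> \<bar>\<epsilon>2\<bar> * (R * ((norm p)\<^sup>2 + B * (B * G1)))"
            unfolding abs_mult by (rule mult_left_mono) simp
          then show ?thesis by (simp add: algebra_simps abs_le_iff)
        qed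
        have 3: "\<epsilon>3 * (div_of D' \<bullet> p) \<ge> - (\<bar>\<epsilon>3\<bar> * ((KD * (B * S1)) * (B * G1)))"
        proof -
          have "norm (div_of D') \<le> KD * (B * S1)"
            using KD(2)[of D'] mult_left_mono[OF D' KD(1)] by linarith
          then have "\<bar>div_of D' \<bullet> p\<bar> \<le> (KD * (B * S1)) * (B * G1)" by (rule ip[OF _ pn])
          then have "\<bar>\<epsilon>3 * (div_of D' \<bullet> p)\<bar> \<le> \<bar>\<epsilon>3\<bar> * ((KD * (B * S1)) * (B * G1))"
            unfolding abs_mult by (rule mult_left_mono) simp
          then show ?thesis by (simp add: abs_le_iff)
        qed
        have 4: "(\<bar>\<epsilon>1\<bar> + \<bar>\<epsilon>2\<bar> * R) * B * B * G1 \<le> (\<bar>\<epsilon>1\<bar> + \<bar>\<epsilon>2\<bar> * R) * B * B * W"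
          using W R0 B0 by (intro mult_left_mono) auto
        have 5: "\<bar>\<epsilon>3\<bar> * (KD * B) * B * (S1 * G1) \<le> \<bar>\<epsilon>3\<bar> * (KD * B) * B * W"
          using W KD B0 by (intro mult_left_mono) auto
        have "(\<epsilon>1 *\<^sub>R g' + \<epsilon>2 *\<^sub>R (TR Q *v g') + \<epsilon>3 *\<^sub>R div_of D') \<bullet> p =
            \<epsilon>1 * (g' \<bullet> p) + \<epsilon>2 * ((TR Q *v g') \<bullet> p) + \<epsilon>3 * (div_of D' \<bullet> p)" by (simp add: inner_simps)
        with 1 2 3 4 5 show ?thesis by (simp add: Ku_def algebra_simps)
      qed
      have "pointwise_op (q0, d0, g0) (Q, D', g') \<bullet> (P, D, p) =
          ((1 / \<Delta>t) *\<^sub>R (Q - q0)) \<bullet> P + (\<beta>1 *\<^sub>R Q - (b / 3) *\<^sub>R M Q) \<bullet> P + \<beta>2 * ((norm Q)\<^sup>2 * (Q \<bullet> P))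
          - dF2 a c \<beta>1 \<beta>2 q0 \<bullet> P - ((\<epsilon>2 / 2) *\<^sub>R dev_sym (Ptilde TR Q q0 \<odot> outer g0 g')) \<bullet> P
          + flux L \<epsilon>3 (d0 + D', g0 + g') \<bullet> D
          + (\<epsilon>1 *\<^sub>R g' + \<epsilon>2 *\<^sub>R (TR Q *v g') + \<epsilon>3 *\<^sub>R div_of D') \<bullet> p"
        by (simp add: pointwise_op_def dF1_def M_def inner_add_left inner_diff_left)
      moreover have "\<beta>2 * ((norm Q)\<^sup>2 * (Q \<bullet> P)) \<ge> \<beta>2 * norm P ^ 4 - Kq * W"
        using mult_left_mono[OF t4, of \<beta>2] \<beta>2_pos by (simp add: Kq_def algebra_simps)
      moreover have "K * W = Kdt * W + Kb * W + K2 * W + Kq * W + KP * W + Kf * W + Ku * W"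
        by (simp add: K_def distrib_right)
      ultimately have "pointwise_op (q0, d0, g0) (Q, D', g') \<bullet> (P, D, p) \<ge>
          \<beta>2 * norm P ^ 4 + (\<epsilon>1 - \<bar>\<epsilon>2\<bar> * R) * (norm p)\<^sup>2 - K * W"
        using t1 t2 t3 t5 t6 t7 by (simp only: abs_le_iff) linarith
      then show ?thesis by (simp only: Q_def D'_def g'_def W_def S1_def G1_def)
    qed
  qed (rule K0)
qed

end

section \<open>Galerkin systems\<close>

lemma quartic_dominates_cubic:
  assumes "c0 > 0" "K \<ge> 0"
  shows "\<exists>C\<ge>0. \<forall>s\<ge>0. K * (1 + s) ^ 3 \<le> c0 * s ^ 4 + (C::real)"
proof -
  \<comment> \<open>Beyond \<open>m\<close> one has \<open>1 + s \<le> 2 s\<close> and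
    \<open>8 K \<le> c0 s\<close>, so the cubic term is dominated by the quartic one. Below
    \<open>m\<close> it is bounded by \<open>8 K m ^ 3\<close>.\<close>
  define m where "m = max 1 (8 * K / c0)"
  have m: "m \<ge> 1" "8 * K \<le> c0 * m" using assms(1) by (auto simp: m_def max_def field_simps)
  have "K * (1 + s) ^ 3 \<le> c0 * s ^ 4 + 8 * K * m ^ 3" if s: "s \<ge> 0" for s
  proof (cases "s \<le> m")
    case True
    have "(1 + s) ^ 3 \<le> (2 * m) ^ 3" using True m(1) s by (intro power_mono) auto
    then have "K * (1 + s) ^ 3 \<le> K * (2 * m) ^ 3" using assms(2) by (rule mult_left_mono)
    moreover have "c0 * s ^ 4 \<ge> 0" using assms(1) s by simp
    ultimately show ?thesis by (simp add: power_mult_distrib)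
  next
    case False
    have "(1 + s) ^ 3 \<le> (2 * s) ^ 3" using False m(1) by (intro power_mono) auto
    then have "K * (1 + s) ^ 3 \<le> K * (2 * s) ^ 3" using assms(2) by (rule mult_left_mono)
    also have "\<dots> = (8 * K) * s ^ 3" by (simp add: power_mult_distrib)
    also have "\<dots> \<le> (c0 * s) * s ^ 3"
    proof (rule mult_right_mono)
      have "c0 * m \<le> c0 * s" using False assms(1) by simp
      with m(2) show "8 * K \<le> c0 * s" by linarith
    qed (use s in simp)
    also have "\<dots> = c0 * s ^ 4" by (simp add: power3_eq_cube power4_eq_xxxx mult.assoc)
    finally show ?thesis using assms(2) m(1) by (simp add: add_increasing2)
  qed
  then show ?thesis using assms(2) m(1) by (intro exI[of _ "8 * K * m ^ 3"]) auto
qed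

text \<open>Young's inequality spends half of \<open>\<kappa> G ^ 2\<close> on the mixed term. The
  other half, completed by \<open>\<kappa> / 2 * s ^ 2\<close>, equals
  \<open>\<kappa> r ^ 2 / 2\<close> on the sphere and outweighs the constant left over by the
  comparison of \<open>s ^ 4\<close> with the cubic terms.\<close>

lemma coercivity_radius:
  assumes c0: "c0 > 0" and \<kappa>: "\<kappa> > 0" and K: "K \<ge> 0"
  shows "\<exists>r>0. \<forall>s\<ge>0. \<forall>G\<ge>0. s\<^sup>2 + G\<^sup>2 = r\<^sup>2 \<longrightarrow>
    0 \<le> c0 * s ^ 4 + \<kappa> * G\<^sup>2 - K * ((1 + s) ^ 3 + (1 + s) * (1 + G :: real))"
proof -
  \<comment> \<open>\<open>2 K\<close> pays for the cubic term and for \<open>K (1 + s)\<close>, the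
    second summand for Young's inequality, and \<open>\<kappa> / 2\<close> for the
    \<open>s ^ 2\<close> borrowed to complete the square of the radius.\<close>
  define K' where "K' = 2 * K + K\<^sup>2 / (2 * \<kappa>) + \<kappa> / 2"
  have K': "K' \<ge> 0" using K \<kappa> by (simp add: K'_def)
  obtain C where C: "C \<ge> 0" "\<And>s. s \<ge> 0 \<Longrightarrow> K' * (1 + s) ^ 3 \<le> c0 * s ^ 4 + C"
    using quartic_dominates_cubic[OF c0 K'] by blast
  \<comment> \<open>Chosen so that \<open>\<kappa> r ^ 2 / 2 = C + \<kappa> / 2\<close>, which
    exceeds the constant \<open>C\<close>.\<close>
  define r where "r = sqrt (2 * C / \<kappa> + 1)"
  have r: "r > 0" "r\<^sup>2 = 2 * C / \<kappa> + 1" using C(1) \<kappa> by (simp_all add: r_def add_nonneg_pos)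
  have "0 \<le> c0 * s ^ 4 + \<kappa> * G\<^sup>2 - K * ((1 + s) ^ 3 + (1 + s) * (1 + G))"
    if s: "s \<ge> 0" and G: "G \<ge> 0" and eq: "s\<^sup>2 + G\<^sup>2 = r\<^sup>2" for s G
  proof -
    define t where "t = 1 + s"
    have t: "t \<ge> 1" using s by (simp add: t_def)
    have p: "t \<le> t ^ 3" "t\<^sup>2 \<le> t ^ 3" "s\<^sup>2 \<le> t ^ 3"
    proof -
      show 1: "t \<le> t ^ 3" "t\<^sup>2 \<le> t ^ 3"
        using power_increasing[OF _ t, of 1 3] power_increasing[OF _ t, of 2 3] by simp_all
      have "s\<^sup>2 \<le> t\<^sup>2" using s by (intro power_mono) (auto simp: t_def)
      with 1 show "s\<^sup>2 \<le> t ^ 3" by linarith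
    qed
    have young: "K * (t * G) \<le> \<kappa> / 2 * G\<^sup>2 + K\<^sup>2 / (2 * \<kappa>) * t\<^sup>2"
    proof -
      have "0 \<le> (\<kappa> * G - K * t)\<^sup>2 / (2 * \<kappa>)" using \<kappa> by simp
      also have "\<dots> = \<kappa> / 2 * G\<^sup>2 + K\<^sup>2 / (2 * \<kappa>) * t\<^sup>2 - K * (t * G)"
        using \<kappa> by (simp add: power2_eq_square field_simps)
      finally show ?thesis by simp
    qed
    have "K * t \<le> K * t ^ 3" by (rule mult_left_mono[OF p(1) K])
    moreover have "K\<^sup>2 / (2 * \<kappa>) * t\<^sup>2 \<le> K\<^sup>2 / (2 * \<kappa>) * t ^ 3"
      by (rule mult_left_mono[OF p(2)]) (use \<kappa> in simp)
    moreover have "\<kappa> / 2 * s\<^sup>2 \<le> \<kappa> / 2 * t ^ 3"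
      by (rule mult_left_mono[OF p(3)]) (use \<kappa> in simp)
    moreover have "K' * t ^ 3 = K * t ^ 3 + K * t ^ 3 + K\<^sup>2 / (2 * \<kappa>) * t ^ 3 + \<kappa> / 2 * t ^ 3"
      by (simp add: K'_def algebra_simps)
    moreover have "K * (t ^ 3 + t * (1 + G)) = K * t ^ 3 + K * t + K * (t * G)" by (simp add: algebra_simps)
    moreover have "K' * t ^ 3 \<le> c0 * s ^ 4 + C" using C(2)[OF s] by (simp add: t_def)
    moreover have "\<kappa> / 2 * G\<^sup>2 + \<kappa> / 2 * s\<^sup>2 = C + \<kappa> / 2"
    proof -
      have "\<kappa> / 2 * (s\<^sup>2 + G\<^sup>2) = C + \<kappa> / 2" unfolding eq r(2) using \<kappa> by (simp add: field_simps)
      then show ?thesis by (simp add: algebra_simps)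
    qed
    moreover have "\<kappa> * G\<^sup>2 = \<kappa> / 2 * G\<^sup>2 + \<kappa> / 2 * G\<^sup>2" by simp
    ultimately have "0 \<le> c0 * s ^ 4 + \<kappa> * G\<^sup>2 - K * (t ^ 3 + t * (1 + G))"
      using young \<kappa> by linarith
    then show ?thesis by (simp add: t_def)
  qed
  with r(1) show ?thesis by blast
qed

text \<open>The residuals against the basis functions form a map on coefficient vectors, and its
  pairing with \<open>z\<close> is the integral tested with the combination of the
  \<open>w i\<close> itself. Continuity in \<open>z\<close> comes from dominated
  convergence.\<close>

lemma galerkin_solution:
  fixes F :: "'y::euclidean_space \<Rightarrow> 'y \<Rightarrow> 'y" and y0 yD :: "'x \<Rightarrow> 'y" and w :: "nat \<Rightarrow> 'x \<Rightarrow> 'y"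
  assumes M: "finite_measure M" and y0: "bdd_meas M y0" and yD: "bdd_meas M yD"
    and w: "\<And>i. i < m \<Longrightarrow> bdd_meas M (w i)"
    and F: "continuous_on UNIV (\<lambda>p. F (fst p) (snd p))"
    and r: "r > 0"
    and coercive: "\<And>z. (\<Sum>i<m. (z i)\<^sup>2) = r\<^sup>2 \<Longrightarrow>
      0 \<le> (LINT x|M. F (y0 x) (yD x + (\<Sum>i<m. z i *\<^sub>R w i x)) \<bullet> (\<Sum>i<m. z i *\<^sub>R w i x))"
  shows "\<exists>z. \<forall>i<m. (LINT x|M. F (y0 x) (yD x + (\<Sum>j<m. z j *\<^sub>R w j x)) \<bullet> w i x) = 0"
proof (rule coercive_map_has_zero[OF _ r])
  define Y where "Y z x = yD x + (\<Sum>j<m. z j *\<^sub>R w j x)" for z x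
  have Y: "bdd_meas M (Y z)" for z
    unfolding Y_def by (intro bdd_meas_add bdd_meas_sum bdd_meas_scaleR bdd_meas_const yD w) simp
  have FY: "bdd_meas M (\<lambda>x. F (y0 x) (Y z x))" for z
    by (rule bdd_meas_continuous2[OF y0 Y F])
  have FYw: "bdd_meas M (\<lambda>x. F (y0 x) (Y z x) \<bullet> w i x)" if "i < m" for z i
    by (rule bdd_meas_inner[OF FY w[OF that]])
  show "(\<lambda>k. LINT x|M. F (y0 x) (yD x + (\<Sum>j<m. X k j *\<^sub>R w j x)) \<bullet> w i x) \<longlonglongrightarrow>
      (LINT x|M. F (y0 x) (yD x + (\<Sum>j<m. z j *\<^sub>R w j x)) \<bullet> w i x)"
    if i: "i < m" and X: "\<And>j. j < m \<Longrightarrow> (\<lambda>k. X k j) \<longlonglongrightarrow> z j" for X z i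
  proof -
    have "\<exists>b. \<forall>k. \<bar>X k j\<bar> \<le> b" if "j < m" for j
      using X[OF that] convergent_imp_Bseq[of "\<lambda>k. X k j"]
      unfolding convergent_def Bseq_def by auto
    then obtain b where b: "\<And>j k. j < m \<Longrightarrow> \<bar>X k j\<bar> \<le> b j" by metis
    obtain B0 BD where B0: "AE x in M. norm (y0 x) \<le> B0" and BD: "AE x in M. norm (yD x) \<le> BD"
      using y0 yD by (auto simp: bdd_meas_def)
    have "\<exists>B. AE x in M. norm (w j x) \<le> B" if "j < m" for j using w[OF that] by (auto simp: bdd_meas_def)
    then obtain Bw where Bw: "\<And>j. j < m \<Longrightarrow> AE x in M. norm (w j x) \<le> Bw j" by metis
    then have Bw': "AE x in M. \<forall>j\<in>{..<m}. norm (w j x) \<le> Bw j"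
      by (subst AE_finite_all) auto
    \<comment> \<open>Along a convergent, hence bounded, sequence of coefficient vectors all
      arguments of \<open>F\<close> stay almost everywhere in one compact ball, on which the
      continuous \<open>F\<close> is bounded.\<close>
    define S where "S = B0 + (BD + (\<Sum>j<m. b j * Bw j))"
    have "bounded ((\<lambda>p. F (fst p) (snd p)) ` cball 0 S)"
      using F by (intro compact_imp_bounded compact_continuous_image) (auto intro: continuous_on_subset)
    then obtain BF where BF: "\<forall>y\<in>(\<lambda>p. F (fst p) (snd p)) ` cball 0 S. norm y \<le> BF" unfolding bounded_iff by blast
    show ?thesis unfolding Y_def[symmetric]
    proof (rule integral_dominated_convergence[where w = "\<lambda>x. \<bar>BF\<bar> * \<bar>Bw i\<bar>"])
      show "(\<lambda>x. F (y0 x) (Y z x) \<bullet> w i x) \<in> borel_measurable M"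
        "(\<lambda>x. F (y0 x) (Y (X k) x) \<bullet> w i x) \<in> borel_measurable M" for k
        using FYw[OF i] by (auto simp: bdd_meas_def)
      show "integrable M (\<lambda>x. \<bar>BF\<bar> * \<bar>Bw i\<bar>)" using M by (simp add: finite_measure.integrable_const)
      show "AE x in M. (\<lambda>k. F (y0 x) (Y (X k) x) \<bullet> w i x) \<longlonglongrightarrow> F (y0 x) (Y z x) \<bullet> w i x"
      proof (rule AE_I2)
        fix x
        have "(\<lambda>k. Y (X k) x) \<longlonglongrightarrow> Y z x"
          unfolding Y_def using X by (intro tendsto_intros) auto
        then have "(\<lambda>k. (y0 x, Y (X k) x)) \<longlonglongrightarrow> (y0 x, Y z x)" by (intro tendsto_intros)
        moreover have "isCont (\<lambda>p. F (fst p) (snd p)) (y0 x, Y z x)"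
          using F by (simp add: continuous_on_eq_continuous_at)
        ultimately have "(\<lambda>k. F (fst (y0 x, Y (X k) x)) (snd (y0 x, Y (X k) x))) \<longlonglongrightarrow> F (fst (y0 x, Y z x)) (snd (y0 x, Y z x))"
          by (rule isCont_tendsto_compose[rotated])
        then show "(\<lambda>k. F (y0 x) (Y (X k) x) \<bullet> w i x) \<longlonglongrightarrow> F (y0 x) (Y z x) \<bullet> w i x"
          by (intro tendsto_intros) simp
      qed
      show "AE x in M. norm (F (y0 x) (Y (X k) x) \<bullet> w i x) \<le> \<bar>BF\<bar> * \<bar>Bw i\<bar>" for k
        using B0 BD Bw'
      proof eventually_elim
        case (elim x)
        have "norm (Y (X k) x) \<le> norm (yD x) + (\<Sum>j<m. norm (X k j *\<^sub>R w j x))"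
          unfolding Y_def by (rule norm_triangle_le) (intro add_left_mono norm_sum)
        also have "(\<Sum>j<m. norm (X k j *\<^sub>R w j x)) \<le> (\<Sum>j<m. b j * Bw j)"
        proof (rule sum_mono)
          fix j assume j: "j \<in> {..<m}"
          then show "norm (X k j *\<^sub>R w j x) \<le> b j * Bw j"
            using b[of j k] elim(3) by (auto intro!: mult_mono order_trans[OF abs_ge_zero b[of j k]])
        qed
        finally have "norm (Y (X k) x) \<le> BD + (\<Sum>j<m. b j * Bw j)" using elim(2) by simp
        then have "norm (y0 x, Y (X k) x) \<le> S"
          using norm_Pair_le[of "y0 x" "Y (X k) x"] elim(1) by (simp add: S_def)
        then have "norm (F (y0 x) (Y (X k) x)) \<le> BF"
          using BF by (force simp: image_iff)
        then have "norm (F (y0 x) (Y (X k) x)) * norm (w i x) \<le> \<bar>BF\<bar> * \<bar>Bw i\<bar>"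
          using elim(3) i by (intro mult_mono) (auto intro: order_trans[OF _ abs_ge_self])
        then show ?case
          using Cauchy_Schwarz_ineq2[of "F (y0 x) (Y (X k) x)" "w i x"] by simp
      qed
    qed
  qed
  show "0 \<le> (\<Sum>i<m. (LINT x|M. F (y0 x) (yD x + (\<Sum>j<m. z j *\<^sub>R w j x)) \<bullet> w i x) * z i)"
    if z: "(\<Sum>i<m. (z i)\<^sup>2) = r\<^sup>2" for z
  proof -
    have "(LINT x|M. F (y0 x) (Y z x) \<bullet> (\<Sum>i<m. z i *\<^sub>R w i x)) =
        (LINT x|M. (\<Sum>i<m. (F (y0 x) (Y z x) \<bullet> w i x) * z i))"
      by (simp add: inner_sum_right mult.commute)
    also have "\<dots> = (\<Sum>i<m. (LINT x|M. (F (y0 x) (Y z x) \<bullet> w i x) * z i))"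
      by (intro Bochner_Integration.integral_sum integrable_mult_left bdd_meas_integrable[OF M] FYw) simp
    finally show ?thesis
      using coercive[OF z] unfolding Y_def by simp
  qed
qed

section \<open>The scheme as a variational problem for states\<close>

lemma bdd_meas_vec:
  fixes f :: "'k::finite \<Rightarrow> 'a \<Rightarrow> 'b::euclidean_space"
  assumes "\<And>k. bdd_meas M (f k)"
  shows "bdd_meas M (\<lambda>x. \<chi> k. f k x)"
proof -
  have "bdd_meas M (\<lambda>x. \<Sum>k\<in>UNIV. axis k (f k x))"
  proof (rule bdd_meas_sum)
    fix k :: 'k
    have "continuous_on UNIV (axis k :: 'b \<Rightarrow> 'b^'k)"
    proof -
      have "continuous_on UNIV (\<lambda>y :: 'b. if i = k then y else 0)" for i :: 'k
        by (cases "i = k") simp_all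
      then show ?thesis unfolding axis_def[abs_def] by (rule continuous_on_vec_lambda)
    qed
    then show "bdd_meas M (\<lambda>x. axis k (f k x))" by (rule bdd_meas_continuous[OF assms])
  qed
  moreover have "(\<Sum>k\<in>UNIV. axis k (f k x)) = (\<chi> k. f k x)" for x
    by (simp add: vec_eq_iff axis_def)
  ultimately show ?thesis by simp
qed

text \<open>One gradient for all value types, with the direction of differentiation as outer index.
  In terms of it \<open>grad\<close>, \<open>diverg\<close> and \<open>grad_contract\<close> become
  pointwise algebraic expressions.\<close>

definition wgrad :: "(real^'n) set \<Rightarrow> (real^'n \<Rightarrow> 'b::euclidean_space) \<Rightarrow> real^'n \<Rightarrow> 'b^'n" where
  "wgrad U v x = (\<chi> k. wpd U k v x)"

lemma grad_eq_wgrad: "grad U u = wgrad U u"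
  by (simp add: fun_eq_iff grad_def wgrad_def)

lemma diverg_eq_div_of: "diverg U Q x = div_of (wgrad U Q x)"
  by (simp add: diverg_def div_of_def wgrad_def)

lemma grad_contract_eq_inner: "grad_contract U A B x = wgrad U A x \<bullet> wgrad U B x"
  by (simp add: grad_contract_def wgrad_def inner_vec_def)

context bounded_open
begin

lemma bdd_meas_wgrad: "tame v \<Longrightarrow> bdd_meas (lebesgue_on U) (wgrad U v)"
  unfolding wgrad_def[abs_def] by (intro bdd_meas_vec) (simp add: tame_def)

lemma wgrad_add:
  assumes "tame v" "tame w"
  shows "AE x in lebesgue_on U. wgrad U (\<lambda>x. v x + w x) x = wgrad U v x + wgrad U w x"
proof -
  have "AE x in lebesgue_on U. \<forall>k. wpd U k (\<lambda>x. v x + w x) x = wpd U k v x + wpd U k w x"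
    by (rule eventually_all_finite) (rule tame_add(2)[OF assms])
  then show ?thesis by eventually_elim (simp add: wgrad_def vec_eq_iff)
qed

lemma wgrad_linear:
  assumes "tame v" "bounded_linear f"
  shows "AE x in lebesgue_on U. wgrad U (\<lambda>x. f (v x)) x = (\<chi> k. f (wgrad U v x $ k))"
proof -
  have "AE x in lebesgue_on U. \<forall>k. wpd U k (\<lambda>x. f (v x)) x = f (wpd U k v x)"
    by (rule eventually_all_finite) (rule tame_linear(2)[OF assms])
  then show ?thesis by eventually_elim (simp add: wgrad_def vec_eq_iff)
qed

lemma wgrad_scaleR:
  assumes "tame v"
  shows "AE x in lebesgue_on U. wgrad U (\<lambda>x. c *\<^sub>R v x) x = c *\<^sub>R wgrad U v x"
  using wgrad_linear[OF assms bounded_linear_scaleR_right[of c]]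
  by eventually_elim (simp add: vec_eq_iff)

lemma wgrad_sum:
  assumes "finite J" "\<And>j. j \<in> J \<Longrightarrow> tame (v j)"
  shows "AE x in lebesgue_on U. wgrad U (\<lambda>x. \<Sum>j\<in>J. c j *\<^sub>R v j x) x = (\<Sum>j\<in>J. c j *\<^sub>R wgrad U (v j) x)"
proof -
  have "AE x in lebesgue_on U. \<forall>k. wpd U k (\<lambda>x. \<Sum>j\<in>J. c j *\<^sub>R v j x) x = (\<Sum>j\<in>J. c j *\<^sub>R wpd U k (v j) x)"
    by (rule eventually_all_finite) (rule tame_sum(2)[OF assms])
  then show ?thesis by eventually_elim (simp add: wgrad_def vec_eq_iff)
qed

lemma wgrad_zero:
  assumes "tame v" "AE x in lebesgue_on U. v x = 0"
  shows "AE x in lebesgue_on U. wgrad U v x = 0"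
proof -
  have "v \<in> borel_measurable (lebesgue_on U)" using assms(1) by (simp add: tame_def bdd_meas_def)
  then have "AE x in lebesgue_on U. \<forall>k. wpd U k v x = 0"
    by (intro eventually_all_finite tame_zero(2)[OF _ assms(2)])
  then show ?thesis by eventually_elim (simp add: wgrad_def vec_eq_iff)
qed

lemma tame_diff: "tame v \<Longrightarrow> tame w \<Longrightarrow> tame (\<lambda>x. v x - w x)"
  using tame_add(1)[of v "\<lambda>x. (-1) *\<^sub>R w x"] tame_scaleR(1)[of w "-1"] by simp

lemma wgrad_diff:
  assumes "tame v" "tame w"
  shows "AE x in lebesgue_on U. wgrad U (\<lambda>x. v x - w x) x = wgrad U v x - wgrad U w x"
  using wgrad_add[OF assms(1) tame_scaleR(1)[OF assms(2), of "-1"]] wgrad_scaleR[OF assms(2), of "-1"]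
  by eventually_elim simp

lemma tame_midpoint:
  assumes "tame v" "tame w"
  shows "tame (midpoint_fun v w)"
    "AE x in lebesgue_on U. wgrad U (midpoint_fun v w) x = (1/2) *\<^sub>R (wgrad U v x + wgrad U w x)"
proof -
  show "tame (midpoint_fun v w)"
    unfolding midpoint_fun_def[abs_def] by (rule tame_scaleR(1)[OF tame_add(1)[OF assms]])
  show "AE x in lebesgue_on U. wgrad U (midpoint_fun v w) x = (1/2) *\<^sub>R (wgrad U v x + wgrad U w x)"
    unfolding midpoint_fun_def[abs_def]
    using wgrad_scaleR[OF tame_add(1)[OF assms], of "1/2"] wgrad_add[OF assms] by eventually_elim simp
qed

end

lemma bounded_linear_sym_part: "bounded_linear (sym_part :: real^'n^'n \<Rightarrow> _)"
  unfolding linear_conv_bounded_linear[symmetric]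
  by (rule linearI) (simp_all add: sym_part_def vec_eq_iff transpose_def algebra_simps)

lemma bounded_linear_trace: "bounded_linear (trace :: real^'n^'n \<Rightarrow> real)"
  unfolding linear_conv_bounded_linear[symmetric]
  by (rule linearI) (simp_all add: trace_def sum.distrib sum_distrib_left)

locale fem_scheme = bounded_open U + scheme_data TR L \<epsilon>1 \<epsilon>2 \<epsilon>3 a b c \<beta>1 \<beta>2 \<Delta>t R C
  for U :: "(real^'n) set" and TR :: "real^'n^'n \<Rightarrow> real^'n^'n"
    and L \<epsilon>1 \<epsilon>2 \<epsilon>3 a b c \<beta>1 \<beta>2 \<Delta>t R C :: real
begin

lemma flux_inner:
  fixes D E :: "real^'n^'n^'n" and w :: "real^'n"
  shows "flux L \<epsilon>3 (D, w) \<bullet> E = L / 2 * (D \<bullet> E)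
     - \<epsilon>3 / 2 * (w \<bullet> (\<chi> i. \<Sum>j\<in>UNIV. sym_part (E $ j) $ i $ j) - (1 / real CARD('n)) * (w \<bullet> (\<chi> k. trace (E $ k))))"
proof -
  have "flux L \<epsilon>3 (D, w) \<bullet> E = (\<Sum>k\<in>UNIV. L / 2 * (D $ k \<bullet> E $ k) - \<epsilon>3 / 2 * (dev_sym (outer w (axis k 1)) \<bullet> E $ k))"
    by (simp add: flux_def inner_vec_def[of _ E] inner_diff_left)
  also have "\<dots> = L / 2 * (\<Sum>k\<in>UNIV. D $ k \<bullet> E $ k) - \<epsilon>3 / 2 * (\<Sum>k\<in>UNIV. dev_sym (outer w (axis k 1)) \<bullet> E $ k)"
    by (simp only: sum_subtractf sum_distrib_left)
  also have "(\<Sum>k\<in>UNIV. D $ k \<bullet> E $ k) = D \<bullet> E" by (simp only: inner_vec_def[of D E])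
  finally show ?thesis unfolding adjoint_div_sym .
qed

text \<open>Tameness makes the five integrals of (S1) finite, so that they can be merged, and lets
  derivatives of midpoints, of \<open>sym_part\<close> and of \<open>trace\<close> be rewritten
  almost everywhere. The last component of the test state is 0 because it carries the test function
  of (S2).\<close>

lemma eq_S1_iff:
  assumes t: "tame Q0" "tame u0" "tame Q1" "tame u1" "tame \<Phi>"
  shows "eq_S1 U TR L \<epsilon>2 \<epsilon>3 a b c \<beta>1 \<beta>2 \<Delta>t Q0 u0 Q1 u1 \<Phi> \<longleftrightarrow>
    (LINT x|lebesgue_on U. pointwise_op (Q0 x, wgrad U Q0 x, wgrad U u0 x) (Q1 x, wgrad U Q1 x, wgrad U u1 x)
       \<bullet> (\<Phi> x, wgrad U \<Phi> x, 0)) = 0"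
proof -
  let ?M = "lebesgue_on U"
  define T1 where "T1 x = ((1 / \<Delta>t) *\<^sub>R (Q1 x - Q0 x)) \<bullet> \<Phi> x" for x
  define T2 where "T2 x = grad_contract U (midpoint_fun Q0 Q1) \<Phi> x" for x
  define T3 where "T3 x = (dF1 b \<beta>1 \<beta>2 (Q1 x) - dF2 a c \<beta>1 \<beta>2 (Q0 x)) \<bullet> \<Phi> x" for x
  define T4 where "T4 x = dev_sym (Ptilde TR (Q1 x) (Q0 x) \<odot> outer (grad U u0 x) (grad U u1 x)) \<bullet> \<Phi> x" for x
  define T5 where "T5 x = grad U (midpoint_fun u0 u1) x \<bullet> diverg U (\<lambda>y. sym_part (\<Phi> y)) x
         - (1 / real CARD('n)) * (grad U (midpoint_fun u0 u1) x \<bullet> grad U (\<lambda>y. trace (\<Phi> y)) x)" for x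
  have def: "eq_S1 U TR L \<epsilon>2 \<epsilon>3 a b c \<beta>1 \<beta>2 \<Delta>t Q0 u0 Q1 u1 \<Phi> \<longleftrightarrow>
     - (LINT x|?M. T1 x) = L * (LINT x|?M. T2 x) + (LINT x|?M. T3 x) - (\<epsilon>2 / 2) * (LINT x|?M. T4 x) - \<epsilon>3 * (LINT x|?M. T5 x)"
    unfolding eq_S1_def lint_U T1_def T2_def T3_def T4_def T5_def Let_def dev_sym_def ..
  have b: "bdd_meas ?M Q0" "bdd_meas ?M Q1" "bdd_meas ?M \<Phi>" using t by (simp_all add: tame_def)
  note mid = tame_midpoint[OF t(1,3)] tame_midpoint[OF t(2,4)]
  note ls = tame_linear[OF t(5) bounded_linear_sym_part] tame_linear[OF t(5) bounded_linear_trace]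
  have "bdd_meas ?M T1"
    unfolding T1_def[abs_def] by (intro bdd_meas_inner bdd_meas_scaleR bdd_meas_diff bdd_meas_const b)
  moreover have "bdd_meas ?M T2"
    unfolding T2_def[abs_def] grad_contract_eq_inner by (intro bdd_meas_inner bdd_meas_wgrad mid t)
  moreover have "bdd_meas ?M T3"
  proof -
    have "continuous_on UNIV (dF1 b \<beta>1 \<beta>2 :: real^'n^'n \<Rightarrow> _)" "continuous_on UNIV (dF2 a c \<beta>1 \<beta>2 :: real^'n^'n \<Rightarrow> _)"
      using continuous_on_dF1[OF continuous_on_id] continuous_on_dF2[OF continuous_on_id] by simp_all
    then show ?thesis
      unfolding T3_def[abs_def] by (intro bdd_meas_inner bdd_meas_diff bdd_meas_continuous[OF b(1)] bdd_meas_continuous[OF b(2)] b)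
  qed
  moreover have "bdd_meas ?M T4"
  proof -
    have d: "continuous_on UNIV (dev_sym :: real^'n^'n \<Rightarrow> _)"
      using continuous_on_dev_sym[OF continuous_on_id] by simp
    have o: "continuous_on UNIV (\<lambda>p. outer (fst p) (snd p :: real^'n) :: real^'n^'n)" by (intro continuous_intros)
    have h: "continuous_on UNIV (\<lambda>p. fst p \<odot> (snd p :: real^'n^'n))" by (intro continuous_intros)
    show ?thesis
      unfolding T4_def[abs_def] grad_eq_wgrad
      by (intro bdd_meas_inner b bdd_meas_continuous[OF _ d] bdd_meas_continuous2[OF _ _ h]
          bdd_meas_continuous2[OF b(2) b(1) Ptilde_continuous[OF trunc]]
          bdd_meas_continuous2[OF bdd_meas_wgrad[OF t(2)] bdd_meas_wgrad[OF t(4)] o])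
  qed
  moreover have "bdd_meas ?M T5"
    unfolding T5_def[abs_def] grad_eq_wgrad diverg_eq_div_of
    by (intro bdd_meas_diff bdd_meas_inner[where f = "\<lambda>x. 1 / real CARD('n)", unfolded inner_real_def] bdd_meas_const
        bdd_meas_inner bdd_meas_wgrad mid ls bdd_meas_continuous[OF _ div_of_continuous])
  ultimately have i: "integrable ?M T1" "integrable ?M T2" "integrable ?M T3" "integrable ?M T4" "integrable ?M T5"
    by (auto intro: integrable_U)
  have "(LINT x|?M. pointwise_op (Q0 x, wgrad U Q0 x, wgrad U u0 x) (Q1 x, wgrad U Q1 x, wgrad U u1 x)
       \<bullet> (\<Phi> x, wgrad U \<Phi> x, 0)) = (LINT x|?M. T1 x + L * T2 x + T3 x - (\<epsilon>2 / 2) * T4 x - \<epsilon>3 * T5 x)"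
  proof (rule integral_cong_AE)
    have y: "bdd_meas ?M (\<lambda>x. (Q0 x, wgrad U Q0 x, wgrad U u0 x))" "bdd_meas ?M (\<lambda>x. (Q1 x, wgrad U Q1 x, wgrad U u1 x))"
      "bdd_meas ?M (\<lambda>x. (\<Phi> x, wgrad U \<Phi> x, 0 :: real^'n))"
      by (intro bdd_meas_Pair bdd_meas_wgrad b t bdd_meas_const)+
    have "bdd_meas ?M (\<lambda>x. pointwise_op (Q0 x, wgrad U Q0 x, wgrad U u0 x) (Q1 x, wgrad U Q1 x, wgrad U u1 x)
       \<bullet> (\<Phi> x, wgrad U \<Phi> x, 0))"
      by (intro bdd_meas_inner bdd_meas_continuous2[OF y(1,2) pointwise_op_continuous] y)
    then show "(\<lambda>x. pointwise_op (Q0 x, wgrad U Q0 x, wgrad U u0 x) (Q1 x, wgrad U Q1 x, wgrad U u1 x)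
       \<bullet> (\<Phi> x, wgrad U \<Phi> x, 0)) \<in> borel_measurable ?M" by (simp add: bdd_meas_def)
    show "(\<lambda>x. T1 x + L * T2 x + T3 x - (\<epsilon>2 / 2) * T4 x - \<epsilon>3 * T5 x) \<in> borel_measurable ?M"
      using i by (intro borel_measurable_diff borel_measurable_add borel_measurable_times) auto
    show "AE x in ?M. pointwise_op (Q0 x, wgrad U Q0 x, wgrad U u0 x) (Q1 x, wgrad U Q1 x, wgrad U u1 x)
       \<bullet> (\<Phi> x, wgrad U \<Phi> x, 0) = T1 x + L * T2 x + T3 x - (\<epsilon>2 / 2) * T4 x - \<epsilon>3 * T5 x"
      using mid(2,4) wgrad_linear[OF t(5) bounded_linear_sym_part] wgrad_linear[OF t(5) bounded_linear_trace]
    proof eventually_elim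
      case (elim x)
      \<comment> \<open>The factor 2 cancels the halves in \<open>flux\<close>.\<close>
      have m: "wgrad U Q0 x + wgrad U Q1 x = 2 *\<^sub>R wgrad U (midpoint_fun Q0 Q1) x"
        "wgrad U u0 x + wgrad U u1 x = 2 *\<^sub>R wgrad U (midpoint_fun u0 u1) x" using elim(1,2) by simp_all
      have s: "div_of (wgrad U (\<lambda>x. sym_part (\<Phi> x)) x) = (\<chi> i. \<Sum>j\<in>UNIV. sym_part (wgrad U \<Phi> x $ j) $ i $ j)"
        using elim(3) by (simp add: div_of_def)
      have "flux L \<epsilon>3 (wgrad U Q0 x + wgrad U Q1 x, wgrad U u0 x + wgrad U u1 x) \<bullet> wgrad U \<Phi> x =
          L * T2 x - \<epsilon>3 * T5 x"
        unfolding m flux_inner T2_def T5_def grad_eq_wgrad diverg_eq_div_of s elim(4) grad_contract_eq_inner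
        by (simp add: algebra_simps)
      then show ?case
        by (simp add: pointwise_op_def T1_def T3_def T4_def grad_eq_wgrad inner_add_left inner_diff_left)
    qed
  qed
  also have "\<dots> = (LINT x|?M. T1 x) + L * (LINT x|?M. T2 x) + (LINT x|?M. T3 x)
      - (\<epsilon>2 / 2) * (LINT x|?M. T4 x) - \<epsilon>3 * (LINT x|?M. T5 x)"
    using i by simp
  finally show ?thesis unfolding def by linarith
qed

text \<open>The state \<open>y0\<close> is arbitrary because the third component of
  \<open>pointwise_op\<close> involves only the new time level.\<close>

lemma eq_S2_iff:
  "eq_S2 U TR \<epsilon>1 \<epsilon>2 \<epsilon>3 Q1 u1 \<psi> \<longleftrightarrow>
    (LINT x|lebesgue_on U. pointwise_op (y0 x) (Q1 x, wgrad U Q1 x, wgrad U u1 x) \<bullet> (0, 0, wgrad U \<psi> x)) = 0"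
  unfolding eq_S2_def lint_U grad_eq_wgrad diverg_eq_div_of pointwise_op_def
  by (simp add: case_prod_beta)

end

section \<open>Orthonormal bases of the finite element spaces\<close>

context mesh
begin

lemma AE_zero_on_U: "(\<And>x. x \<in> closure U \<Longrightarrow> v x = 0) \<Longrightarrow> AE x in lebesgue_on U. v x = 0"
  unfolding AE_U_iff using closure_subset[of U] by auto

lemma integral_inner_eq_0_imp_AE:
  fixes f :: "real^'n \<Rightarrow> 'c::euclidean_space"
  assumes "bdd_meas (lebesgue_on U) f" "(LINT x|lebesgue_on U. f x \<bullet> f x) = 0"
  shows "AE x in lebesgue_on U. f x = 0"
  using integral_nonneg_eq_0_iff_AE[of "lebesgue_on U" "\<lambda>x. f x \<bullet> f x"] integrable_U[OF bdd_meas_inner[OF assms(1) assms(1)]] assms(2)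
  by simp

text \<open>The functionals are the coordinates of the values at the vertices, encoded as pairs of a
  point and a basis vector; they are what \<open>orthonormal_basis_exists\<close> inducts
  on.\<close>

lemma vertex_functionals:
  "\<exists>\<Lambda> :: ((real^'n) \<times> 'b::euclidean_space) set. finite \<Lambda> \<and>
     (\<forall>v\<in>P1_zero U Tr. (\<forall>l\<in>\<Lambda>. v (fst l) \<bullet> snd l = 0) \<longrightarrow> (\<forall>x\<in>closure U. v x = 0))"
proof -
  obtain V where V: "finite V" "\<And>v :: real^'n \<Rightarrow> 'b. affine_on_elements Tr v \<Longrightarrow> \<forall>x\<in>V. v x = 0 \<Longrightarrow> \<forall>x\<in>closure U. v x = 0"
    using affine_zero_at_vertices by blast
  have "\<forall>x\<in>closure U. v x = 0" if "v \<in> P1_zero U Tr" and 0: "\<forall>l\<in>V \<times> Basis. v (fst l) \<bullet> snd l = 0"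
    for v :: "real^'n \<Rightarrow> 'b"
  proof (rule V(2)[OF P1_zero_affine[OF that(1)]])
    show "\<forall>x\<in>V. v x = 0" using 0 by (auto intro!: euclidean_eqI[of _ 0])
  qed
  with V(1) show ?thesis by (intro exI[of _ "V \<times> Basis"]) auto
qed

text \<open>
  Only the class of \<open>Q\<close> modulo null functions and only the gradient of \<open>u\<close> enter the scheme. Hence
  \<open>\<X>\<^sub>h\<close> is used with the \<open>L\<^sup>2\<close> product and \<open>\<Y>\<^sub>h\<close> with the Dirichlet form, both of which may be
  degenerate on functions with arbitrary values outside the domain.
\<close>

lemma P1_basis_general:
  fixes J :: "(real^'n \<Rightarrow> 'b::euclidean_space) \<Rightarrow> real^'n \<Rightarrow> 'c::euclidean_space"
  assumes J: "\<And>v. tame v \<Longrightarrow> bdd_meas (lebesgue_on U) (J v)"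
    and J_add: "\<And>v w. tame v \<Longrightarrow> tame w \<Longrightarrow> AE x in lebesgue_on U. J (\<lambda>x. v x + w x) x = J v x + J w x"
    and J_scale: "\<And>v c. tame v \<Longrightarrow> AE x in lebesgue_on U. J (\<lambda>x. c *\<^sub>R v x) x = c *\<^sub>R J v x"
    and J_sum: "\<And>v c m. (\<And>j. j < m \<Longrightarrow> tame (v j)) \<Longrightarrow>
      AE x in lebesgue_on U. J (\<lambda>x. \<Sum>j<(m::nat). c j *\<^sub>R v j x) x = (\<Sum>j<m. c j *\<^sub>R J (v j) x)"
    and J_zero: "\<And>v. tame v \<Longrightarrow> AE x in lebesgue_on U. v x = 0 \<Longrightarrow> AE x in lebesgue_on U. J v x = 0"
  shows "\<exists>(m::nat) w. (\<forall>i<m. w i \<in> P1_zero U Tr) \<and>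
    (\<forall>c. (LINT x|lebesgue_on U. (norm (\<Sum>i<m. c i *\<^sub>R J (w i) x))\<^sup>2) = (\<Sum>i<m. (c i)\<^sup>2)) \<and>
    (\<forall>v\<in>P1_zero U Tr. \<exists>c. AE x in lebesgue_on U. J (\<lambda>x. v x - (\<Sum>i<m. c i *\<^sub>R w i x)) x = 0)"
proof -
  let ?M = "lebesgue_on U" and ?V = "P1_zero U Tr :: (real^'n \<Rightarrow> 'b) set"
  \<comment> \<open>\<open>J\<close> will be the identity or \<open>wgrad U\<close>. It is linear
    only almost everywhere, hence each law of the form passes through
    \<open>integral_cong_AE\<close>.\<close>
  define ip where "ip v w = (LINT x|?M. J v x \<bullet> J w x)" for v w
  have Ji: "integrable ?M (\<lambda>x. J v x \<bullet> J w x)" if "tame v" "tame w" for v w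
    by (intro integrable_U bdd_meas_inner J that)
  have Jm: "(\<lambda>x. J v x \<bullet> J w x) \<in> borel_measurable ?M" if "tame v" "tame w" for v w
    using Ji[OF that] by simp
  have V: "semi_inner_space ?V ip"
  proof
    show "(\<lambda>x. 0) \<in> ?V" by (rule P1_zero_zero)
    fix u v w :: "real^'n \<Rightarrow> 'b" and c :: real assume "v \<in> ?V"
    note v = this P1_zero_tame[OF this]
    show "(\<lambda>x. c *\<^sub>R v x) \<in> ?V" by (rule P1_zero_scaleR[OF v(1)])
    show "0 \<le> ip v v" unfolding ip_def by (rule Bochner_Integration.integral_nonneg) simp
    {
      assume w: "w \<in> ?V"
      show "ip (\<lambda>x. c *\<^sub>R v x) w = c * ip v w"
      proof -
        have "ip (\<lambda>x. c *\<^sub>R v x) w = (LINT x|?M. c * (J v x \<bullet> J w x))"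
          unfolding ip_def
        proof (rule integral_cong_AE)
          show "AE x in ?M. J (\<lambda>x. c *\<^sub>R v x) x \<bullet> J w x = c * (J v x \<bullet> J w x)"
            using J_scale[OF v(2), of c] by eventually_elim simp
        qed (use Jm[OF tame_scaleR(1)[OF v(2)] P1_zero_tame[OF w]] Jm[OF v(2) P1_zero_tame[OF w]] in auto)
        then show ?thesis by (simp add: ip_def)
      qed
      show "ip v w = ip w v" unfolding ip_def by (simp add: inner_commute)
    }
    assume "u \<in> ?V"
    note u = this P1_zero_tame[OF this]
    show "(\<lambda>x. u x + v x) \<in> ?V" by (rule P1_zero_add[OF u(1) v(1)])
    assume w: "w \<in> ?V"
    show "ip (\<lambda>x. u x + v x) w = ip u w + ip v w"
    proof -
      have "ip (\<lambda>x. u x + v x) w = (LINT x|?M. J u x \<bullet> J w x + J v x \<bullet> J w x)"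
        unfolding ip_def
      proof (rule integral_cong_AE)
        show "AE x in ?M. J (\<lambda>x. u x + v x) x \<bullet> J w x = J u x \<bullet> J w x + J v x \<bullet> J w x"
          using J_add[OF u(2) v(2)] by eventually_elim (simp add: inner_add_left)
      qed (use Jm[OF tame_add(1)[OF u(2) v(2)] P1_zero_tame[OF w]] Jm[OF v(2) P1_zero_tame[OF w]]
          Jm[OF u(2) P1_zero_tame[OF w]] in auto)
      also have "\<dots> = ip u w + ip v w"
        unfolding ip_def by (rule Bochner_Integration.integral_add) (intro Ji u v P1_zero_tame[OF w])+
      finally show ?thesis .
    qed
  qed
  then interpret semi_inner_space ?V ip .
  obtain \<Lambda> :: "((real^'n) \<times> 'b) set" where \<Lambda>: "finite \<Lambda>"
    "\<And>v. v \<in> ?V \<Longrightarrow> (\<forall>l\<in>\<Lambda>. v (fst l) \<bullet> snd l = 0) \<Longrightarrow> \<forall>x\<in>closure U. v x = 0"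
    using vertex_functionals by blast
  have "\<exists>(m::nat) w. (\<forall>i<m. w i \<in> ?V) \<and> (\<forall>i<m. \<forall>j<m. ip (w i) (w j) = of_bool (i = j)) \<and>
    (\<forall>v\<in>?V. \<exists>c. ip (\<lambda>x. v x - (\<Sum>i<m. c i *\<^sub>R w i x)) (\<lambda>x. v x - (\<Sum>i<m. c i *\<^sub>R w i x)) = 0)"
  proof (rule orthonormal_basis_exists[OF \<Lambda>(1) V, where ev = "\<lambda>l v. v (fst l) \<bullet> snd l"])
    fix v assume v: "v \<in> ?V" and "\<And>l. l \<in> \<Lambda> \<Longrightarrow> v (fst l) \<bullet> snd l = 0"
    then have "\<forall>x\<in>closure U. v x = 0" using \<Lambda>(2) by blast
    then have "AE x in ?M. v x = 0" by (intro AE_zero_on_U) simp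
    from J_zero[OF P1_zero_tame[OF v] this] show "ip v v = 0"
      unfolding ip_def by (intro integral_eq_zero_AE) (auto elim!: eventually_mono)
  qed (simp_all add: inner_add_left)
  then obtain m :: nat and w where w: "\<And>i. i < m \<Longrightarrow> w i \<in> ?V"
    and on: "\<And>i j. i < m \<Longrightarrow> j < m \<Longrightarrow> ip (w i) (w j) = of_bool (i = j)"
    and span: "\<And>v. v \<in> ?V \<Longrightarrow> \<exists>c. ip (\<lambda>x. v x - (\<Sum>i<m. c i *\<^sub>R w i x)) (\<lambda>x. v x - (\<Sum>i<m. c i *\<^sub>R w i x)) = 0"
    by blast
  have "(LINT x|?M. (norm (\<Sum>i<m. c i *\<^sub>R J (w i) x))\<^sup>2) = (\<Sum>i<m. (c i)\<^sup>2)" for c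
  proof -
    let ?s = "\<lambda>x. \<Sum>i<m. c i *\<^sub>R w i x"
    have s: "tame ?s" by (rule P1_zero_tame[OF sum_in[OF w]])
    have "ip ?s ?s = (LINT x|?M. (norm (\<Sum>i<m. c i *\<^sub>R J (w i) x))\<^sup>2)"
      unfolding ip_def
    proof (rule integral_cong_AE)
      show "(\<lambda>x. (norm (\<Sum>i<m. c i *\<^sub>R J (w i) x))\<^sup>2) \<in> borel_measurable ?M"
      proof -
        have "bdd_meas ?M (\<lambda>x. \<Sum>i<m. c i *\<^sub>R J (w i) x)"
          using w by (intro bdd_meas_sum bdd_meas_scaleR bdd_meas_const J P1_zero_tame) auto
        from bdd_meas_inner[OF this this] show ?thesis
          by (simp add: bdd_meas_def power2_norm_eq_inner)
      qed
      show "AE x in ?M. J ?s x \<bullet> J ?s x = (norm (\<Sum>i<m. c i *\<^sub>R J (w i) x))\<^sup>2"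
        using J_sum[of m w c] P1_zero_tame[OF w] by (auto elim!: eventually_mono simp: power2_norm_eq_inner)
    qed (rule Jm[OF s s])
    then show ?thesis using ip_sum_orthonormal[of m w c, OF w on] by simp
  qed
  moreover have "\<exists>c. AE x in ?M. J (\<lambda>x. v x - (\<Sum>i<m. c i *\<^sub>R w i x)) x = 0" if v: "v \<in> ?V" for v
  proof -
    obtain c where c: "ip (\<lambda>x. v x - (\<Sum>i<m. c i *\<^sub>R w i x)) (\<lambda>x. v x - (\<Sum>i<m. c i *\<^sub>R w i x)) = 0"
      using span[OF v] by blast
    have "tame (\<lambda>x. v x - (\<Sum>i<m. c i *\<^sub>R w i x))"
      by (rule P1_zero_tame[OF diff_in[OF v sum_in[OF w]]])
    from integral_inner_eq_0_imp_AE[OF J[OF this] c[unfolded ip_def]] show ?thesis by blast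
  qed
  ultimately show ?thesis using w by blast
qed

text \<open>A tame function that vanishes almost everywhere has a vanishing weak gradient. An
  expansion modulo null functions therefore holds for the gradients too, with the same
  coefficients.\<close>

lemma P1_basis_L2:
  "\<exists>(m::nat) (w :: nat \<Rightarrow> real^'n \<Rightarrow> 'b::euclidean_space). (\<forall>i<m. w i \<in> P1_zero U Tr) \<and>
    (\<forall>c. (LINT x|lebesgue_on U. (norm (\<Sum>i<m. c i *\<^sub>R w i x))\<^sup>2) = (\<Sum>i<m. (c i)\<^sup>2)) \<and>
    (\<forall>v\<in>P1_zero U Tr. \<exists>c. (AE x in lebesgue_on U. v x = (\<Sum>i<m. c i *\<^sub>R w i x)) \<and>
       (AE x in lebesgue_on U. wgrad U v x = (\<Sum>i<m. c i *\<^sub>R wgrad U (w i) x)))"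
proof -
  have "\<exists>(m::nat) (w :: nat \<Rightarrow> real^'n \<Rightarrow> 'b). (\<forall>i<m. w i \<in> P1_zero U Tr) \<and>
    (\<forall>c. (LINT x|lebesgue_on U. (norm (\<Sum>i<m. c i *\<^sub>R w i x))\<^sup>2) = (\<Sum>i<m. (c i)\<^sup>2)) \<and>
    (\<forall>v\<in>P1_zero U Tr. \<exists>c. AE x in lebesgue_on U. v x - (\<Sum>i<m. c i *\<^sub>R w i x) = 0)"
    by (rule P1_basis_general[where J = "\<lambda>v. v"]) (auto simp: tame_def)
  then obtain m :: nat and w :: "nat \<Rightarrow> real^'n \<Rightarrow> 'b" where w: "\<And>i. i < m \<Longrightarrow> w i \<in> P1_zero U Tr"
    and n: "\<And>c. (LINT x|lebesgue_on U. (norm (\<Sum>i<m. c i *\<^sub>R w i x))\<^sup>2) = (\<Sum>i<m. (c i)\<^sup>2)"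
    and span: "\<And>v. v \<in> P1_zero U Tr \<Longrightarrow> \<exists>c. AE x in lebesgue_on U. v x - (\<Sum>i<m. c i *\<^sub>R w i x) = 0"
    by blast
  have "\<exists>c. (AE x in lebesgue_on U. v x = (\<Sum>i<m. c i *\<^sub>R w i x)) \<and>
       (AE x in lebesgue_on U. wgrad U v x = (\<Sum>i<m. c i *\<^sub>R wgrad U (w i) x))" if v: "v \<in> P1_zero U Tr" for v
  proof -
    obtain c where c: "AE x in lebesgue_on U. v x - (\<Sum>i<m. c i *\<^sub>R w i x) = 0" using span[OF v] by blast
    have wt: "tame (w j)" if "j \<in> {..<m}" for j using w that P1_zero_tame by blast
    have "tame (\<lambda>x. \<Sum>i<m. c i *\<^sub>R w i x)" by (rule tame_sum(1)) (auto intro: wt)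
    note t = P1_zero_tame[OF v] this
    have gs: "AE x in lebesgue_on U. wgrad U (\<lambda>x. \<Sum>i<m. c i *\<^sub>R w i x) x = (\<Sum>i<m. c i *\<^sub>R wgrad U (w i) x)"
      by (rule wgrad_sum) (auto intro: wt)
    have "AE x in lebesgue_on U. wgrad U v x = (\<Sum>i<m. c i *\<^sub>R wgrad U (w i) x)"
      using wgrad_zero[OF tame_diff[OF t] c] wgrad_diff[OF t] gs
      by eventually_elim simp
    moreover have "AE x in lebesgue_on U. v x = (\<Sum>i<m. c i *\<^sub>R w i x)"
      using c by eventually_elim simp
    ultimately show ?thesis by blast
  qed
  with w n show ?thesis by blast
qed

lemma P1_basis_Dirichlet:
  "\<exists>(m::nat) (w :: nat \<Rightarrow> real^'n \<Rightarrow> 'b::euclidean_space). (\<forall>i<m. w i \<in> P1_zero U Tr) \<and>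
    (\<forall>c. (LINT x|lebesgue_on U. (norm (\<Sum>i<m. c i *\<^sub>R wgrad U (w i) x))\<^sup>2) = (\<Sum>i<m. (c i)\<^sup>2)) \<and>
    (\<forall>v\<in>P1_zero U Tr. \<exists>c. AE x in lebesgue_on U. wgrad U v x = (\<Sum>i<m. c i *\<^sub>R wgrad U (w i) x))"
proof -
  have "\<exists>(m::nat) (w :: nat \<Rightarrow> real^'n \<Rightarrow> 'b). (\<forall>i<m. w i \<in> P1_zero U Tr) \<and>
    (\<forall>c. (LINT x|lebesgue_on U. (norm (\<Sum>i<m. c i *\<^sub>R wgrad U (w i) x))\<^sup>2) = (\<Sum>i<m. (c i)\<^sup>2)) \<and>
    (\<forall>v\<in>P1_zero U Tr. \<exists>c. AE x in lebesgue_on U. wgrad U (\<lambda>x. v x - (\<Sum>i<m. c i *\<^sub>R w i x)) x = 0)"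
  proof (rule P1_basis_general)
    fix v :: "nat \<Rightarrow> real^'n \<Rightarrow> 'b" and c and m :: nat
    assume "\<And>j. j < m \<Longrightarrow> tame (v j)"
    then show "AE x in lebesgue_on U. wgrad U (\<lambda>x. \<Sum>j<m. c j *\<^sub>R v j x) x = (\<Sum>j<m. c j *\<^sub>R wgrad U (v j) x)"
      by (intro wgrad_sum) auto
  qed (fact bdd_meas_wgrad wgrad_add wgrad_scaleR wgrad_zero)+
  then obtain m :: nat and w :: "nat \<Rightarrow> real^'n \<Rightarrow> 'b" where w: "\<And>i. i < m \<Longrightarrow> w i \<in> P1_zero U Tr"
    and n: "\<And>c. (LINT x|lebesgue_on U. (norm (\<Sum>i<m. c i *\<^sub>R wgrad U (w i) x))\<^sup>2) = (\<Sum>i<m. (c i)\<^sup>2)"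
    and span: "\<And>v. v \<in> P1_zero U Tr \<Longrightarrow> \<exists>c. AE x in lebesgue_on U. wgrad U (\<lambda>x. v x - (\<Sum>i<m. c i *\<^sub>R w i x)) x = 0"
    by blast
  have "\<exists>c. AE x in lebesgue_on U. wgrad U v x = (\<Sum>i<m. c i *\<^sub>R wgrad U (w i) x)" if v: "v \<in> P1_zero U Tr" for v
  proof -
    obtain c where c: "AE x in lebesgue_on U. wgrad U (\<lambda>x. v x - (\<Sum>i<m. c i *\<^sub>R w i x)) x = 0" using span[OF v] by blast
    have wt: "tame (w j)" if "j \<in> {..<m}" for j using w that P1_zero_tame by blast
    have "tame (\<lambda>x. \<Sum>i<m. c i *\<^sub>R w i x)" by (rule tame_sum(1)) (auto intro: wt)
    note t = P1_zero_tame[OF v] this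
    have gs: "AE x in lebesgue_on U. wgrad U (\<lambda>x. \<Sum>i<m. c i *\<^sub>R w i x) x = (\<Sum>i<m. c i *\<^sub>R wgrad U (w i) x)"
      by (rule wgrad_sum) (auto intro: wt)
    have "AE x in lebesgue_on U. wgrad U v x = (\<Sum>i<m. c i *\<^sub>R wgrad U (w i) x)"
      using c wgrad_diff[OF t] gs
      by eventually_elim simp
    then show ?thesis by blast
  qed
  with w n show ?thesis by blast
qed

end

section \<open>One time step\<close>

lemma sum_lessThan_add: "(\<Sum>i<k + l. f i) = (\<Sum>i<k. f i) + (\<Sum>j<l. f (k + j :: nat))"
  by (induction l) (simp_all add: add.assoc)

lemma bdd_meas_bound: "bdd_meas M f \<Longrightarrow> \<exists>B\<ge>0. AE x in M. norm (f x) \<le> B"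
proof -
  assume "bdd_meas M f"
  then obtain B where "AE x in M. norm (f x) \<le> B" by (auto simp: bdd_meas_def)
  then have "AE x in M. norm (f x) \<le> \<bar>B\<bar>" by (auto elim!: eventually_mono)
  then show ?thesis by (intro exI[of _ "\<bar>B\<bar>"]) simp
qed

text \<open>Each coefficient is at most the Euclidean norm of the coefficient vector. This supplies
  the bounds \<open>B * s\<close> and \<open>B * G\<close> that the pointwise coercivity estimate
  asks for.\<close>

lemma norm_sum_coefficients_le:
  assumes "\<And>i. i < (k::nat) \<Longrightarrow> norm (v i) \<le> b i" "\<And>i. i < k \<Longrightarrow> 0 \<le> b i"
  shows "norm (\<Sum>i<k. z i *\<^sub>R v i) \<le> (\<Sum>i<k. b i) * sqrt (\<Sum>i<k. (z i)\<^sup>2)"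
proof -
  have z: "\<bar>z i\<bar> \<le> sqrt (\<Sum>i<k. (z i)\<^sup>2)" if "i < k" for i
  proof (rule real_le_rsqrt)
    show "\<bar>z i\<bar>\<^sup>2 \<le> (\<Sum>i<k. (z i)\<^sup>2)"
      using member_le_sum[of i "{..<k}" "\<lambda>i. (z i)\<^sup>2"] that by simp
  qed
  have "norm (\<Sum>i<k. z i *\<^sub>R v i) \<le> (\<Sum>i<k. b i * sqrt (\<Sum>i<k. (z i)\<^sup>2))"
  proof (rule sum_norm_le)
    fix i assume "i \<in> {..<k}"
    then have "\<bar>z i\<bar> * norm (v i) \<le> sqrt (\<Sum>i<k. (z i)\<^sup>2) * b i"
      using z[of i] assms[of i] by (intro mult_mono) (auto intro: sum_nonneg)
    then show "norm (z i *\<^sub>R v i) \<le> b i * sqrt (\<Sum>i<k. (z i)\<^sup>2)" by (simp add: mult.commute)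
  qed
  then show ?thesis by (simp add: sum_distrib_right)
qed

locale galerkin_step = fem_scheme U TR L \<epsilon>1 \<epsilon>2 \<epsilon>3 a b c \<beta>1 \<beta>2 \<Delta>t R C + mesh U Tr
  for U :: "(real^'n) set" and TR :: "real^'n^'n \<Rightarrow> real^'n^'n"
    and L \<epsilon>1 \<epsilon>2 \<epsilon>3 a b c \<beta>1 \<beta>2 \<Delta>t R C :: real and Tr :: "(real^'n) set set"
begin

text \<open>Jensen's inequality through a tangent line: \<open>y ^ 4 \<ge> 2 t y ^ 2 - t ^ 2\<close>
  is integrated with a suitable \<open>t\<close>. The denominator \<open>\<mu> + 1\<close>, with
  \<open>\<mu>\<close> the measure of the domain, makes a case of measure zero harmless.\<close>

lemma integral_quartic_ge:
  fixes P :: "real^'n \<Rightarrow> 'b::euclidean_space"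
  assumes P: "bdd_meas (lebesgue_on U) P" and s: "(LINT x|lebesgue_on U. (norm (P x))\<^sup>2) = s\<^sup>2"
  shows "s ^ 4 / (measure (lebesgue_on U) (space (lebesgue_on U)) + 1) \<le> (LINT x|lebesgue_on U. norm (P x) ^ 4)"
proof -
  interpret finite_measure "lebesgue_on U" by (rule finite_U)
  let ?M = "lebesgue_on U"
  define \<mu> where "\<mu> = measure ?M (space ?M)"
  define t where "t = s\<^sup>2 / (\<mu> + 1)"
  have \<mu>: "\<mu> \<ge> 0" by (simp add: \<mu>_def)
  have i2: "integrable ?M (\<lambda>x. (norm (P x))\<^sup>2)"
    unfolding power2_norm_eq_inner by (intro integrable_U bdd_meas_inner P)
  have i4: "integrable ?M (\<lambda>x. norm (P x) ^ 4)"
  proof -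
    have "continuous_on UNIV (\<lambda>y :: 'b. norm y ^ 4)" by (intro continuous_intros)
    from integrable_U[OF bdd_meas_continuous[OF P this]] show ?thesis .
  qed
  have "(LINT x|?M. 2 * t * (norm (P x))\<^sup>2 - t\<^sup>2) \<le> (LINT x|?M. norm (P x) ^ 4)"
  proof (rule integral_mono)
    show "2 * t * (norm (P x))\<^sup>2 - t\<^sup>2 \<le> norm (P x) ^ 4" for x
      using zero_le_power2[of "(norm (P x))\<^sup>2 - t"]
      by (simp add: power2_eq_square power4_eq_xxxx algebra_simps)
  qed (use i2 i4 in auto)
  moreover have "(LINT x|?M. 2 * t * (norm (P x))\<^sup>2 - t\<^sup>2) = 2 * t * s\<^sup>2 - \<mu> * t\<^sup>2"
    using i2 s by (simp add: \<mu>_def)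
  moreover have "s ^ 4 / (\<mu> + 1) \<le> 2 * t * s\<^sup>2 - \<mu> * t\<^sup>2"
  proof -
    have st: "s\<^sup>2 = t * (\<mu> + 1)" using \<mu> by (simp add: t_def)
    have "s ^ 4 = (s\<^sup>2)\<^sup>2" by simp
    then have "s ^ 4 / (\<mu> + 1) = t\<^sup>2 * (\<mu> + 1)"
      unfolding st using \<mu> by (simp add: power2_eq_square)
    moreover have "2 * t * s\<^sup>2 - \<mu> * t\<^sup>2 = t\<^sup>2 * (\<mu> + 1) + t\<^sup>2"
      unfolding st by (simp add: power2_eq_square algebra_simps)
    ultimately show ?thesis by simp
  qed
  ultimately show ?thesis by (simp add: \<mu>_def)
qed

lemma scheme_step:
  fixes Q0 qh :: "real^'n \<Rightarrow> real^'n^'n" and u0 gh :: "real^'n \<Rightarrow> real"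
  assumes aff: "affine_on_elements Tr Q0" "affine_on_elements Tr u0"
    "affine_on_elements Tr qh" "affine_on_elements Tr gh"
  shows "\<exists>Qt\<in>P1_zero U Tr. \<exists>ut\<in>P1_zero U Tr.
    (\<forall>\<Phi>\<in>P1_zero U Tr. eq_S1 U TR L \<epsilon>2 \<epsilon>3 a b c \<beta>1 \<beta>2 \<Delta>t Q0 u0 (\<lambda>x. Qt x + qh x) (\<lambda>x. ut x + gh x) \<Phi>) \<and>
    (\<forall>\<psi>\<in>P1_zero U Tr. eq_S2 U TR \<epsilon>1 \<epsilon>2 \<epsilon>3 (\<lambda>x. Qt x + qh x) (\<lambda>x. ut x + gh x) \<psi>)"
proof -
  let ?M = "lebesgue_on U"
  interpret finite_measure ?M by (rule finite_U)
  note t = aff[THEN affine_tame]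
  obtain k :: nat and w :: "nat \<Rightarrow> real^'n \<Rightarrow> real^'n^'n" where ww: "\<forall>i<k. w i \<in> P1_zero U Tr"
    "\<forall>c. (LINT x|?M. (norm (\<Sum>i<k. c i *\<^sub>R w i x))\<^sup>2) = (\<Sum>i<k. (c i)\<^sup>2)"
    "\<forall>v\<in>P1_zero U Tr. \<exists>c. (AE x in ?M. v x = (\<Sum>i<k. c i *\<^sub>R w i x)) \<and>
       (AE x in ?M. wgrad U v x = (\<Sum>i<k. c i *\<^sub>R wgrad U (w i) x))"
    using P1_basis_L2 by (elim exE conjE)
  note w = ww(1)[rule_format] and w_norm = ww(2)[rule_format] and w_span = ww(3)[rule_format]
  obtain l :: nat and p :: "nat \<Rightarrow> real^'n \<Rightarrow> real" where pp: "\<forall>j<l. p j \<in> P1_zero U Tr"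
    "\<forall>c. (LINT x|?M. (norm (\<Sum>j<l. c j *\<^sub>R wgrad U (p j) x))\<^sup>2) = (\<Sum>j<l. (c j)\<^sup>2)"
    "\<forall>v\<in>P1_zero U Tr. \<exists>c. AE x in ?M. wgrad U v x = (\<Sum>j<l. c j *\<^sub>R wgrad U (p j) x)"
    using P1_basis_Dirichlet by (elim exE conjE)
  note p = pp(1)[rule_format] and p_norm = pp(2)[rule_format] and p_span = pp(3)[rule_format]
  have wt: "tame (w i)" if "i < k" for i using w[OF that] by (rule P1_zero_tame)
  have pt: "tame (p j)" if "j < l" for j using p[OF that] by (rule P1_zero_tame)
  define y0 :: "real^'n \<Rightarrow> 'n state" where "y0 x = (Q0 x, wgrad U Q0 x, wgrad U u0 x)" for x
  define yD :: "real^'n \<Rightarrow> 'n state" where "yD x = (qh x, wgrad U qh x, wgrad U gh x)" for x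
  \<comment> \<open>The first \<open>k\<close> directions move \<open>Q\<close> together with its
    gradient, the remaining \<open>l\<close> move only the gradient of \<open>u\<close>. Splitting a
    coefficient vector at \<open>k\<close> separates the two unknowns.\<close>
  define bs :: "nat \<Rightarrow> real^'n \<Rightarrow> 'n state" where
    "bs i x = (if i < k then (w i x, wgrad U (w i) x, 0) else (0, 0, wgrad U (p (i - k)) x))" for i x
  define P where "P z x = (\<Sum>i<k. z i *\<^sub>R w i x)" for z :: "nat \<Rightarrow> real" and x
  define D where "D z x = (\<Sum>i<k. z i *\<^sub>R wgrad U (w i) x)" for z :: "nat \<Rightarrow> real" and x
  define g where "g z x = (\<Sum>j<l. z (k + j) *\<^sub>R wgrad U (p j) x)" for z :: "nat \<Rightarrow> real" and x
  have bs_sum: "(\<Sum>i<k + l. z i *\<^sub>R bs i x) = (P z x, D z x, g z x)" for z x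
    unfolding sum_lessThan_add
    by (simp add: bs_def P_def D_def g_def prod_eq_iff fst_sum snd_sum)
  have b0: "bdd_meas ?M y0" and bD: "bdd_meas ?M yD"
    unfolding y0_def[abs_def] yD_def[abs_def]
    using t by (auto intro!: bdd_meas_Pair bdd_meas_wgrad simp: tame_def)
  have bb: "bdd_meas ?M (bs i)" if i: "i < k + l" for i
  proof (cases "i < k")
    case True
    then have "bs i = (\<lambda>x. (w i x, wgrad U (w i) x, 0))" by (simp add: bs_def fun_eq_iff)
    then show ?thesis
      using tameD(1)[OF wt[OF True]] bdd_meas_wgrad[OF wt[OF True]] by (simp add: bdd_meas_Pair bdd_meas_const)
  next
    case False
    then have "bs i = (\<lambda>x. (0, 0, wgrad U (p (i - k)) x))" by (simp add: bs_def fun_eq_iff)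
    moreover have "tame (p (i - k))" using False i by (intro pt) simp
    ultimately show ?thesis by (auto intro!: bdd_meas_Pair bdd_meas_const bdd_meas_wgrad)
  qed
  have bP: "bdd_meas ?M (P z)" "bdd_meas ?M (g z)" for z
    unfolding P_def[abs_def] g_def[abs_def]
    using wt pt by (auto intro!: bdd_meas_sum bdd_meas_scaleR bdd_meas_const bdd_meas_wgrad simp: tame_def)
  obtain B0 where B0: "B0 \<ge> 0" "AE x in ?M. norm (y0 x) \<le> B0" using bdd_meas_bound[OF b0] by blast
  obtain BD where BD: "BD \<ge> 0" "AE x in ?M. norm (yD x) \<le> BD" using bdd_meas_bound[OF bD] by blast
  obtain Bb where Bb: "\<And>i. i < k + l \<Longrightarrow> Bb i \<ge> 0" "\<And>i. i < k + l \<Longrightarrow> AE x in ?M. norm (bs i x) \<le> Bb i"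
    using bdd_meas_bound[OF bb] by metis
  have Bb': "AE x in ?M. \<forall>i\<in>{..<k + l}. norm (bs i x) \<le> Bb i"
    by (subst AE_finite_all) (use Bb(2) in auto)
  \<comment> \<open>One bound for the old state, the extensions and the sums of the basis bounds,
    made at least 1 to fit the coercivity estimate.\<close>
  define B where "B = 1 + B0 + BD + (\<Sum>i<k + l. Bb i)"
  have Bsum: "(\<Sum>i<k. Bb i) \<ge> 0" "(\<Sum>j<l. Bb (k + j)) \<ge> 0" using Bb(1) by (auto intro!: sum_nonneg)
  have B: "B \<ge> 1" "B0 \<le> B" "BD \<le> B" "(\<Sum>i<k. Bb i) \<le> B" "(\<Sum>j<l. Bb (k + j)) \<le> B"
    using B0(1) BD(1) Bsum by (auto simp: B_def sum_lessThan_add)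
  obtain K where K: "K \<ge> 0" and coer: "\<And>q0 d0 g0 q d g P D p s G.
    norm q0 \<le> B \<Longrightarrow> norm d0 \<le> B \<Longrightarrow> norm g0 \<le> B \<Longrightarrow> norm q \<le> B \<Longrightarrow> norm d \<le> B \<Longrightarrow> norm g \<le> B \<Longrightarrow>
    0 \<le> s \<Longrightarrow> 0 \<le> G \<Longrightarrow> norm P \<le> B * s \<Longrightarrow> norm D \<le> B * s \<Longrightarrow> norm p \<le> B * G \<Longrightarrow>
    pointwise_op (q0, d0, g0) (q + P, d + D, g + p) \<bullet> (P, D, p) \<ge>
      \<beta>2 * norm P ^ 4 + (\<epsilon>1 - \<bar>\<epsilon>2\<bar> * R) * (norm p)\<^sup>2 - K * ((1 + s) ^ 3 + (1 + s) * (1 + G))"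
    using pointwise_op_coercive[OF B(1)] by blast
  define \<mu> where "\<mu> = measure ?M (space ?M)"
  define \<kappa> where "\<kappa> = \<epsilon>1 - \<bar>\<epsilon>2\<bar> * R"
  have \<mu>: "\<mu> \<ge> 0" and \<kappa>: "\<kappa> > 0" using elliptic by (simp_all add: \<mu>_def \<kappa>_def)
  have "\<beta>2 / (\<mu> + 1) > 0" using \<beta>2_pos \<mu> by simp
  \<comment> \<open>Integrating the pointwise defect over the domain multiplies it by its measure,
    hence the constant \<open>K * \<mu>\<close>.\<close>
  from coercivity_radius[OF this \<kappa>, of "K * \<mu>"] K \<mu>
  obtain r where r: "r > 0" and rad: "\<And>s G. s \<ge> 0 \<Longrightarrow> G \<ge> 0 \<Longrightarrow> s\<^sup>2 + G\<^sup>2 = r\<^sup>2 \<Longrightarrow>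
    0 \<le> \<beta>2 / (\<mu> + 1) * s ^ 4 + \<kappa> * G\<^sup>2 - K * \<mu> * ((1 + s) ^ 3 + (1 + s) * (1 + G))"
    by auto
  have "\<exists>z. \<forall>i<k + l. (LINT x|?M. pointwise_op (y0 x) (yD x + (\<Sum>j<k + l. z j *\<^sub>R bs j x)) \<bullet> bs i x) = 0"
  proof (rule galerkin_solution[OF finite_U b0 bD bb pointwise_op_continuous r])
    fix z :: "nat \<Rightarrow> real" assume z: "(\<Sum>i<k + l. (z i)\<^sup>2) = r\<^sup>2"
    define s where "s = sqrt (\<Sum>i<k. (z i)\<^sup>2)"
    define G where "G = sqrt (\<Sum>j<l. (z (k + j))\<^sup>2)"
    have sG: "s \<ge> 0" "G \<ge> 0" "s\<^sup>2 = (\<Sum>i<k. (z i)\<^sup>2)" "G\<^sup>2 = (\<Sum>j<l. (z (k + j))\<^sup>2)"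
      by (simp_all add: s_def G_def sum_nonneg)
    define W where "W = (1 + s) ^ 3 + (1 + s) * (1 + G)"
    have sr: "s\<^sup>2 + G\<^sup>2 = r\<^sup>2" using z by (simp add: sG sum_lessThan_add)
    have pw: "AE x in ?M. \<beta>2 * norm (P z x) ^ 4 + \<kappa> * (norm (g z x))\<^sup>2 - K * W \<le>
        pointwise_op (y0 x) (yD x + (P z x, D z x, g z x)) \<bullet> (P z x, D z x, g z x)"
      using B0(2) BD(2) Bb'
    proof eventually_elim
      case (elim x)
      have c3: "norm (fst y) \<le> norm y" "norm (fst (snd y)) \<le> norm y" "norm (snd (snd y)) \<le> norm y" for y :: "'n state"
        using norm_fst_le[of "fst y" "snd y"] norm_snd_le[of "snd y" "fst y"]
          norm_fst_le[of "fst (snd y)" "snd (snd y)"] norm_snd_le[of "snd (snd y)" "fst (snd y)"] by simp_all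
      have n0: "norm (Q0 x) \<le> B" "norm (wgrad U Q0 x) \<le> B" "norm (wgrad U u0 x) \<le> B"
        using c3[of "y0 x"] elim(1) B(2) by (simp_all add: y0_def)
      have nD: "norm (qh x) \<le> B" "norm (wgrad U qh x) \<le> B" "norm (wgrad U gh x) \<le> B"
        using c3[of "yD x"] elim(2) B(3) by (simp_all add: yD_def)
      have nw: "norm (w i x) \<le> Bb i" "norm (wgrad U (w i) x) \<le> Bb i" if "i < k" for i
      proof -
        have "norm (bs i x) \<le> Bb i" using elim(3) that by simp
        then show "norm (w i x) \<le> Bb i" "norm (wgrad U (w i) x) \<le> Bb i"
          using c3[of "bs i x"] that by (simp_all add: bs_def)
      qed
      have np: "norm (wgrad U (p j) x) \<le> Bb (k + j)" if "j < l" for j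
      proof -
        have "norm (bs (k + j) x) \<le> Bb (k + j)" using elim(3) that by simp
        then show ?thesis using c3[of "bs (k + j) x"] by (simp add: bs_def)
      qed
      have "norm (P z x) \<le> B * s"
        unfolding P_def s_def
        by (rule order_trans[OF norm_sum_coefficients_le[where b = Bb] mult_right_mono[OF B(4)]])
          (use nw Bb(1) in \<open>auto intro: sum_nonneg\<close>)
      moreover have "norm (D z x) \<le> B * s"
        unfolding D_def s_def
        by (rule order_trans[OF norm_sum_coefficients_le[where b = Bb] mult_right_mono[OF B(4)]])
          (use nw Bb(1) in \<open>auto intro: sum_nonneg\<close>)
      moreover have "norm (g z x) \<le> B * G"
        unfolding g_def G_def
        by (rule order_trans[OF norm_sum_coefficients_le[where b = "\<lambda>j. Bb (k + j)"] mult_right_mono[OF B(5)]])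
          (use np Bb(1) in \<open>auto intro: sum_nonneg\<close>)
      ultimately show ?case
        using coer[OF n0 nD sG(1,2)] by (simp add: y0_def yD_def \<kappa>_def W_def)
    qed
    have bPDg: "bdd_meas ?M (\<lambda>x. (P z x, D z x, g z x))"
      unfolding bs_sum[symmetric] by (intro bdd_meas_sum bdd_meas_scaleR bdd_meas_const bb) simp
    have i_op: "integrable ?M (\<lambda>x. pointwise_op (y0 x) (yD x + (P z x, D z x, g z x)) \<bullet> (P z x, D z x, g z x))"
      by (intro integrable_U bdd_meas_inner bdd_meas_continuous2[OF b0 _ pointwise_op_continuous] bdd_meas_add bD bPDg)
    have i4: "integrable ?M (\<lambda>x. norm (P z x) ^ 4)"
    proof -
      have "continuous_on UNIV (\<lambda>y :: real^'n^'n. norm y ^ 4)" by (intro continuous_intros)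
      from integrable_U[OF bdd_meas_continuous[OF bP(1) this]] show ?thesis .
    qed
    have i2: "integrable ?M (\<lambda>x. (norm (g z x))\<^sup>2)"
      unfolding power2_norm_eq_inner by (intro integrable_U bdd_meas_inner bP)
    have P2: "(LINT x|?M. (norm (P z x))\<^sup>2) = s\<^sup>2" unfolding P_def sG by (rule w_norm)
    have g2: "(LINT x|?M. (norm (g z x))\<^sup>2) = G\<^sup>2" unfolding g_def sG by (rule p_norm)
    \<comment> \<open>The orthonormality of the two bases enters here: it turns the integrals of
      \<open>|P|^2\<close> and \<open>|g|^2\<close> into \<open>s ^ 2\<close> and
      \<open>G ^ 2\<close>, and the quartic integral is bounded below in terms of the
      former.\<close>
    have "0 \<le> \<beta>2 / (\<mu> + 1) * s ^ 4 + \<kappa> * G\<^sup>2 - K * \<mu> * W"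
      using rad[OF sG(1,2) sr] by (simp add: W_def)
    also have "\<dots> \<le> \<beta>2 * (LINT x|?M. norm (P z x) ^ 4) + \<kappa> * G\<^sup>2 - K * \<mu> * W"
      using mult_left_mono[OF integral_quartic_ge[OF bP(1) P2], of \<beta>2] \<beta>2_pos by (simp add: \<mu>_def)
    also have "\<dots> = (LINT x|?M. \<beta>2 * norm (P z x) ^ 4 + \<kappa> * (norm (g z x))\<^sup>2 - K * W)"
      using i4 i2 g2 by (simp add: \<mu>_def)
    also have "\<dots> \<le> (LINT x|?M. pointwise_op (y0 x) (yD x + (P z x, D z x, g z x)) \<bullet> (P z x, D z x, g z x))"
      by (rule integral_mono_AE[OF _ i_op pw]) (use i4 i2 in auto)
    finally show "0 \<le> (LINT x|?M. pointwise_op (y0 x) (yD x + (\<Sum>i<k + l. z i *\<^sub>R bs i x)) \<bullet> (\<Sum>i<k + l. z i *\<^sub>R bs i x))"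
      unfolding bs_sum .
  qed
  then obtain z where z: "\<And>i. i < k + l \<Longrightarrow>
      (LINT x|?M. pointwise_op (y0 x) (yD x + (P z x, D z x, g z x)) \<bullet> bs i x) = 0"
    unfolding bs_sum by blast
  \<comment> \<open>The coefficients found for gradients are reused for the functions
    \<open>p j\<close> themselves, which gives a potential with the prescribed gradient.\<close>
  define ut where "ut x = (\<Sum>j<l. z (k + j) *\<^sub>R p j x)" for x
  have Qt: "P z \<in> P1_zero U Tr" unfolding P_def[abs_def] by (rule P1_zero_sum) (use w in auto)
  have ut: "ut \<in> P1_zero U Tr" unfolding ut_def[abs_def] by (rule P1_zero_sum) (use p in auto)
  define Q1 where "Q1 x = P z x + qh x" for x
  define u1 where "u1 x = ut x + gh x" for x
  have t1: "tame Q1" "tame u1"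
    unfolding Q1_def[abs_def] u1_def[abs_def]
    by (rule tame_add(1)[OF P1_zero_tame[OF Qt] t(3)], rule tame_add(1)[OF P1_zero_tame[OF ut] t(4)])
  define y1 :: "real^'n \<Rightarrow> 'n state" where "y1 x = (Q1 x, wgrad U Q1 x, wgrad U u1 x)" for x
  \<comment> \<open>The state formed with the chosen representatives for the actual functions agrees
    almost everywhere with the algebraic combination that solves the Galerkin system.\<close>
  have y1: "AE x in ?M. y1 x = yD x + (P z x, D z x, g z x)"
  proof -
    have "AE x in ?M. wgrad U (P z) x = D z x"
      unfolding P_def[abs_def] D_def by (rule wgrad_sum) (use wt in auto)
    moreover have "AE x in ?M. wgrad U ut x = g z x"
      unfolding ut_def[abs_def] g_def by (rule wgrad_sum) (use pt in auto)
    moreover have "AE x in ?M. wgrad U Q1 x = wgrad U (P z) x + wgrad U qh x"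
      unfolding Q1_def[abs_def] by (rule wgrad_add[OF P1_zero_tame[OF Qt] t(3)])
    moreover have "AE x in ?M. wgrad U u1 x = wgrad U ut x + wgrad U gh x"
      unfolding u1_def[abs_def] by (rule wgrad_add[OF P1_zero_tame[OF ut] t(4)])
    ultimately show ?thesis
      by eventually_elim (simp add: y1_def yD_def Q1_def add.commute)
  qed
  have b1: "bdd_meas ?M y1"
    unfolding y1_def[abs_def] using t1 by (auto intro!: bdd_meas_Pair bdd_meas_wgrad simp: tame_def)
  have bop: "bdd_meas ?M (\<lambda>x. pointwise_op (y0 x) (y1 x))"
    by (rule bdd_meas_continuous2[OF b0 b1 pointwise_op_continuous])
  \<comment> \<open>By linearity the equation holds for every test state that is almost everywhere a
    combination of the \<open>bs i\<close>.\<close>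
  have test: "(LINT x|?M. pointwise_op (y0 x) (y1 x) \<bullet> \<tau> x) = 0"
    if \<tau>: "bdd_meas ?M \<tau>" and eq: "AE x in ?M. \<tau> x = (\<Sum>i<k + l. d i *\<^sub>R bs i x)" for \<tau> d
  proof -
    have m: "bdd_meas ?M (\<lambda>x. yD x + (P z x, D z x, g z x))"
      unfolding bs_sum[symmetric] by (intro bdd_meas_add bD bdd_meas_sum bdd_meas_scaleR bdd_meas_const bb) simp
    have bz: "bdd_meas ?M (\<lambda>x. pointwise_op (y0 x) (yD x + (P z x, D z x, g z x)))"
      by (rule bdd_meas_continuous2[OF b0 m pointwise_op_continuous])
    have iz: "integrable ?M (\<lambda>x. pointwise_op (y0 x) (yD x + (P z x, D z x, g z x)) \<bullet> bs i x)" if "i < k + l" for i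
      by (intro integrable_U bdd_meas_inner bz bb that)
    have "(LINT x|?M. pointwise_op (y0 x) (y1 x) \<bullet> \<tau> x) =
        (LINT x|?M. (\<Sum>i<k + l. d i * (pointwise_op (y0 x) (yD x + (P z x, D z x, g z x)) \<bullet> bs i x)))"
    proof (rule integral_cong_AE)
      show "(\<lambda>x. pointwise_op (y0 x) (y1 x) \<bullet> \<tau> x) \<in> borel_measurable ?M"
        using bdd_meas_inner[OF bop \<tau>] by (simp add: bdd_meas_def)
      show "(\<lambda>x. \<Sum>i<k + l. d i * (pointwise_op (y0 x) (yD x + (P z x, D z x, g z x)) \<bullet> bs i x)) \<in> borel_measurable ?M"
        using iz by (intro borel_measurable_sum borel_measurable_times) auto
      show "AE x in ?M. pointwise_op (y0 x) (y1 x) \<bullet> \<tau> x =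
          (\<Sum>i<k + l. d i * (pointwise_op (y0 x) (yD x + (P z x, D z x, g z x)) \<bullet> bs i x))"
        using y1 eq by eventually_elim (simp only: inner_sum_right inner_scaleR_right)
    qed
    also have "\<dots> = (\<Sum>i<k + l. (LINT x|?M. d i * (pointwise_op (y0 x) (yD x + (P z x, D z x, g z x)) \<bullet> bs i x)))"
      using iz by (intro Bochner_Integration.integral_sum integrable_mult_right) auto
    also have "\<dots> = 0" using z by (intro sum.neutral) simp
    finally show ?thesis .
  qed
  have S1: "eq_S1 U TR L \<epsilon>2 \<epsilon>3 a b c \<beta>1 \<beta>2 \<Delta>t Q0 u0 Q1 u1 \<Phi>" if \<Phi>: "\<Phi> \<in> P1_zero U Tr" for \<Phi>
  proof -
    note \<Phi>t = P1_zero_tame[OF \<Phi>]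
    obtain d where d: "AE x in ?M. \<Phi> x = (\<Sum>i<k. d i *\<^sub>R w i x)"
      "AE x in ?M. wgrad U \<Phi> x = (\<Sum>i<k. d i *\<^sub>R wgrad U (w i) x)"
      using w_span[OF \<Phi>] by blast
    \<comment> \<open>Padding with zeros selects (S1) from the joint system; in the same way
      coefficients shifted by \<open>k\<close> select (S2).\<close>
    define d' where "d' i = (if i < k then d i else 0)" for i
    have "AE x in ?M. (\<Phi> x, wgrad U \<Phi> x, 0) = (\<Sum>i<k + l. d' i *\<^sub>R bs i x)"
      using d unfolding bs_sum by eventually_elim (simp add: P_def D_def g_def d'_def)
    moreover have "bdd_meas ?M (\<lambda>x. (\<Phi> x, wgrad U \<Phi> x, 0 :: real^'n))"
      using \<Phi>t by (intro bdd_meas_Pair bdd_meas_wgrad bdd_meas_const) (simp_all add: tame_def)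
    ultimately have "(LINT x|?M. pointwise_op (y0 x) (y1 x) \<bullet> (\<Phi> x, wgrad U \<Phi> x, 0)) = 0" by (intro test)
    then show ?thesis
      unfolding eq_S1_iff[OF t(1,2) t1 \<Phi>t] y0_def y1_def .
  qed
  have S2: "eq_S2 U TR \<epsilon>1 \<epsilon>2 \<epsilon>3 Q1 u1 \<psi>" if \<psi>: "\<psi> \<in> P1_zero U Tr" for \<psi>
  proof -
    obtain d where d: "AE x in ?M. wgrad U \<psi> x = (\<Sum>j<l. d j *\<^sub>R wgrad U (p j) x)"
      using p_span[OF \<psi>] by blast
    define d' where "d' i = (if i < k then 0 else d (i - k))" for i
    have "AE x in ?M. (0, 0, wgrad U \<psi> x) = (\<Sum>i<k + l. d' i *\<^sub>R bs i x)"
      using d unfolding bs_sum by eventually_elim (simp add: P_def D_def g_def d'_def)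
    moreover have "bdd_meas ?M (\<lambda>x. (0 :: real^'n^'n, 0 :: real^'n^'n^'n, wgrad U \<psi> x))"
      by (intro bdd_meas_Pair bdd_meas_wgrad bdd_meas_const P1_zero_tame[OF \<psi>])
    ultimately have "(LINT x|?M. pointwise_op (y0 x) (y1 x) \<bullet> (0, 0, wgrad U \<psi> x)) = 0" by (intro test)
    then show ?thesis
      unfolding eq_S2_iff[where ?y0.0 = y0] y1_def .
  qed
  show ?thesis
    using Qt ut S1 S2 unfolding Q1_def[abs_def] u1_def[abs_def] by blast
qed

end

section \<open>Iteration over the time levels\<close>

theorem theorem2p7:
  fixes \<Omega> :: "(real^'n) set" and \<T> :: "(real^'n) set set"
    and T L \<epsilon>1 \<epsilon>2 \<epsilon>3 a b c R C\<^sub>T \<beta>1 \<beta>2 \<Delta>t \<rho> h :: real and N :: nat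
    and TR :: "real^'n^'n \<Rightarrow> real^'n^'n"
    and g :: "real \<Rightarrow> real^'n \<Rightarrow> real" and gh :: "nat \<Rightarrow> real^'n \<Rightarrow> real"
    and q qh :: "real^'n \<Rightarrow> real^'n^'n"
  assumes dim: "CARD('n) = 2 \<or> CARD('n) = 3"
    and dom: "polyhedral_domain \<Omega>"
    and pos: "T > 0" "L > 0" "\<epsilon>1 > 0" "c > 0" "R > 0" "C\<^sub>T > 0"
    and beta: "\<beta>1 \<ge> max \<bar>b\<bar> a" "\<beta>2 \<ge> max \<bar>b\<bar> c"
    and trunc: "truncation R C\<^sub>T TR"
    and time: "\<Delta>t > 0" "real N * \<Delta>t = T"
    and mesh: "\<rho> > 0" "quasi_uniform_mesh \<Omega> \<rho> h \<T>"
    and g: "g \<in> Linf_time_H1 \<Omega> T" "g \<in> W12_time_H1 \<Omega> T" "continuous_time_H1 \<Omega> T g"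
    and gh: "\<And>n. n \<le> N \<Longrightarrow> is_L2_projection \<Omega> \<T> (g (real n * \<Delta>t)) (gh n)"
    and q: "q \<in> H1 \<Omega>" "AE x in lebesgue. x \<in> \<Omega> \<longrightarrow> sym_tracefree (q x)"
    and qh: "is_L2_projection \<Omega> \<T> q qh"
    and eps: "\<epsilon>1 > \<bar>\<epsilon>2\<bar> * R + \<bar>\<epsilon>3\<bar>" "\<bar>\<epsilon>3\<bar> < L / 12"
  shows "(\<forall>n<N. \<forall>Qt \<in> P1_zero \<Omega> \<T>. \<forall>ut \<in> P1_zero \<Omega> \<T>.
            (\<forall>x\<in>\<Omega>. sym_tracefree (Qt x + qh x)) \<longrightarrow>
            (\<exists>Qt' \<in> P1_zero \<Omega> \<T>. \<exists>ut' \<in> P1_zero \<Omega> \<T>.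
               (\<forall>\<Phi> \<in> P1_zero \<Omega> \<T>.
                  eq_S1 \<Omega> TR L \<epsilon>2 \<epsilon>3 a b c \<beta>1 \<beta>2 \<Delta>t
                    (\<lambda>x. Qt x + qh x) (\<lambda>x. ut x + gh n x)
                    (\<lambda>x. Qt' x + qh x) (\<lambda>x. ut' x + gh (Suc n) x) \<Phi>) \<and>
               (\<forall>\<psi> \<in> P1_zero \<Omega> \<T>.
                  eq_S2 \<Omega> TR \<epsilon>1 \<epsilon>2 \<epsilon>3
                    (\<lambda>x. Qt' x + qh x) (\<lambda>x. ut' x + gh (Suc n) x) \<psi>)))
       \<and>
         (\<forall>Q0 u0.
            (\<lambda>x. Q0 x - qh x) \<in> P1_zero \<Omega> \<T> \<longrightarrow> (\<forall>x\<in>\<Omega>. sym_tracefree (Q0 x)) \<longrightarrow>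
            (\<lambda>x. u0 x - gh 0 x) \<in> P1_zero \<Omega> \<T> \<longrightarrow>
            (\<exists>(Q :: nat \<Rightarrow> real^'n \<Rightarrow> real^'n^'n) (u :: nat \<Rightarrow> real^'n \<Rightarrow> real).
               Q 0 = Q0 \<and> u 0 = u0 \<and>
               (\<forall>n<N.
                  (\<lambda>x. Q (Suc n) x - qh x) \<in> P1_zero \<Omega> \<T> \<and>
                  (\<lambda>x. u (Suc n) x - gh (Suc n) x) \<in> P1_zero \<Omega> \<T> \<and>
                  (\<forall>\<Phi> \<in> P1_zero \<Omega> \<T>.
                     eq_S1 \<Omega> TR L \<epsilon>2 \<epsilon>3 a b c \<beta>1 \<beta>2 \<Delta>t (Q n) (u n) (Q (Suc n)) (u (Suc n)) \<Phi>) \<and>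
                  (\<forall>\<psi> \<in> P1_zero \<Omega> \<T>. eq_S2 \<Omega> TR \<epsilon>1 \<epsilon>2 \<epsilon>3 (Q (Suc n)) (u (Suc n)) \<psi>))))"
proof -
  have \<beta>2: "\<beta>2 > 0" using beta(2) pos(4) by linarith
  interpret galerkin_step \<Omega> TR L \<epsilon>1 \<epsilon>2 \<epsilon>3 a b c \<beta>1 \<beta>2 \<Delta>t R C\<^sub>T \<T>
  proof
    show "open \<Omega>" "bounded \<Omega>" "convex \<Omega>" using dom by (auto simp: polyhedral_domain_def)
    show "truncation R C\<^sub>T TR" by (rule trunc)
    show "\<beta>2 > 0" by (rule \<beta>2)
    show "\<epsilon>1 > \<bar>\<epsilon>2\<bar> * R" using eps(1) by linarith
    show "finite \<T>" "\<Union>\<T> = closure \<Omega>"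
      using mesh(2) by (auto simp: quasi_uniform_mesh_def triangulation_def)
    show "\<exists>C. finite C \<and> K = convex hull C" if "K \<in> \<T>" for K
    proof -
      have "int CARD('n) simplex K" using mesh(2) that by (simp add: quasi_uniform_mesh_def)
      then show ?thesis unfolding simplex by blast
    qed
  qed
  have qh': "affine_on_elements \<T> qh" using qh by (simp add: is_L2_projection_def P1_space_def)
  have gh': "affine_on_elements \<T> (gh n)" if "n \<le> N" for n
    using gh[OF that] by (simp add: is_L2_projection_def P1_space_def)
  show ?thesis
  proof (intro conjI allI impI ballI)
    fix n and Qt :: "real^'n \<Rightarrow> real^'n^'n" and ut :: "real^'n \<Rightarrow> real"
    assume n: "n < N" and Qt: "Qt \<in> P1_zero \<Omega> \<T>" and ut: "ut \<in> P1_zero \<Omega> \<T>"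
    have "affine_on_elements \<T> (\<lambda>x. Qt x + qh x)" "affine_on_elements \<T> (\<lambda>x. ut x + gh n x)"
      using affine_add[OF P1_zero_affine[OF Qt] qh'] affine_add[OF P1_zero_affine[OF ut] gh'[of n]] n by simp_all
    from scheme_step[OF this qh' gh'[of "Suc n"]] n
    show "\<exists>Qt' \<in> P1_zero \<Omega> \<T>. \<exists>ut' \<in> P1_zero \<Omega> \<T>.
               (\<forall>\<Phi> \<in> P1_zero \<Omega> \<T>.
                  eq_S1 \<Omega> TR L \<epsilon>2 \<epsilon>3 a b c \<beta>1 \<beta>2 \<Delta>t
                    (\<lambda>x. Qt x + qh x) (\<lambda>x. ut x + gh n x)
                    (\<lambda>x. Qt' x + qh x) (\<lambda>x. ut' x + gh (Suc n) x) \<Phi>) \<and>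
               (\<forall>\<psi> \<in> P1_zero \<Omega> \<T>.
                  eq_S2 \<Omega> TR \<epsilon>1 \<epsilon>2 \<epsilon>3
                    (\<lambda>x. Qt' x + qh x) (\<lambda>x. ut' x + gh (Suc n) x) \<psi>)"
      by simp
  next
    fix Q0 :: "real^'n \<Rightarrow> real^'n^'n" and u0 :: "real^'n \<Rightarrow> real"
    assume Q0: "(\<lambda>x. Q0 x - qh x) \<in> P1_zero \<Omega> \<T>" and u0: "(\<lambda>x. u0 x - gh 0 x) \<in> P1_zero \<Omega> \<T>"
    \<comment> \<open>Being piecewise affine is all that a step requires from the old time level.
      The last conjunct pins the sequence to the given initial data.\<close>
    define inv where "inv n y \<longleftrightarrow> affine_on_elements \<T> (fst y) \<and> affine_on_elements \<T> (snd y) \<and> (n = 0 \<longrightarrow> y = (Q0, u0))"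
      for n :: nat and y :: "(real^'n \<Rightarrow> real^'n^'n) \<times> (real^'n \<Rightarrow> real)"
    define step where "step n y y' \<longleftrightarrow> (n < N \<longrightarrow>
        (\<lambda>x. fst y' x - qh x) \<in> P1_zero \<Omega> \<T> \<and> (\<lambda>x. snd y' x - gh (Suc n) x) \<in> P1_zero \<Omega> \<T> \<and>
        (\<forall>\<Phi> \<in> P1_zero \<Omega> \<T>. eq_S1 \<Omega> TR L \<epsilon>2 \<epsilon>3 a b c \<beta>1 \<beta>2 \<Delta>t (fst y) (snd y) (fst y') (snd y') \<Phi>) \<and>
        (\<forall>\<psi> \<in> P1_zero \<Omega> \<T>. eq_S2 \<Omega> TR \<epsilon>1 \<epsilon>2 \<epsilon>3 (fst y') (snd y') \<psi>))"
      for n and y y' :: "(real^'n \<Rightarrow> real^'n^'n) \<times> (real^'n \<Rightarrow> real)"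
    have "\<exists>f. \<forall>n. inv n (f n) \<and> step n (f n) (f (Suc n))"
    proof (rule dependent_nat_choice)
      have "affine_on_elements \<T> (\<lambda>x. (Q0 x - qh x) + qh x)" "affine_on_elements \<T> (\<lambda>x. (u0 x - gh 0 x) + gh 0 x)"
        using affine_add[OF P1_zero_affine[OF Q0] qh'] affine_add[OF P1_zero_affine[OF u0] gh'[of 0]] by simp_all
      then show "\<exists>y. inv 0 y" by (intro exI[of _ "(Q0, u0)"]) (simp add: inv_def)
      fix y n assume y: "inv n y"
      show "\<exists>y'. inv (Suc n) y' \<and> step n y y'"
      proof (cases "n < N")
        case True
        obtain Qt ut where 1: "Qt \<in> P1_zero \<Omega> \<T>" "ut \<in> P1_zero \<Omega> \<T>"
          "\<forall>\<Phi>\<in>P1_zero \<Omega> \<T>. eq_S1 \<Omega> TR L \<epsilon>2 \<epsilon>3 a b c \<beta>1 \<beta>2 \<Delta>t (fst y) (snd y) (\<lambda>x. Qt x + qh x) (\<lambda>x. ut x + gh (Suc n) x) \<Phi>"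
          "\<forall>\<psi>\<in>P1_zero \<Omega> \<T>. eq_S2 \<Omega> TR \<epsilon>1 \<epsilon>2 \<epsilon>3 (\<lambda>x. Qt x + qh x) (\<lambda>x. ut x + gh (Suc n) x) \<psi>"
          using scheme_step[of "fst y" "snd y" qh "gh (Suc n)"] y qh' gh'[of "Suc n"] True by (auto simp: inv_def)
        have "inv (Suc n) (\<lambda>x. Qt x + qh x, \<lambda>x. ut x + gh (Suc n) x)"
          using affine_add[OF P1_zero_affine[OF 1(1)] qh'] affine_add[OF P1_zero_affine[OF 1(2)] gh'[of "Suc n"]] True
          by (simp add: inv_def)
        moreover have "step n y (\<lambda>x. Qt x + qh x, \<lambda>x. ut x + gh (Suc n) x)"
          using 1 by (simp add: step_def)
        ultimately show ?thesis by blast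
      next
        \<comment> \<open>Dependent choice builds an infinite sequence, whereas equations are
          imposed only for \<open>n < N\<close>; afterwards the last pair is simply
          repeated.\<close>
        case False
        then show ?thesis using y by (intro exI[of _ y]) (simp add: inv_def step_def)
      qed
    qed
    then obtain f where f: "\<And>n. inv n (f n)" "\<And>n. step n (f n) (f (Suc n))" by blast
    show "\<exists>(Q :: nat \<Rightarrow> real^'n \<Rightarrow> real^'n^'n) (u :: nat \<Rightarrow> real^'n \<Rightarrow> real).
               Q 0 = Q0 \<and> u 0 = u0 \<and>
               (\<forall>n<N.
                  (\<lambda>x. Q (Suc n) x - qh x) \<in> P1_zero \<Omega> \<T> \<and>
                  (\<lambda>x. u (Suc n) x - gh (Suc n) x) \<in> P1_zero \<Omega> \<T> \<and>
                  (\<forall>\<Phi> \<in> P1_zero \<Omega> \<T>.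
                     eq_S1 \<Omega> TR L \<epsilon>2 \<epsilon>3 a b c \<beta>1 \<beta>2 \<Delta>t (Q n) (u n) (Q (Suc n)) (u (Suc n)) \<Phi>) \<and>
                  (\<forall>\<psi> \<in> P1_zero \<Omega> \<T>. eq_S2 \<Omega> TR \<epsilon>1 \<epsilon>2 \<epsilon>3 (Q (Suc n)) (u (Suc n)) \<psi>))"
      using f(1)[of 0] f(2) by (intro exI[of _ "\<lambda>n. fst (f n)"] exI[of _ "\<lambda>n. snd (f n)"]) (simp add: inv_def step_def)
  qed
qed

end
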